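(* Let $f\in C^k([0,1]\times\mathbb{R})$ with $k\geqslant 2$ satisfy $f_y(x,y)\geqslant m>0$ for all $(x,y)\in[0,1]\times\mathbb{R}$, where $m$ is a constant, and let $\gamma$ be a constant with $\gamma\geqslant f_y(x,y)$ for all $(x,y)\in[0,1]\times\mathbb{R}$. For $0<\varepsilon<1$ let $y$ be the unique solution of $\varepsilon^2y''=f(x,y)$ on $(0,1)$, $y(0)=y(1)=0$. Let $x_0,\dots,x_N$ be the points of the modified Shishkin mesh and let $\overline{y}=(\overline{y}_0,\dots,\overline{y}_N)^T$ be the unique solution of the discrete problem $T\overline{y}=0$ on this mesh (mesh and operator $T$ defined in the context). Then the discrete problem is uniformly convergent with respect to $\varepsilon$: there is a constant $C>0$, independent of $N$ and $\varepsilon$, such that $$\left|y(x_i)-\overline{y}_i\right|\leqslant C\begin{cases}(\ln^2N)/N^2, & i=0,\dots,N/4-1,\\ 1/N^2, & i=N/4,\dots,3N/4,\\ (\ln^2N)/N^2, & i=3N/4+1,\dots,N.\end{cases}$$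
   Context: Here $f_y=\partial f/\partial y$. The function $f$ and the constants $m,\gamma$ do not depend on $\varepsilon$ or $N$. Modified Shishkin mesh: $N$ is a positive integer divisible by $4$, $$\lambda=\min\left\{\frac{2\varepsilon\ln N}{\sqrt m},\frac14\right\},\qquad p=32(1-4\lambda),$$ and $x_i=\psi(i/N)$, $i=0,\dots,N$, where $$\psi(t)=\begin{cases}4\lambda t, & t\in[0,1/4],\\ p(t-1/4)^3+4\lambda t, & t\in[1/4,1/2],\\ 1-\psi(1-t), & t\in[1/2,1].\end{cases}$$ Discrete operator: put $h_i=x_{i+1}-x_i$ for $i=0,\dots,N-1$, $\beta=\sqrt{\gamma}/\varepsilon$, and $$a_i=\frac{\cosh(\beta h_i)+1}{\sinh(\beta h_i)},\qquad d_i=\frac{\cosh(\beta h_i)-1}{\sinh(\beta h_i)},\qquad i=0,\dots,N-1 .$$ For $u=(u_0,\dots,u_N)^T\in\mathbb{R}^{N+1}$ let $Tu=(Tu_0,Tu_1,\dots,Tu_N)^T$, where $Tu_0=-u_0$, $Tu_N=-u_N$, and for $i=1,\dots,N-1$ $$Tu_i=\frac{\gamma}{d_{i-1}+d_i}\left[a_{i-1}u_{i-1}-(a_{i-1}+a_i)u_i+a_iu_{i+1}-\frac{f(x_{i-1},u_{i-1})+f(x_i,u_i)}{\gamma}\,d_{i-1}-\frac{f(x_i,u_i)+f(x_{i+1},u_{i+1})}{\gamma}\,d_i\right].$$ The equation $T\overline{y}=0$ has a unique solution $\overline{y}\in\mathbb{R}^{N+1}$ under the stated hypotheses. *)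

theory Defs
  imports "HOL-Analysis.Analysis"
begin

text \<open>
  The class \<open>C\<^sup>k([0,1] \<times> \<real>)\<close>: all partial derivatives up to order \<open>k\<close> exist and are
  continuous on the closed strip, those in \<open>x\<close> being one-sided at \<open>x = 0\<close> and \<open>x = 1\<close>.
  Values of \<open>f\<close> off the strip are irrelevant.
\<close>

primrec Ck_strip :: "nat \<Rightarrow> (real \<Rightarrow> real \<Rightarrow> real) \<Rightarrow> bool" where
  "Ck_strip 0 f \<longleftrightarrow> continuous_on ({0..1} \<times> UNIV) (\<lambda>(x, y). f x y)"
| "Ck_strip (Suc k) f \<longleftrightarrow>
     continuous_on ({0..1} \<times> UNIV) (\<lambda>(x, y). f x y) \<and>
     (\<exists>fx fy.
        (\<forall>x\<in>{0..1}. \<forall>y.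
           ((\<lambda>s. f s y) has_real_derivative fx x y) (at x within {0..1}) \<and>
           ((\<lambda>v. f x v) has_real_derivative fy x y) (at y)) \<and>
        Ck_strip k fx \<and> Ck_strip k fy)"

definition bvp_solution :: "real \<Rightarrow> (real \<Rightarrow> real \<Rightarrow> real) \<Rightarrow> (real \<Rightarrow> real) \<Rightarrow> bool" where
  "bvp_solution \<epsilon> f y \<longleftrightarrow>
     continuous_on {0..1} y \<and> y 0 = 0 \<and> y 1 = 0 \<and>
     (\<exists>y' y''. \<forall>x\<in>{0<..<1}.
        (y has_real_derivative y' x) (at x) \<and>
        (y' has_real_derivative y'' x) (at x) \<and>
        \<epsilon>\<^sup>2 * y'' x = f x (y x))"

definition shishkin_lambda :: "real \<Rightarrow> real \<Rightarrow> nat \<Rightarrow> real" where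
  "shishkin_lambda m \<epsilon> N = min (2 * \<epsilon> * ln (real N) / sqrt m) (1 / 4)"

definition psi_left :: "real \<Rightarrow> real \<Rightarrow> real" where
  "psi_left l t =
     (if t \<le> 1 / 4 then 4 * l * t
      else 32 * (1 - 4 * l) * (t - 1 / 4) ^ 3 + 4 * l * t)"

text \<open>
  The generating function \<open>\<psi>\<close>, with \<open>psi_left\<close> its restriction to \<open>[0,1/2]\<close>. The branches agree
  where they meet; in particular both give \<open>1/2\<close> at \<open>t = 1/2\<close>.
\<close>

definition psi :: "real \<Rightarrow> real \<Rightarrow> real" where
  "psi l t = (if t \<le> 1 / 2 then psi_left l t else 1 - psi_left l (1 - t))"

definition mesh :: "real \<Rightarrow> real \<Rightarrow> nat \<Rightarrow> nat \<Rightarrow> real" where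
  "mesh m \<epsilon> N i = psi (shishkin_lambda m \<epsilon> N) (real i / real N)"

definition mesh_step :: "(nat \<Rightarrow> real) \<Rightarrow> nat \<Rightarrow> real" where
  "mesh_step x i = x (i + 1) - x i"

definition coeff_a :: "real \<Rightarrow> real \<Rightarrow> (nat \<Rightarrow> real) \<Rightarrow> nat \<Rightarrow> real" where
  "coeff_a \<gamma> \<epsilon> x i =
     (let \<beta> = sqrt \<gamma> / \<epsilon>; h = mesh_step x i in (cosh (\<beta> * h) + 1) / sinh (\<beta> * h))"

definition coeff_d :: "real \<Rightarrow> real \<Rightarrow> (nat \<Rightarrow> real) \<Rightarrow> nat \<Rightarrow> real" where
  "coeff_d \<gamma> \<epsilon> x i =
     (let \<beta> = sqrt \<gamma> / \<epsilon>; h = mesh_step x i in (cosh (\<beta> * h) - 1) / sinh (\<beta> * h))"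

text \<open>
  Vectors in \<open>\<real>\<^bsup>N+1\<^esup>\<close> are functions on \<open>nat\<close> of which only the entries \<open>0, \<dots>, N\<close> are used;
  \<open>discrete_T \<dots> u i\<close> is the \<open>i\<close>-th component of \<open>Tu\<close> and is meaningful for \<open>i \<le> N\<close>.
\<close>

definition discrete_T ::
  "(real \<Rightarrow> real \<Rightarrow> real) \<Rightarrow> real \<Rightarrow> real \<Rightarrow> nat \<Rightarrow> (nat \<Rightarrow> real) \<Rightarrow> (nat \<Rightarrow> real) \<Rightarrow> nat \<Rightarrow> real"
where
  "discrete_T f \<gamma> \<epsilon> N x u i =
     (if i = 0 \<or> i = N then - u i
      else
        (let a = coeff_a \<gamma> \<epsilon> x; d = coeff_d \<gamma> \<epsilon> x in
         \<gamma> / (d (i - 1) + d i) *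
         (a (i - 1) * u (i - 1) - (a (i - 1) + a i) * u i + a i * u (i + 1)
          - (f (x (i - 1)) (u (i - 1)) + f (x i) (u i)) / \<gamma> * d (i - 1)
          - (f (x i) (u i) + f (x (i + 1)) (u (i + 1))) / \<gamma> * d i)))"

definition discrete_solution ::
  "(real \<Rightarrow> real \<Rightarrow> real) \<Rightarrow> real \<Rightarrow> real \<Rightarrow> nat \<Rightarrow> (nat \<Rightarrow> real) \<Rightarrow> (nat \<Rightarrow> real) \<Rightarrow> bool"
where
  "discrete_solution f \<gamma> \<epsilon> N x u \<longleftrightarrow> (\<forall>i\<le>N. discrete_T f \<gamma> \<epsilon> N x u i = 0)"

end

theory Submission
  imports Defs
begin

text \<open>
  Write \<open>t\<^sub>i = tanh (\<beta> h\<^sub>i / 2)\<close>. The coefficients of the scheme are \<open>d\<^sub>i = t\<^sub>i\<close> and \<open>a\<^sub>i = 1 / t\<^sub>i\<close>, so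
  \<open>T u = 0\<close> says that a three-point operator, here \<open>fitted_op\<close>, annihilates \<open>u\<close>. The error
  estimate combines stability and consistency of this operator, each of them measured with a
  weight that remembers the distance to the boundary layers.

  Stability. Since \<open>f\<^sub>y\<close> lies in \<open>[m, \<gamma>]\<close> and \<open>t\<^sub>i \<le> 1\<close>, the operator linearised along the segment
  from the discrete to the exact solution is of monotone type, hence the error is dominated by
  any supersolution (\<open>fitted_op_comparison\<close>). A useful supersolution is the discrete exponential
  \<open>\<phi>\<^sub>i = (\<Prod>j<i. 1 / (1 + \<kappa> t\<^sub>j))\<close> with \<open>\<kappa>\<^sup>2 = m / \<gamma>\<close>, on every mesh (\<open>fitted_op_layer_barrier\<close>). It
  dominates \<open>exp (- sqrt m x\<^sub>i / \<epsilon>)\<close>.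

  Consistency. Let \<open>E x = exp (- sqrt m x / \<epsilon>) + exp (- sqrt m (1 - x) / \<epsilon>)\<close>. The maximum principle
  yields \<open>\<bar>y' x\<bar> \<le> C (1 + E x / \<epsilon>)\<close> and \<open>\<bar>y'' x\<bar> \<le> C (1 + E x / \<epsilon>\<^sup>2)\<close>, and differentiating the equation
  yields the same bounds for \<open>\<epsilon>\<^sup>2 y'''\<close> and \<open>\<epsilon>\<^sup>2 y''''\<close> (\<open>solution_layer_bounded\<close>). The rate \<open>sqrt m\<close>
  must not be weakened: it makes \<open>E\<close> of size \<open>1 / N\<^sup>2\<close> at the transition point. The bounds are
  applied to \<open>y\<close> itself, not to a smooth and a layer part. Where the steps are at most a multiple of \<open>\<epsilon>\<close>, a
  Taylor expansion shows that the terms of the residual cancel up to \<open>h\<^sub>i - h\<^sub>i\<^sub>-\<^sub>1\<close> and \<open>h\<^sub>i\<^sup>2\<close> times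
  those bounds (\<open>truncation_fine\<close>); the derivatives of order three and four enter with the weight
  \<open>1 / \<beta>\<^sup>2\<close>, a multiple of \<open>\<epsilon>\<^sup>2\<close>, which is why \<open>f \<in> C\<^sup>2\<close> suffices. Where the steps are larger, the
  divided differences of \<open>y\<close> are compared with those of \<open>x\<^sup>2 / 2 + E x / m\<close>, whose second derivative
  is \<open>1 + E x / \<epsilon>\<^sup>2\<close> (\<open>truncation_coarse\<close>). On the mesh both cases give a residual of at most
  \<open>C (t\<^sub>i\<^sub>-\<^sub>1 + t\<^sub>i) (1 + \<Lambda>\<^sup>2 E x\<^sub>i) / N\<^sup>2\<close> with \<open>\<Lambda> = \<lambda> / \<epsilon>\<close> (\<open>mesh_truncation\<close>).

  Conclusion. The error is at most \<open>A (1 + \<Lambda>\<^sup>2 (\<phi>\<^sub>i + \<phi>\<^sub>N\<^sub>-\<^sub>i)) / N\<^sup>2\<close>. Inside the layers \<open>\<phi> \<le> 1\<close> and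
  \<open>\<Lambda> \<le> 2 ln N / sqrt m\<close> produce the squared logarithm; from the transition point on, \<open>\<phi>\<close> has decayed
  to \<open>O(\<Lambda>\<^sup>-\<^sup>2)\<close> (\<open>layer_barrier_uniform_decay\<close>) and the logarithm disappears.
\<close>

section \<open>The hyperbolic weights\<close>

lemma nonneg_if_deriv_nonneg:
  fixes g g' :: "real \<Rightarrow> real"
  assumes "0 \<le> z" "g 0 = 0"
    and "\<And>s. 0 \<le> s \<Longrightarrow> (g has_real_derivative g' s) (at s)"
    and "\<And>s. 0 \<le> s \<Longrightarrow> 0 \<le> g' s"
  shows "0 \<le> g z"
  using DERIV_nonneg_imp_nondecreasing[of 0 z g] assms by metis

lemma tanh_deriv_real: "(tanh has_real_derivative 1 - tanh s ^ 2) (at (s::real))"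
  by (auto intro!: derivative_eq_intros)

lemma tanh_le_self: "0 \<le> z \<Longrightarrow> tanh z \<le> (z::real)"
  using nonneg_if_deriv_nonneg[of z "\<lambda>z. z - tanh z" "\<lambda>z. tanh z ^ 2"]
    DERIV_diff[OF DERIV_ident tanh_deriv_real] by simp

lemma self_minus_tanh_le_cube:
  assumes "0 \<le> z" shows "z - tanh z \<le> (z::real) ^ 3"
proof -
  have "0 \<le> z ^ 3 - (z - tanh z)"
  proof (rule nonneg_if_deriv_nonneg[of z "\<lambda>z. z ^ 3 - (z - tanh z)" "\<lambda>z. 3 * z\<^sup>2 - tanh z ^ 2"])
    fix s :: real assume s: "0 \<le> s"
    show "((\<lambda>z. z ^ 3 - (z - tanh z)) has_real_derivative 3 * s\<^sup>2 - (tanh s)\<^sup>2) (at s)"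
      by (auto intro!: derivative_eq_intros)
    have "tanh s ^ 2 \<le> s ^ 2" using s tanh_le_self by (intro power_mono) auto
    moreover have "0 \<le> s ^ 2" by simp
    ultimately show "0 \<le> 3 * s\<^sup>2 - (tanh s)\<^sup>2" by linarith
  qed (use assms in auto)
  then show ?thesis by simp
qed

lemma self_le_tanh_times:
  assumes "0 \<le> z" shows "z \<le> tanh z * (1 + (z::real))"
proof -
  have "0 \<le> tanh z * (1 + z) - z"
  proof (rule nonneg_if_deriv_nonneg[of z "\<lambda>z. tanh z * (1 + z) - z"
        "\<lambda>z. (1 - tanh z) * ((1 + tanh z) * (1 + z) - 1)"])
    fix s :: real assume s: "0 \<le> s"
    show "((\<lambda>z. tanh z * (1 + z) - z) has_real_derivative
       (1 - tanh s) * ((1 + tanh s) * (1 + s) - 1)) (at s)"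
      by (auto intro!: derivative_eq_intros simp: power2_eq_square algebra_simps)
    have "1 \<le> (1 + tanh s) * (1 + s)"
      using mult_mono[of 1 "1 + tanh s" 1 "1 + s"] s by auto
    then show "0 \<le> (1 - tanh s) * ((1 + tanh s) * (1 + s) - 1)"
      using tanh_real_lt_1[of s] by (intro mult_nonneg_nonneg) auto
  qed (use assms in auto)
  then show ?thesis by simp
qed

lemma self_le_tanh_times_square:
  assumes "0 \<le> z" shows "z \<le> tanh z * (1 + (z::real)\<^sup>2)"
proof -
  have "0 \<le> tanh z * (1 + z\<^sup>2) - z"
  proof (rule nonneg_if_deriv_nonneg[of z "\<lambda>z. tanh z * (1 + z\<^sup>2) - z"
        "\<lambda>z. z\<^sup>2 * (1 - tanh z ^ 2) + tanh z * (2 * z - tanh z)"])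
    fix s :: real assume s: "0 \<le> s"
    show "((\<lambda>z. tanh z * (1 + z\<^sup>2) - z) has_real_derivative
       s\<^sup>2 * (1 - tanh s ^ 2) + tanh s * (2 * s - tanh s)) (at s)"
      by (auto intro!: derivative_eq_intros simp: power2_eq_square algebra_simps)
    have "tanh s ^ 2 \<le> 1" using tanh_real_lt_1[of s] s by (intro power_le_one) auto
    then show "0 \<le> s\<^sup>2 * (1 - tanh s ^ 2) + tanh s * (2 * s - tanh s)"
      using s tanh_le_self[of s] by (intro add_nonneg_nonneg mult_nonneg_nonneg) auto
  qed (use assms in auto)
  then show ?thesis by simp
qed

text \<open>
  The function \<open>z / tanh z\<close> governs how the coefficient \<open>1 / t\<^sub>i\<close> varies with the step. Its
  derivative is bounded by \<open>1\<close>, which is what counts for steps large compared with \<open>\<epsilon>\<close>, and by \<open>z\<close>,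
  which supplies the extra power of the step needed for small ones.
\<close>

lemma coth_weight_deriv:
  fixes s :: real
  assumes "0 < s"
  defines "D \<equiv> (tanh s - s * (1 - tanh s ^ 2)) / tanh s ^ 2"
  shows "((\<lambda>z. z / tanh z) has_real_derivative D) (at s)" "0 \<le> D" "D \<le> 1" "D \<le> s"
proof -
  have t: "0 < tanh s" "tanh s < 1" "tanh s \<le> s"
    using assms tanh_real_lt_1 tanh_le_self by auto
  show "((\<lambda>z. z / tanh z) has_real_derivative D) (at s)"
    unfolding D_def using t
    by (auto intro!: derivative_eq_intros simp: power2_eq_square)
  have "0 \<le> tanh s - s * (1 - tanh s ^ 2)"
  proof (rule nonneg_if_deriv_nonneg[of s "\<lambda>s. tanh s - s * (1 - tanh s ^ 2)"
        "\<lambda>s. 2 * s * tanh s * (1 - tanh s ^ 2)"])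
    fix s :: real assume s: "0 \<le> s"
    show "((\<lambda>s. tanh s - s * (1 - tanh s ^ 2)) has_real_derivative
        2 * s * tanh s * (1 - tanh s ^ 2)) (at s)"
      by (auto intro!: derivative_eq_intros simp: power2_eq_square algebra_simps)
    have "tanh s ^ 2 \<le> 1" using tanh_real_lt_1[of s] s by (intro power_le_one) auto
    then show "0 \<le> 2 * s * tanh s * (1 - tanh s ^ 2)" using s by simp
  qed (use assms in auto)
  then show "0 \<le> D" unfolding D_def by simp
  have "(1 - tanh s) * tanh s \<le> (1 - tanh s) * (s * (1 + tanh s))"
  proof (intro mult_left_mono)
    show "tanh s \<le> s * (1 + tanh s)" using t by (simp add: algebra_simps add_increasing2)
  qed (use t in auto)
  then have "tanh s - s * (1 - tanh s ^ 2) \<le> tanh s ^ 2"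
    by (simp add: power2_eq_square algebra_simps)
  then show "D \<le> 1" unfolding D_def using t by (simp add: divide_le_eq)
  have "tanh s - s * (1 - tanh s ^ 2) \<le> s * tanh s ^ 2"
    using t by (simp add: algebra_simps)
  then show "D \<le> s" unfolding D_def using t by (simp add: divide_le_eq)
qed

lemma coth_weight_diff:
  fixes z w :: real
  assumes "0 < z" "z \<le> w"
  shows "0 \<le> w / tanh w - z / tanh z" "w / tanh w - z / tanh z \<le> w - z"
    "w / tanh w - z / tanh z \<le> w * (w - z)"
proof -
  define g where "g = (\<lambda>z::real. z / tanh z)"
  define D where "D = (\<lambda>s::real. (tanh s - s * (1 - tanh s ^ 2)) / tanh s ^ 2)"
  have "\<exists>\<xi>. z \<le> \<xi> \<and> \<xi> \<le> w \<and> g w - g z = (w - z) * D \<xi>"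
  proof (cases "z = w")
    case False
    then show ?thesis
      using MVT2[of z w g D] coth_weight_deriv(1) assms unfolding g_def D_def
      by (smt (verit, del_insts))
  qed auto
  then obtain \<xi> where \<xi>: "z \<le> \<xi>" "\<xi> \<le> w" "g w - g z = (w - z) * D \<xi>" by blast
  have "0 < \<xi>" using \<xi> assms by auto
  from coth_weight_deriv(2-4)[OF this] have D: "0 \<le> D \<xi>" "D \<xi> \<le> 1" "D \<xi> \<le> \<xi>"
    unfolding D_def by auto
  show "0 \<le> w / tanh w - z / tanh z"
    using \<xi>(3) D assms unfolding g_def by simp
  show "w / tanh w - z / tanh z \<le> w - z"
    using \<xi>(3) mult_left_mono[OF D(2), of "w - z"] assms unfolding g_def by simp
  show "w / tanh w - z / tanh z \<le> w * (w - z)"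
    using \<xi> mult_left_mono[of "D \<xi>" w "w - z"] D assms unfolding g_def
    by (simp add: mult.commute)
qed

lemma tanh_diff_le:
  fixes z w :: real
  assumes "0 \<le> z" "z \<le> w" shows "tanh w - tanh z \<le> w - z"
proof -
  have "z - tanh z \<le> w - tanh w"
  proof (rule DERIV_nonneg_imp_nondecreasing[OF assms(2)])
    fix x show "\<exists>y. ((\<lambda>x. x - tanh x) has_real_derivative y) (at x) \<and> 0 \<le> y"
      by (rule exI[of _ "tanh x ^ 2"]) (auto intro!: derivative_eq_intros)
  qed
  then show ?thesis by simp
qed

lemma self_tanh_diff_le:
  fixes z w :: real
  assumes "0 \<le> z" "z \<le> w"
  shows "0 \<le> w * tanh w - z * tanh z" "w * tanh w - z * tanh z \<le> 2 * w * (w - z)"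
proof -
  have "z * tanh z \<le> w * tanh w" using assms by (intro mult_mono) auto
  then show "0 \<le> w * tanh w - z * tanh z" by simp
  have "w * tanh w - z * tanh z = (w - z) * tanh w + z * (tanh w - tanh z)"
    by (simp add: algebra_simps)
  also have "\<dots> \<le> (w - z) * w + w * (w - z)"
    using assms tanh_le_self[of w] tanh_diff_le[of z w]
    by (intro add_mono mult_mono) auto
  finally show "w * tanh w - z * tanh z \<le> 2 * w * (w - z)" by (simp add: algebra_simps)
qed

section \<open>The discrete operator and its comparison principle\<close>

text \<open>
  The bracket in the discrete operator at the node \<open>j + 1\<close>, for \<open>t\<^sub>i = d\<^sub>i = 1 / a\<^sub>i\<close>. The values \<open>v\<close> of
  the reaction term are kept apart from the nodal values \<open>u\<close>, so that the operator is linear and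
  serves the nonlinear scheme, its linearisation and the barriers alike.
\<close>

definition fitted_op ::
  "real \<Rightarrow> (nat \<Rightarrow> real) \<Rightarrow> (nat \<Rightarrow> real) \<Rightarrow> (nat \<Rightarrow> real) \<Rightarrow> nat \<Rightarrow> real" where
  "fitted_op \<gamma> t u v j =
     (u (Suc (Suc j)) - u (Suc j)) / t (Suc j) - (u (Suc j) - u j) / t j
     - (t j * (v j + v (Suc j)) + t (Suc j) * (v (Suc j) + v (Suc (Suc j)))) / \<gamma>"

lemma fitted_op_add:
  "fitted_op \<gamma> t (\<lambda>i. u i + u' i) (\<lambda>i. v i + v' i) j = fitted_op \<gamma> t u v j + fitted_op \<gamma> t u' v' j"
  by (simp add: fitted_op_def diff_divide_distrib add_divide_distrib algebra_simps)

lemma fitted_op_scale: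
  "fitted_op \<gamma> t (\<lambda>i. c * u i) (\<lambda>i. c * v i) j = c * fitted_op \<gamma> t u v j"
proof -
  have *: "c * x / t = c * (x / t)" for x t :: real by simp
  show ?thesis
    unfolding fitted_op_def right_diff_distrib[symmetric] distrib_left[symmetric]
      mult.left_commute[of _ c] * ..
qed

lemma fitted_op_diff:
  "fitted_op \<gamma> t (\<lambda>i. u i - u' i) (\<lambda>i. v i - v' i) j = fitted_op \<gamma> t u v j - fitted_op \<gamma> t u' v' j"
  by (simp add: fitted_op_def diff_divide_distrib add_divide_distrib algebra_simps)

text \<open>
  At a negative minimum both differences to the neighbours are nonnegative, and their effective
  coefficients \<open>1 / t - t q / \<gamma>\<close> are nonnegative because \<open>t \<le> 1\<close> and \<open>q \<le> \<gamma>\<close>; the zero-order term is then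
  strictly positive.
\<close>

lemma fitted_op_minimum_principle:
  fixes t q w :: "nat \<Rightarrow> real"
  assumes "0 < \<gamma>" "0 < m"
    and t: "\<And>i. i < N \<Longrightarrow> 0 < t i \<and> t i \<le> 1"
    and q: "\<And>i. i \<le> N \<Longrightarrow> m \<le> q i \<and> q i \<le> \<gamma>"
    and bd: "0 \<le> w 0" "0 \<le> w N"
    and L: "\<And>j. Suc j < N \<Longrightarrow> fitted_op \<gamma> t w (\<lambda>i. q i * w i) j \<le> 0"
    and "i \<le> N"
  shows "0 \<le> w i"
proof (rule ccontr)
  assume neg: "\<not> 0 \<le> w i"
  define k where "k = arg_min_on w {..N}"
  have k: "k \<le> N" "\<And>l. l \<le> N \<Longrightarrow> w k \<le> w l"
    using arg_min_if_finite(1)[of "{..N}" w] arg_min_least[of "{..N}" _ w]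
    unfolding k_def by auto
  have wk: "w k < 0" using k(2)[OF \<open>i \<le> N\<close>] neg by simp
  then have "k \<noteq> 0" "k \<noteq> N" using bd by (metis not_less)+
  then obtain j where j: "k = Suc j" "Suc j < N" using k(1) by (metis le_neq_implies_less not0_implies_Suc)
  let ?l = "w j" and ?c = "w (Suc j)" and ?r = "w (Suc (Suc j))"
  have tj: "0 < t j" "t j \<le> 1" "0 < t (Suc j)" "t (Suc j) \<le> 1" using t j by auto
  have qj: "m \<le> q j" "q j \<le> \<gamma>" "m \<le> q (Suc j)" "m \<le> q (Suc (Suc j))" "q (Suc (Suc j)) \<le> \<gamma>"
    using q j by auto
  have coeff: "0 \<le> 1 / s - s * p / \<gamma>" if "0 < s" "s \<le> 1" "p \<le> \<gamma>" for s p :: real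
  proof -
    have "s * p / \<gamma> \<le> s * 1"
      using that \<open>0 < \<gamma>\<close> by (simp add: divide_le_eq mult_left_mono)
    also have "s * 1 \<le> 1 / s" using that mult_le_one[of s s] by (simp add: le_divide_eq)
    finally show ?thesis by simp
  qed
  have "0 \<le> (1 / t (Suc j) - t (Suc j) * q (Suc (Suc j)) / \<gamma>) * (?r - ?c)"
    using coeff tj qj k(2)[of "Suc (Suc j)"] j by (intro mult_nonneg_nonneg) auto
  moreover have "0 \<le> (1 / t j - t j * q j / \<gamma>) * (?l - ?c)"
    using coeff tj qj k(2)[of j] j by (intro mult_nonneg_nonneg) auto
  moreover have "0 < (t j * (q j + q (Suc j)) + t (Suc j) * (q (Suc j) + q (Suc (Suc j)))) / \<gamma> * (- ?c)"
    using tj qj \<open>0 < m\<close> \<open>0 < \<gamma>\<close> wk j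
    by (intro mult_pos_pos divide_pos_pos add_pos_pos) auto
  moreover have "fitted_op \<gamma> t w (\<lambda>i. q i * w i) j =
      (1 / t (Suc j) - t (Suc j) * q (Suc (Suc j)) / \<gamma>) * (?r - ?c)
    + (1 / t j - t j * q j / \<gamma>) * (?l - ?c)
    + (t j * (q j + q (Suc j)) + t (Suc j) * (q (Suc j) + q (Suc (Suc j)))) / \<gamma> * (- ?c)"
    unfolding fitted_op_def
    by (simp add: diff_divide_distrib add_divide_distrib algebra_simps)
  ultimately show False using L[OF j(2)] by linarith
qed

text \<open>
  The coefficient \<open>q\<close> comes from the mean value theorem and is only known to lie in \<open>[m, \<gamma>]\<close>; for a
  nonnegative barrier it may be replaced by its lower bound \<open>m\<close>.
\<close>

lemma fitted_op_comparison:
  fixes t q e \<phi> :: "nat \<Rightarrow> real"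
  assumes "0 < \<gamma>" "0 < m"
    and t: "\<And>i. i < N \<Longrightarrow> 0 < t i \<and> t i \<le> 1"
    and q: "\<And>i. i \<le> N \<Longrightarrow> m \<le> q i \<and> q i \<le> \<gamma>"
    and e: "e 0 = 0" "e N = 0"
    and \<phi>: "\<And>i. i \<le> N \<Longrightarrow> 0 \<le> \<phi> i"
    and L: "\<And>j. Suc j < N \<Longrightarrow>
        \<bar>fitted_op \<gamma> t e (\<lambda>i. q i * e i) j\<bar> \<le> - fitted_op \<gamma> t \<phi> (\<lambda>i. m * \<phi> i) j"
    and "i \<le> N"
  shows "\<bar>e i\<bar> \<le> \<phi> i"
proof -
  have super: "fitted_op \<gamma> t \<phi> (\<lambda>i. q i * \<phi> i) j \<le> fitted_op \<gamma> t \<phi> (\<lambda>i. m * \<phi> i) j"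
    if "Suc j < N" for j
    unfolding fitted_op_def
    using that t[of j] t[of "Suc j"] q[of j] q[of "Suc j"] q[of "Suc (Suc j)"]
      \<phi>[of j] \<phi>[of "Suc j"] \<phi>[of "Suc (Suc j)"] \<open>0 < \<gamma>\<close>
    by (intro diff_left_mono divide_right_mono add_mono mult_left_mono mult_right_mono) auto
  have "0 \<le> \<phi> i - e i"
  proof (rule fitted_op_minimum_principle[OF assms(1,2) t q, where N = N])
    fix j assume j: "Suc j < N"
    show "fitted_op \<gamma> t (\<lambda>i. \<phi> i - e i) (\<lambda>i. q i * (\<phi> i - e i)) j \<le> 0"
      using L[OF j] super[OF j] fitted_op_diff[of \<gamma> t \<phi> e "\<lambda>i. q i * \<phi> i" "\<lambda>i. q i * e i" j]
      by (simp add: right_diff_distrib)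
  qed (use e \<phi> assms in auto)
  moreover have "0 \<le> \<phi> i + e i"
  proof (rule fitted_op_minimum_principle[OF assms(1,2) t q, where N = N])
    fix j assume j: "Suc j < N"
    show "fitted_op \<gamma> t (\<lambda>i. \<phi> i + e i) (\<lambda>i. q i * (\<phi> i + e i)) j \<le> 0"
      using L[OF j] super[OF j] fitted_op_add[of \<gamma> t \<phi> e "\<lambda>i. q i * \<phi> i" "\<lambda>i. q i * e i" j]
      by (simp add: distrib_left)
  qed (use e \<phi> assms in auto)
  ultimately show ?thesis by simp
qed

section \<open>A discrete exponential as barrier\<close>

definition layer_barrier :: "real \<Rightarrow> (nat \<Rightarrow> real) \<Rightarrow> nat \<Rightarrow> real" where
  "layer_barrier \<kappa> t i = (\<Prod>j<i. 1 / (1 + \<kappa> * t j))"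

lemma layer_barrier_bounds:
  assumes "0 \<le> \<kappa>" "\<And>j. j < i \<Longrightarrow> 0 \<le> t j"
  shows "0 < layer_barrier \<kappa> t i" "layer_barrier \<kappa> t i \<le> 1"
proof -
  have p: "0 < 1 + \<kappa> * t j" if "j < i" for j
    using assms that by (simp add: add_pos_nonneg)
  then show "0 < layer_barrier \<kappa> t i" unfolding layer_barrier_def by (intro prod_pos) auto
  show "layer_barrier \<kappa> t i \<le> 1"
    unfolding layer_barrier_def using p assms by (intro prod_le_1) (auto simp: divide_le_eq)
qed

lemma layer_barrier_antimono:
  assumes "0 \<le> \<kappa>" "\<And>j. j < k \<Longrightarrow> 0 \<le> t j" "i \<le> k"
  shows "layer_barrier \<kappa> t k \<le> layer_barrier \<kappa> t i"
  using assms(3,2)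
proof (induction k rule: dec_induct)
  case (step n)
  have "layer_barrier \<kappa> t (Suc n) = layer_barrier \<kappa> t n * (1 / (1 + \<kappa> * t n))"
    by (simp add: layer_barrier_def)
  also have "\<dots> \<le> layer_barrier \<kappa> t n * 1"
    using step assms(1) layer_barrier_bounds(1)[of \<kappa> n t]
    by (intro mult_left_mono) (auto simp: divide_le_eq add_pos_nonneg)
  finally show ?case using step by simp
qed simp

lemma exp_le_layer_barrier:
  assumes "0 \<le> \<kappa>" "\<And>j. j < i \<Longrightarrow> 0 \<le> t j"
  shows "exp (- \<kappa> * (\<Sum>j<i. t j)) \<le> layer_barrier \<kappa> t i"
proof -
  have "exp (- \<kappa> * (\<Sum>j<i. t j)) = (\<Prod>j<i. exp (- (\<kappa> * t j)))"
    by (simp add: exp_sum[symmetric] sum_distrib_left sum_negf)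
  also have "\<dots> \<le> (\<Prod>j<i. 1 / (1 + \<kappa> * t j))"
  proof (intro prod_mono conjI)
    fix j assume "j \<in> {..<i}"
    then have "0 < 1 + \<kappa> * t j" using assms by (simp add: add_pos_nonneg)
    then show "exp (- (\<kappa> * t j)) \<le> 1 / (1 + \<kappa> * t j)"
      using exp_ge_add_one_self[of "\<kappa> * t j"]
      by (simp add: exp_minus inverse_eq_divide frac_le)
  qed auto
  finally show ?thesis unfolding layer_barrier_def .
qed

text \<open>
  The factors \<open>1 + \<kappa> t\<^sub>j\<close> are chosen so that \<open>(\<phi>\<^sub>i\<^sub>+\<^sub>1 - \<phi>\<^sub>i) / t\<^sub>i = - \<kappa> \<phi>\<^sub>i\<^sub>+\<^sub>1\<close>: the second difference is
  then exactly \<open>\<kappa>\<^sup>2 t \<phi>\<close>, which one of the four reaction terms absorbs. Sampling a true exponential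
  would fail on steps much larger than \<open>\<epsilon>\<close>.
\<close>

lemma fitted_op_layer_barrier:
  fixes t :: "nat \<Rightarrow> real"
  assumes "0 < \<gamma>" "0 \<le> m" "0 \<le> \<kappa>" "\<kappa>\<^sup>2 \<le> m / \<gamma>" "\<And>i. i \<le> Suc j \<Longrightarrow> 0 < t i"
  defines "\<phi> \<equiv> layer_barrier \<kappa> t"
  shows "fitted_op \<gamma> t \<phi> (\<lambda>i. m * \<phi> i) j \<le> - (m / \<gamma>) * (t j + t (Suc j)) * \<phi> (Suc j)"
proof -
  define T where "T = t j"
  define S where "S = t (Suc j)"
  have T: "0 < T" "0 < S" using assms(5)[of j] assms(5)[of "Suc j"] by (auto simp: T_def S_def)
  define A where "A = \<phi> j"
  define B where "B = \<phi> (Suc j)"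
  define C where "C = \<phi> (Suc (Suc j))"
  have "0 \<le> \<kappa> * T" "0 \<le> \<kappa> * S" using assms(3) T by auto
  then have pos: "0 < 1 + \<kappa> * T" "0 < 1 + \<kappa> * S" by linarith+
  have "B = A * (1 / (1 + \<kappa> * T))" unfolding A_def B_def T_def \<phi>_def layer_barrier_def by simp
  then have A: "A = B * (1 + \<kappa> * T)" using pos by simp
  have "C = B * (1 / (1 + \<kappa> * S))" unfolding C_def B_def S_def \<phi>_def layer_barrier_def by simp
  then have B: "B = C * (1 + \<kappa> * S)" using pos by simp
  have C0: "0 \<le> C" unfolding C_def \<phi>_def using assms(3,5)
    by (intro less_imp_le[OF layer_barrier_bounds(1)]) (auto simp: less_Suc_eq_le less_imp_le)
  have B0: "0 \<le> B" unfolding B_def \<phi>_def using assms(3,5)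
    by (intro less_imp_le[OF layer_barrier_bounds(1)]) (auto simp: less_Suc_eq_le less_imp_le)
  have AB: "B \<le> A" using A B0 T assms(3) by (simp add: distrib_left)
  have "(C - B) / S - (B - A) / T = \<kappa>\<^sup>2 * S * C"
    unfolding A B using T by (simp add: field_simps power2_eq_square)
  also have "\<dots> \<le> m / \<gamma> * S * C"
    using assms(4) T C0 by (intro mult_right_mono) auto
  finally have "(C - B) / S - (B - A) / T \<le> m / \<gamma> * S * C" .
  moreover have "m / \<gamma> * T * B \<le> m / \<gamma> * T * A"
    using AB T assms(1,2) by (intro mult_left_mono) auto
  moreover have "0 \<le> m / \<gamma> * T * B" using B0 T assms(1,2) by simp
  moreover have "fitted_op \<gamma> t \<phi> (\<lambda>i. m * \<phi> i) j = (C - B) / S - (B - A) / T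
     - (m / \<gamma> * T * A + m / \<gamma> * T * B + m / \<gamma> * S * B + m / \<gamma> * S * C)"
    unfolding fitted_op_def A_def B_def C_def S_def T_def
    by (simp add: add_divide_distrib algebra_simps)
  ultimately have "fitted_op \<gamma> t \<phi> (\<lambda>i. m * \<phi> i) j \<le> - (m / \<gamma> * T * B + m / \<gamma> * S * B)"
    by linarith
  then show "fitted_op \<gamma> t \<phi> (\<lambda>i. m * \<phi> i) j \<le> - (m / \<gamma>) * (t j + t (Suc j)) * \<phi> (Suc j)"
    unfolding B_def S_def T_def by (simp add: algebra_simps)
qed

lemma fitted_op_reverse:
  assumes "Suc j < N" "\<And>i. i < N \<Longrightarrow> t (N - Suc i) = t i"
  shows "fitted_op \<gamma> t (\<lambda>i. u (N - i)) (\<lambda>i. v (N - i)) j = fitted_op \<gamma> t u v (N - Suc (Suc j))"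
proof -
  obtain k where k: "N = Suc (Suc (j + k))" using assms(1) by (metis less_iff_Suc_add add_Suc)
  have "t j = t (Suc k)" "t (Suc j) = t k"
    using assms(2)[of j] assms(2)[of "Suc j"] k by (simp_all add: Suc_diff_le)
  then show ?thesis unfolding fitted_op_def k
    by (simp add: Suc_diff_le diff_divide_distrib algebra_simps)
qed

text \<open>
  On \<open>n\<close> equal steps the barrier is at most \<open>exp (- c n z)\<close>, where \<open>c\<close> depends on \<open>\<kappa>\<close> and \<open>Z\<close>, and \<open>s\<^sup>2 exp (- s)\<close> is bounded. This is what
  removes the logarithm beyond the transition point.
\<close>

lemma layer_barrier_uniform_decay:
  fixes z \<kappa> :: real
  assumes "0 < z" "z \<le> Z" "0 < \<kappa>" "\<kappa> \<le> 1" "\<And>j. j < n \<Longrightarrow> t j = tanh z"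
  shows "layer_barrier \<kappa> t n * (n * z)\<^sup>2 \<le> 8 * (1 + Z)\<^sup>2 / \<kappa>\<^sup>2"
proof -
  define x where "x = \<kappa> * tanh z"
  have t: "0 < tanh z" "tanh z < 1" using assms tanh_real_lt_1 by auto
  have x: "0 < x" "x \<le> 1" unfolding x_def using assms t mult_mono[of \<kappa> 1 "tanh z" 1] by auto
  have zx: "\<kappa> * z \<le> x * (1 + Z)"
  proof -
    have "z \<le> tanh z * (1 + Z)"
      using self_le_tanh_times[of z] mult_left_mono[of "1 + z" "1 + Z" "tanh z"] assms t by linarith
    from mult_left_mono[OF this, of \<kappa>] show ?thesis unfolding x_def using assms by simp
  qed
  have ge: "exp (x / 2) \<le> 1 + x"
  proof -
    have "exp (x / 2) \<le> 1 + x / 2 + (x / 2)\<^sup>2" using x by (intro exp_bound) auto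
    also have "(x / 2)\<^sup>2 \<le> x / 2" using x mult_left_mono[of x 1 x] by (simp add: power2_eq_square)
    finally show ?thesis by simp
  qed
  define s where "s = n * x / 2"
  have s0: "0 \<le> s" unfolding s_def using x by simp
  have "s\<^sup>2 / 2 \<le> exp s"
    using exp_lower_Taylor_quadratic[OF s0] s0 by linarith
  also have "exp s = exp (x / 2) ^ n"
    by (simp add: s_def exp_of_nat_mult[symmetric])
  also have "\<dots> \<le> (1 + x) ^ n" using ge by (intro power_mono) auto
  finally have s: "s\<^sup>2 / 2 \<le> (1 + x) ^ n" .
  have "layer_barrier \<kappa> t n = (1 / (1 + x)) ^ n"
    unfolding layer_barrier_def x_def using assms(5) by simp
  then have lb: "layer_barrier \<kappa> t n = 1 / (1 + x) ^ n" by (simp add: power_one_over)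
  have "(n * z)\<^sup>2 * \<kappa>\<^sup>2 = (n * (\<kappa> * z))\<^sup>2" by (simp add: power_mult_distrib)
  also have "\<dots> \<le> (n * (x * (1 + Z)))\<^sup>2"
    using zx assms by (intro power_mono mult_left_mono) auto
  also have "\<dots> = s\<^sup>2 / 2 * 8 * (1 + Z)\<^sup>2" unfolding s_def by (simp add: power_mult_distrib power_divide)
  also have "\<dots> \<le> (1 + x) ^ n * 8 * (1 + Z)\<^sup>2" using s by (intro mult_right_mono) auto
  finally show ?thesis unfolding lb using assms x by (simp add: field_simps)
qed

section \<open>Layer bounds for the solution and its derivatives\<close>

text \<open>
  At a negative interior minimum \<open>w'\<close> vanishes and \<open>w''\<close> is negative, so \<open>w\<close> would decrease further to
  the right. Negativity of \<open>w''\<close> is required only where \<open>w\<close> is negative, which suits nonlinear equations.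
\<close>

lemma continuous_minimum_principle:
  fixes w w' w'' :: "real \<Rightarrow> real"
  assumes cont: "continuous_on {0..1} w"
    and deriv1: "\<And>x. 0 < x \<Longrightarrow> x < 1 \<Longrightarrow> (w has_real_derivative w' x) (at x)"
    and deriv2: "\<And>x. 0 < x \<Longrightarrow> x < 1 \<Longrightarrow> (w' has_real_derivative w'' x) (at x)"
    and bd: "0 \<le> w 0" "0 \<le> w 1"
    and neg: "\<And>x. 0 < x \<Longrightarrow> x < 1 \<Longrightarrow> w x < 0 \<Longrightarrow> w'' x < 0"
    and x: "x \<in> {0..1}"
  shows "0 \<le> w x"
proof (rule ccontr)
  assume nx: "\<not> 0 \<le> w x"
  obtain c where c: "c \<in> {0..1}" "\<And>s. s \<in> {0..1} \<Longrightarrow> w c \<le> w s"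
    using continuous_attains_inf[OF _ _ cont] by auto
  have wc: "w c < 0" using c(2)[OF x] nx by simp
  with c(1) bd have c01: "0 < c" "c < 1" by (auto simp: less_le)
  have "w' c = 0"
  proof (rule DERIV_local_min[OF deriv1[OF c01], of "min c (1 - c)"])
    show "\<forall>s. \<bar>c - s\<bar> < min c (1 - c) \<longrightarrow> w c \<le> w s" by (auto intro!: c(2))
  qed (use c01 in auto)
  moreover obtain d where d: "0 < d" "\<And>h. 0 < h \<Longrightarrow> h < d \<Longrightarrow> w' (c + h) < w' c"
    using DERIV_neg_dec_right[OF deriv2[OF c01] neg[OF c01 wc]] by blast
  ultimately have dec: "w' s < 0" if "c < s" "s < c + d" for s
    using d(2)[of "s - c"] that by simp
  define b where "b = min (c + d / 2) ((c + 1) / 2)"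
  have b: "c < b" "b < c + d" "b < 1" unfolding b_def using c01 d(1) by (auto simp: min_def)
  have "w b < w c"
  proof (rule DERIV_neg_imp_decreasing_open[OF b(1)])
    fix s assume s: "c < s" "s < b"
    with b c01 show "\<exists>y. (w has_real_derivative y) (at s) \<and> y < 0"
      by (intro exI[of _ "w' s"] conjI deriv1 dec) auto
  next
    show "continuous_on {c..b} w"
      using c01 b by (intro continuous_on_subset[OF cont]) auto
  qed
  moreover have "w c \<le> w b" using b c01 by (intro c(2)) auto
  ultimately show False by simp
qed

definition layer :: "real \<Rightarrow> real \<Rightarrow> real \<Rightarrow> real" where
  "layer m \<epsilon> x = exp (- (sqrt m * x / \<epsilon>))"

definition layers :: "real \<Rightarrow> real \<Rightarrow> real \<Rightarrow> real" where
  "layers m \<epsilon> x = layer m \<epsilon> x + layer m \<epsilon> (1 - x)"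

text \<open>
  The function \<open>D 0\<close> with its derivatives \<open>D 1, \<dots>, D 4\<close>. The derivatives are one-sided at the
  end points so that Taylor's formula can be used on the cells that touch the boundary.
\<close>

definition layer_bounded :: "real \<Rightarrow> real \<Rightarrow> real \<Rightarrow> (nat \<Rightarrow> real \<Rightarrow> real) \<Rightarrow> bool" where
  "layer_bounded C m \<epsilon> D \<longleftrightarrow>
     (\<forall>i<4. \<forall>x\<in>{0..1}. (D i has_real_derivative D (Suc i) x) (at x within {0..1})) \<and>
     (\<forall>x\<in>{0..1}. \<bar>D 1 x\<bar> \<le> C * (1 + layers m \<epsilon> x / \<epsilon>) \<and>
                 \<bar>D 2 x\<bar> \<le> C * (1 + layers m \<epsilon> x / \<epsilon>\<^sup>2) \<and>
                 \<epsilon>\<^sup>2 * \<bar>D 3 x\<bar> \<le> C * (1 + layers m \<epsilon> x / \<epsilon>) \<and>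
                 \<epsilon>\<^sup>2 * \<bar>D 4 x\<bar> \<le> C * (1 + layers m \<epsilon> x / \<epsilon>\<^sup>2))"

lemma layer_pos [simp]: "0 < layer m \<epsilon> x"
  by (simp add: layer_def)

lemma layer_le_1: "0 \<le> m \<Longrightarrow> 0 < \<epsilon> \<Longrightarrow> 0 \<le> x \<Longrightarrow> layer m \<epsilon> x \<le> 1"
  by (simp add: layer_def)

lemma layer_add: "layer m \<epsilon> (x + y) = layer m \<epsilon> x * layer m \<epsilon> y"
  by (simp add: layer_def distrib_left add_divide_distrib exp_add[symmetric])

lemma layer_antimono: "0 \<le> m \<Longrightarrow> 0 < \<epsilon> \<Longrightarrow> x \<le> y \<Longrightarrow> layer m \<epsilon> y \<le> layer m \<epsilon> x"
  by (simp add: layer_def divide_right_mono mult_left_mono)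

lemma layer_deriv: "(layer m \<epsilon> has_real_derivative - (sqrt m / \<epsilon>) * layer m \<epsilon> x) (at x within S)"
proof -
  have "(\<lambda>x. exp (- (sqrt m / \<epsilon>) * x)) = layer m \<epsilon>" by (auto simp: layer_def)
  moreover have "((\<lambda>x. exp (- (sqrt m / \<epsilon>) * x)) has_real_derivative
      - (sqrt m / \<epsilon>) * exp (- (sqrt m / \<epsilon>) * x)) (at x within S)"
    by (rule derivative_eq_intros refl | simp)+
  ultimately show ?thesis by (simp add: layer_def)
qed

lemma layer_reflected_deriv:
  "((\<lambda>x. layer m \<epsilon> (1 - x)) has_real_derivative sqrt m / \<epsilon> * layer m \<epsilon> (1 - x)) (at x within S)"
  using DERIV_chain'[OF DERIV_diff[OF DERIV_const[of 1] DERIV_ident] layer_deriv[of m \<epsilon> "1 - x" UNIV]]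
  by simp

lemma layers_nonneg [simp]: "0 \<le> layers m \<epsilon> x"
  unfolding layers_def by (intro add_nonneg_nonneg less_imp_le layer_pos)

lemma layers_reflect [simp]: "layers m \<epsilon> (1 - x) = layers m \<epsilon> x"
  by (simp add: layers_def)

lemma layer_bounded_reflect:
  assumes "layer_bounded C m \<epsilon> D"
  shows "layer_bounded C m \<epsilon> (\<lambda>i x. (- 1) ^ i * D i (1 - x))"
proof -
  have "((\<lambda>x. (- 1) ^ i * D i (1 - x)) has_real_derivative (- 1) ^ Suc i * D (Suc i) (1 - x))
     (at x within {0..1})" if "i < 4" "x \<in> {0..1}" for i x
  proof -
    have *: "(\<lambda>x::real. 1 - x) ` {0..1} = {0..1}" by (metis Groups.cancel_comm_monoid_add_class.diff_cancel diff_zero image_diff_atLeastAtMost)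
    have "(D i has_real_derivative D (Suc i) (1 - x)) (at (1 - x) within (\<lambda>x. 1 - x) ` {0..1})"
      using assms that unfolding layer_bounded_def * by auto
    from DERIV_image_chain[OF this DERIV_diff[OF DERIV_const DERIV_ident]]
    have "((\<lambda>x. D i (1 - x)) has_real_derivative D (Suc i) (1 - x) * (- 1)) (at x within {0..1})"
      by (simp add: o_def)
    from DERIV_cmult[OF this, of "(- 1) ^ i"] show ?thesis by (simp add: algebra_simps)
  qed
  moreover have "\<bar>D 1 (1 - x)\<bar> \<le> C * (1 + layers m \<epsilon> x / \<epsilon>) \<and>
                 \<bar>D 2 (1 - x)\<bar> \<le> C * (1 + layers m \<epsilon> x / \<epsilon>\<^sup>2) \<and>
                 \<epsilon>\<^sup>2 * \<bar>D 3 (1 - x)\<bar> \<le> C * (1 + layers m \<epsilon> x / \<epsilon>) \<and>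
                 \<epsilon>\<^sup>2 * \<bar>D 4 (1 - x)\<bar> \<le> C * (1 + layers m \<epsilon> x / \<epsilon>\<^sup>2)"
    if "x \<in> {0..1}" for x
  proof -
    have "1 - x \<in> {0..1}" using that by auto
    moreover have "\<forall>x\<in>{0..1}. \<bar>D 1 x\<bar> \<le> C * (1 + layers m \<epsilon> x / \<epsilon>) \<and>
                 \<bar>D 2 x\<bar> \<le> C * (1 + layers m \<epsilon> x / \<epsilon>\<^sup>2) \<and>
                 \<epsilon>\<^sup>2 * \<bar>D 3 x\<bar> \<le> C * (1 + layers m \<epsilon> x / \<epsilon>) \<and>
                 \<epsilon>\<^sup>2 * \<bar>D 4 x\<bar> \<le> C * (1 + layers m \<epsilon> x / \<epsilon>\<^sup>2)"
      using assms unfolding layer_bounded_def by (rule conjunct2)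
    ultimately show ?thesis using layers_reflect[of m \<epsilon> x] by fastforce
  qed
  ultimately show ?thesis unfolding layer_bounded_def by (simp add: abs_mult)
qed

lemma Ck_strip_Suc: "Ck_strip (Suc k) f \<Longrightarrow> Ck_strip k f"
proof (induction k arbitrary: f)
  case (Suc k)
  from Suc.prems obtain fx fy where
    "\<forall>x\<in>{0..1}. \<forall>y. ((\<lambda>s. f s y) has_real_derivative fx x y) (at x within {0..1}) \<and>
        ((\<lambda>v. f x v) has_real_derivative fy x y) (at y)"
    and "Ck_strip (Suc k) fx" "Ck_strip (Suc k) fy" and "continuous_on ({0..1} \<times> UNIV) (\<lambda>(x, y). f x y)"
    unfolding Ck_strip.simps(2)[of "Suc k"] by blast
  with Suc.IH show ?case unfolding Ck_strip.simps(2)[of k] by blast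
qed simp

lemma Ck_strip_mono: "Ck_strip k f \<Longrightarrow> n \<le> k \<Longrightarrow> Ck_strip n f"
proof (induction k)
  case (Suc k)
  then show ?case using Ck_strip_Suc[of k f] by (cases "n = Suc k") (simp_all del: Ck_strip.simps)
qed (simp del: Ck_strip.simps)

text \<open>
  Partial derivatives alone do not give the chain rule; continuity of one of them does.
\<close>

lemma has_real_derivative_along_curve:
  fixes g gx gy :: "real \<Rightarrow> real \<Rightarrow> real"
  assumes gx: "((\<lambda>s. g s (y x)) has_real_derivative gx x (y x)) (at x within {0..1})"
    and gy: "\<And>x v. x \<in> {0..1} \<Longrightarrow> ((\<lambda>v. g x v) has_real_derivative gy x v) (at v)"
    and cont: "continuous_on ({0..1} \<times> UNIV) (\<lambda>(x, y). gy x y)"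
    and y: "(y has_real_derivative y1) (at x within {0..1})"
    and x: "x \<in> {0..1}"
  shows "((\<lambda>s. g s (y s)) has_real_derivative gx x (y x) + gy x (y x) * y1) (at x within {0..1})"
proof -
  have "((\<lambda>(x, y). g x y) has_derivative (\<lambda>(tx, ty). gx x (y x) * tx + blinfun_mult_right (gy x (y x)) ty))
      (at (x, y x) within {0..1} \<times> UNIV)"
  proof (rule has_derivative_partialsI)
    show "((\<lambda>s. g s (y x)) has_derivative (*) (gx x (y x))) (at x within {0..1})"
      using gx by (simp add: has_field_derivative_def)
    show "((\<lambda>v. g x v) has_derivative blinfun_apply (blinfun_mult_right (gy x v))) (at v within UNIV)"
      if "x \<in> {0..1}" for x v
      using gy[OF that, of v] by (simp add: has_field_derivative_def)
    have "continuous_on ({0..1} \<times> UNIV) (\<lambda>p. blinfun_mult_right (case p of (x, v) \<Rightarrow> gy x v))"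
      by (intro bounded_linear.continuous_on[OF bounded_linear_blinfun_mult_right] cont)
    then show "continuous (at (x, y x) within {0..1} \<times> UNIV) (\<lambda>(x, v). blinfun_mult_right (gy x v))"
      using x by (simp add: continuous_on_eq_continuous_within case_prod_unfold)
  qed auto
  then have *: "((\<lambda>(x, y). g x y) has_derivative (\<lambda>(tx, ty). gx x (y x) * tx + gy x (y x) * ty))
      (at (x, y x) within (\<lambda>s. (s, y s)) ` {0..1})"
    unfolding blinfun_mult_right.rep_eq by (rule has_derivative_subset) blast
  have "((\<lambda>s. (s, y s)) has_derivative (\<lambda>h. (h, y1 * h))) (at x within {0..1})"
    using y by (auto intro!: derivative_eq_intros simp: has_field_derivative_def)
  from has_derivative_in_compose[OF this *]
  have "((\<lambda>s. g s (y s)) has_derivative (\<lambda>h. gx x (y x) * h + gy x (y x) * (y1 * h))) (at x within {0..1})"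
    by simp
  then show ?thesis
    unfolding has_field_derivative_def
    by (rule has_derivative_eq_rhs) (simp add: fun_eq_iff algebra_simps)
qed

lemma bounded_on_strip_slab:
  assumes "continuous_on ({0..1} \<times> UNIV) (\<lambda>(x, y). g x y)"
  shows "\<exists>B\<ge>0. \<forall>x\<in>{0..1::real}. \<forall>y. \<bar>y\<bar> \<le> (M::real) \<longrightarrow> \<bar>g x y :: real\<bar> \<le> B"
proof -
  have "compact ((\<lambda>(x, y). g x y) ` ({0..1} \<times> {- M..M}))"
    by (intro compact_continuous_image compact_Times continuous_on_subset[OF assms]) auto
  then obtain B where "\<forall>p\<in>{0..1} \<times> {- M..M}. norm ((\<lambda>(x, y). g x y) p) \<le> B"
    by (auto dest!: compact_imp_bounded simp: bounded_iff)
  then have "\<forall>x\<in>{0..1}. \<forall>y. \<bar>y\<bar> \<le> M \<longrightarrow> \<bar>g x y\<bar> \<le> max B 0"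
    by (auto simp: abs_le_iff le_max_iff_disj)
  then show ?thesis by (intro exI[of _ "max B 0"]) auto
qed

text \<open>
  A solution is differentiable only in the open interval, but \<open>y''\<close> is the restriction of the
  continuous function \<open>f x (y x) / \<epsilon>\<^sup>2\<close>; integrating this function twice recovers \<open>y\<close> together with
  one-sided derivatives at the end points.
\<close>

lemma bvp_solution_closed_interval:
  assumes f: "continuous_on ({0..1} \<times> UNIV) (\<lambda>(x, y). f x y)" and "0 < \<epsilon>"
    and sol: "bvp_solution \<epsilon> f y"
  obtains y1 where "\<And>x. x \<in> {0..1} \<Longrightarrow> (y has_real_derivative y1 x) (at x within {0..1})"
    and "\<And>x. x \<in> {0..1} \<Longrightarrow> (y1 has_real_derivative f x (y x) / \<epsilon>\<^sup>2) (at x within {0..1})"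
proof -
  have cy: "continuous_on {0..1} y" using sol by (simp add: bvp_solution_def)
  obtain y' y'' where
    y': "\<And>x. x \<in> {0<..<1} \<Longrightarrow> (y has_real_derivative y' x) (at x)" and
    y'': "\<And>x. x \<in> {0<..<1} \<Longrightarrow> (y' has_real_derivative y'' x) (at x)" and
    ode: "\<And>x. x \<in> {0<..<1} \<Longrightarrow> \<epsilon>\<^sup>2 * y'' x = f x (y x)"
    using sol unfolding bvp_solution_def by blast
  have "continuous_on {0..1} (\<lambda>x. (\<lambda>(x, y). f x y) (x, y x))"
    by (rule continuous_on_compose2[OF f]) (auto intro!: continuous_intros cy)
  then have "continuous_on {0..1} (\<lambda>x. f x (y x) / \<epsilon>\<^sup>2)"
    using \<open>0 < \<epsilon>\<close> by (auto intro!: continuous_intros)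
  from antiderivative_continuous[OF this] obtain G
    where G: "\<And>x. x \<in> {0..1} \<Longrightarrow> (G has_real_derivative f x (y x) / \<epsilon>\<^sup>2) (at x within {0..1})"
    by (auto simp: has_real_derivative_iff_has_vector_derivative)
  have at: "at x within {0..1} = at x" if "x \<in> {0<..<1}" for x :: real
    using that by (intro at_within_interior) auto
  define c where "c = y' (1/2) - G (1/2)"
  have y'G: "y' x = G x + c" if "x \<in> {0<..<1}" for x
  proof -
    have "y' x - G x = y' (1/2) - G (1/2)"
    proof (rule DERIV_isconst3[of 0 1 x "1/2" "\<lambda>x. y' x - G x"])
      fix s :: real assume s: "s \<in> {0<..<1}"
      have "(G has_real_derivative f s (y s) / \<epsilon>\<^sup>2) (at s)" using G[of s] at[OF s] s by auto
      moreover have "f s (y s) / \<epsilon>\<^sup>2 = y'' s" using ode[OF s] \<open>0 < \<epsilon>\<close> by (simp add: field_simps)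
      ultimately show "((\<lambda>x. y' x - G x) has_real_derivative 0) (at s)"
        using DERIV_diff[OF y''[OF s]] by fastforce
    qed (use that in auto)
    then show ?thesis by (simp add: c_def)
  qed
  define y1 where "y1 = (\<lambda>x. G x + c)"
  have y1: "(y1 has_real_derivative f x (y x) / \<epsilon>\<^sup>2) (at x within {0..1})" if "x \<in> {0..1}" for x
    unfolding y1_def using G[OF that] by (auto intro!: derivative_eq_intros)
  then have "continuous_on {0..1} y1"
    by (intro DERIV_continuous_on) auto
  from antiderivative_continuous[OF this] obtain H
    where H: "\<And>x. x \<in> {0..1} \<Longrightarrow> (H has_real_derivative y1 x) (at x within {0..1})"
    by (auto simp: has_real_derivative_iff_has_vector_derivative)
  have yH: "y x = H x + (y 0 - H 0)" if "x \<in> {0..1}" for x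
  proof -
    have "y x - H x = y 0 - H 0"
    proof (rule DERIV_isconst2[of 0 1 "\<lambda>x. y x - H x"])
      show "continuous_on {0..1} (\<lambda>x. y x - H x)"
        using H by (intro continuous_intros cy DERIV_continuous_on) auto
      fix s :: real assume s: "0 < s" "s < 1"
      have "(H has_real_derivative y' s) (at s)"
        using H[of s] at[of s] y'G[of s] s by (auto simp: y1_def)
      then show "((\<lambda>x. y x - H x) has_real_derivative 0) (at s)"
        using DERIV_diff[OF y'[of s]] s by fastforce
    qed (use that in auto)
    then show ?thesis by simp
  qed
  have "(y has_real_derivative y1 x) (at x within {0..1})" if "x \<in> {0..1}" for x
  proof -
    have "((\<lambda>x. H x + (y 0 - H 0)) has_real_derivative y1 x) (at x within {0..1})"
      using H[OF that] by (auto intro!: derivative_eq_intros)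
    then show ?thesis
      unfolding has_field_derivative_def
      by (intro has_derivative_transform[OF that yH])
  qed
  with y1 show ?thesis by (rule that[rotated])
qed

locale monotone_C2_reaction =
  fixes f fx fy fxx fxy fyx fyy :: "real \<Rightarrow> real \<Rightarrow> real" and m \<gamma> :: real
  assumes partial_x: "\<And>x y. x \<in> {0..1} \<Longrightarrow>
      ((\<lambda>s. f s y) has_real_derivative fx x y) (at x within {0..1}) \<and>
      ((\<lambda>s. fx s y) has_real_derivative fxx x y) (at x within {0..1}) \<and>
      ((\<lambda>s. fy s y) has_real_derivative fyx x y) (at x within {0..1})"
    and partial_y: "\<And>x y. x \<in> {0..1} \<Longrightarrow>
      ((\<lambda>v. f x v) has_real_derivative fy x y) (at y) \<and>
      ((\<lambda>v. fx x v) has_real_derivative fxy x y) (at y) \<and>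
      ((\<lambda>v. fy x v) has_real_derivative fyy x y) (at y)"
    and continuous_partials: "\<And>g. g \<in> {f, fx, fy, fxx, fxy, fyx, fyy} \<Longrightarrow>
      continuous_on ({0..1} \<times> UNIV) (\<lambda>(x, y). g x y)"
    and m_pos: "0 < m"
    and fy_bounds: "\<And>x y. x \<in> {0..1} \<Longrightarrow> m \<le> fy x y \<and> fy x y \<le> \<gamma>"
begin

lemma secant_bounds:
  assumes "x \<in> {0..1}"
  shows "\<exists>q. m \<le> q \<and> q \<le> \<gamma> \<and> f x u - f x v = q * (u - v)"
proof -
  have *: "\<exists>q. m \<le> q \<and> q \<le> \<gamma> \<and> f x b - f x a = q * (b - a)" if "a < b" for a b
    using MVT2[OF that, of "f x" "fy x"] partial_y[OF assms] fy_bounds[OF assms]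
    by (metis mult.commute)
  consider "u < v" | "u = v" | "v < u" by linarith
  then show ?thesis
  proof cases
    case 1
    from *[OF this] obtain q where "m \<le> q \<and> q \<le> \<gamma> \<and> f x v - f x u = q * (v - u)" by blast
    then show ?thesis by (intro exI[of _ q]) (auto simp: algebra_simps)
  next
    case 2
    then show ?thesis using fy_bounds[OF assms, of u] by (intro exI[of _ m]) auto
  qed (rule *)
qed

text \<open>
  If \<open>y\<close> exceeded \<open>F / m\<close>, then \<open>f x y \<ge> f x 0 + m y > 0\<close>, so \<open>y\<close> would be convex at its maximum.
\<close>

lemma solution_bound:
  assumes "0 < \<epsilon>" "bvp_solution \<epsilon> f y" "\<And>x. x \<in> {0..1} \<Longrightarrow> \<bar>f x 0\<bar> \<le> F" and x: "x \<in> {0..1}"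
  shows "\<bar>y x\<bar> \<le> F / m"
proof -
  obtain y1 where y1: "\<And>x. x \<in> {0..1} \<Longrightarrow> (y has_real_derivative y1 x) (at x within {0..1})"
    and y2: "\<And>x. x \<in> {0..1} \<Longrightarrow> (y1 has_real_derivative f x (y x) / \<epsilon>\<^sup>2) (at x within {0..1})"
    using bvp_solution_closed_interval[OF continuous_partials assms(1,2)] by blast
  have bd: "y 0 = 0" "y 1 = 0" using assms(2) by (auto simp: bvp_solution_def)
  have F: "0 \<le> F" using assms(3)[of 0] by force
  have at: "at x within {0..1} = at x" if "0 < x" "x < 1" for x :: real
    using that by (intro at_within_interior) auto
  have "0 \<le> F / m - \<sigma> * y x" if \<sigma>: "\<sigma> = 1 \<or> \<sigma> = - 1" for \<sigma> :: real
  proof (rule continuous_minimum_principle[where w = "\<lambda>x. F / m - \<sigma> * y x" and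
        w' = "\<lambda>x. - \<sigma> * y1 x" and w'' = "\<lambda>x. - \<sigma> * (f x (y x) / \<epsilon>\<^sup>2)"])
    show "continuous_on {0..1} (\<lambda>x. F / m - \<sigma> * y x)"
      using y1 by (intro continuous_intros DERIV_continuous_on) auto
    fix x :: real assume x: "0 < x" "x < 1"
    then have x': "x \<in> {0..1}" by auto
    show "((\<lambda>x. F / m - \<sigma> * y x) has_real_derivative - \<sigma> * y1 x) (at x)"
      using y1[OF x'] at[OF x] by (auto intro!: derivative_eq_intros)
    show "((\<lambda>x. - \<sigma> * y1 x) has_real_derivative - \<sigma> * (f x (y x) / \<epsilon>\<^sup>2)) (at x)"
      using y2[OF x'] at[OF x] by (auto intro!: derivative_eq_intros)
    assume neg: "F / m - \<sigma> * y x < 0"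
    obtain q where q: "m \<le> q" "f x (y x) - f x 0 = q * (y x - 0)" using secant_bounds[OF x'] by blast
    have "F < m * (\<sigma> * y x)" using neg m_pos by (simp add: field_simps)
    also have "\<dots> \<le> q * (\<sigma> * y x)"
      using neg q(1) divide_nonneg_pos[OF F m_pos] by (intro mult_right_mono) linarith+
    also have "\<dots> = \<sigma> * f x (y x) - \<sigma> * f x 0" using q(2) by (simp add: algebra_simps)
    finally have "0 < \<sigma> * f x (y x)" using assms(3)[OF x'] \<sigma> by auto
    then show "- \<sigma> * (f x (y x) / \<epsilon>\<^sup>2) < 0" using \<open>0 < \<epsilon>\<close> by simp
  qed (use x bd F m_pos in auto)
  from this[of 1] this[of "- 1"] show ?thesis by auto
qed

end

text \<open>
  The mean value theorem on an interval of length \<open>\<epsilon>\<close> next to the end point gives a point where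
  \<open>\<bar>y'\<bar> \<le> 2 M / \<epsilon>\<close>; over that distance \<open>y'\<close> changes by at most \<open>\<epsilon> \<cdot> B / \<epsilon>\<^sup>2\<close>.
\<close>

lemma endpoint_derivative_bound:
  assumes \<epsilon>: "0 < \<epsilon>" "\<epsilon> < (1::real)"
    and y1: "\<And>x. x \<in> {0..1} \<Longrightarrow> (y has_real_derivative y1 x) (at x within {0..1})"
    and y2: "\<And>x. x \<in> {0..1} \<Longrightarrow> (y1 has_real_derivative y2 x) (at x within {0..1})"
    and M: "\<And>x. x \<in> {0..1} \<Longrightarrow> \<bar>y x\<bar> \<le> M"
    and B: "\<And>x. x \<in> {0..1} \<Longrightarrow> \<bar>y2 x\<bar> \<le> B / \<epsilon>\<^sup>2"
    and c: "c = 0 \<or> c = 1"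
  shows "\<bar>y1 c\<bar> \<le> (2 * M + B) / \<epsilon>"
proof -
  have at: "at x within {0..1} = at x" if "0 < x" "x < 1" for x :: real
    using that by (intro at_within_interior) auto
  define a where "a = c * (1 - \<epsilon>)"
  have a: "0 \<le> a" "a + \<epsilon> \<le> 1" "\<And>\<xi>. a < \<xi> \<Longrightarrow> \<xi> < a + \<epsilon> \<Longrightarrow> \<bar>c - \<xi>\<bar> \<le> \<epsilon>" using c \<epsilon> unfolding a_def by auto
  have "\<exists>\<xi>. a < \<xi> \<and> \<xi> < a + \<epsilon> \<and> y (a + \<epsilon>) - y a = (a + \<epsilon> - a) * y1 \<xi>"
  proof -
    have "continuous_on {a..a + \<epsilon>} y"
      using a(1,2) by (intro continuous_on_subset[OF DERIV_continuous_on[OF y1]]) auto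
    moreover have "(y has_real_derivative y1 x) (at x)" if "a < x" "x < a + \<epsilon>" for x
      using y1[of x] at[of x] that a by auto
    ultimately show ?thesis
      using MVT[of a "a + \<epsilon>" y] \<epsilon> DERIV_unique real_differentiable_def
      by (smt (verit, ccfv_threshold))
  qed
  then obtain \<xi> where \<xi>: "a < \<xi>" "\<xi> < a + \<epsilon>" "y (a + \<epsilon>) - y a = \<epsilon> * y1 \<xi>" by auto
  have "\<bar>\<epsilon> * y1 \<xi>\<bar> \<le> 2 * M" using M[of a] M[of "a + \<epsilon>"] \<xi>(3) a \<epsilon> by auto
  then have 1: "\<bar>y1 \<xi>\<bar> \<le> 2 * M / \<epsilon>" using \<epsilon> by (simp add: abs_mult field_simps)
  have "norm (y1 c - y1 \<xi>) \<le> B / \<epsilon>\<^sup>2 * norm (c - \<xi>)"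
    using a \<xi> c by (intro field_differentiable_bound[of "{0..1}" y1 y2] y2) (use B in auto)
  also have "\<dots> \<le> B / \<epsilon>\<^sup>2 * \<epsilon>"
    using a(3)[OF \<xi>(1,2)] order_trans[OF abs_ge_zero B[of 0]] by (intro mult_left_mono) auto
  also have "\<dots> = B / \<epsilon>" using \<epsilon> by (simp add: power2_eq_square)
  finally show ?thesis using 1 by (simp add: add_divide_distrib)
qed

lemma sqrt_sqrt_times: "0 \<le> m \<Longrightarrow> sqrt m * (sqrt m * X) = m * X"
  by (simp flip: mult.assoc)

text \<open>
  Applied to \<open>v = y'\<close>, which solves \<open>\<epsilon>\<^sup>2 v'' = f\<^sub>x + f\<^sub>y v\<close>. The layer functions solve \<open>\<epsilon>\<^sup>2 e'' = m e\<close>, so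
  they are supersolutions because \<open>f\<^sub>y \<ge> m\<close>.
\<close>

lemma layer_bound_of_bounded_source:
  fixes m \<epsilon> A B :: real
  assumes m_pos: "0 < m" and \<epsilon>: "0 < \<epsilon>"
    and v1: "\<And>x. x \<in> {0..1} \<Longrightarrow> (v has_real_derivative v1 x) (at x within {0..1})"
    and v2: "\<And>x. x \<in> {0..1} \<Longrightarrow> (v1 has_real_derivative (a x + b x * v x) / \<epsilon>\<^sup>2) (at x within {0..1})"
    and a: "\<And>x. x \<in> {0..1} \<Longrightarrow> \<bar>a x\<bar> \<le> A" and b: "\<And>x. x \<in> {0..1} \<Longrightarrow> m \<le> b x"
    and bd: "\<bar>v 0\<bar> \<le> B" "\<bar>v 1\<bar> \<le> B" and x: "x \<in> {0..1}"
  shows "\<bar>v x\<bar> \<le> A / m + B * layers m \<epsilon> x"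
proof -
  have AB: "0 \<le> A" "0 \<le> B" using a[of 0] bd by force+
  have at: "at x within {0..1} = at x" if "0 < x" "x < 1" for x :: real
    using that by (intro at_within_interior) auto
  let ?l = "layer m \<epsilon>"
  have "0 \<le> A / m + B * (?l x + ?l (1 - x)) - \<sigma> * v x" if \<sigma>: "\<sigma> = 1 \<or> \<sigma> = - 1" for \<sigma> :: real
  proof (rule continuous_minimum_principle[where w = "\<lambda>x. A / m + B * (?l x + ?l (1 - x)) - \<sigma> * v x" and
        w' = "\<lambda>x. B * (sqrt m / \<epsilon>) * (?l (1 - x) - ?l x) - \<sigma> * v1 x" and
        w'' = "\<lambda>x. (B * m * (?l x + ?l (1 - x)) - \<sigma> * (a x + b x * v x)) / \<epsilon>\<^sup>2"])
    show "continuous_on {0..1} (\<lambda>x. A / m + B * (?l x + ?l (1 - x)) - \<sigma> * v x)"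
      using v1 layer_deriv layer_reflected_deriv
      by (intro continuous_intros DERIV_continuous_on) auto
    fix x :: real assume x: "0 < x" "x < 1"
    then have x': "x \<in> {0..1}" by auto
    note l = layer_deriv[of m \<epsilon> x UNIV] layer_reflected_deriv[of m \<epsilon> x UNIV]
    show "((\<lambda>x. A / m + B * (?l x + ?l (1 - x)) - \<sigma> * v x) has_real_derivative
       B * (sqrt m / \<epsilon>) * (?l (1 - x) - ?l x) - \<sigma> * v1 x) (at x)"
      using v1[OF x'] at[OF x] l
      by (auto intro!: derivative_eq_intros simp: algebra_simps)
    show "((\<lambda>x. B * (sqrt m / \<epsilon>) * (?l (1 - x) - ?l x) - \<sigma> * v1 x) has_real_derivative
       (B * m * (?l x + ?l (1 - x)) - \<sigma> * (a x + b x * v x)) / \<epsilon>\<^sup>2) (at x)"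
      using v2[OF x'] at[OF x] l m_pos \<epsilon>
      by (auto intro!: derivative_eq_intros simp: field_simps power2_eq_square sqrt_sqrt_times)
    assume neg: "A / m + B * (?l x + ?l (1 - x)) - \<sigma> * v x < 0"
    have p: "0 \<le> A / m" "0 \<le> B * (?l x + ?l (1 - x))"
      using AB m_pos by (auto intro!: mult_nonneg_nonneg add_nonneg_nonneg less_imp_le[OF layer_pos])
    have "A + m * (B * (?l x + ?l (1 - x))) = m * (A / m + B * (?l x + ?l (1 - x)))"
      using m_pos by (simp add: field_simps)
    also have "\<dots> < m * (\<sigma> * v x)" using neg m_pos by (intro mult_strict_left_mono) auto
    also have "\<dots> \<le> b x * (\<sigma> * v x)" using neg p b[OF x'] by (intro mult_right_mono) auto
    finally have "B * m * (?l x + ?l (1 - x)) < \<sigma> * (b x * v x) - A" by (simp add: algebra_simps)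
    also have "\<dots> \<le> \<sigma> * (a x + b x * v x)" using a[OF x'] \<sigma> by auto
    finally show "(B * m * (?l x + ?l (1 - x)) - \<sigma> * (a x + b x * v x)) / \<epsilon>\<^sup>2 < 0"
      using \<epsilon> by (simp add: divide_less_0_iff)
  next
    have "1 \<le> ?l 0 + ?l 1" "1 \<le> ?l 1 + ?l 0" by (auto simp: layer_def)
    from this[THEN mult_left_mono, OF AB(2)]
    have "B \<le> B * (?l 0 + ?l 1)" "B \<le> B * (?l 1 + ?l 0)" by simp_all
    moreover have "\<sigma> * v 0 \<le> B" "\<sigma> * v 1 \<le> B" using bd \<sigma> by auto
    moreover have "0 \<le> A / m" using AB m_pos by simp
    ultimately show "0 \<le> A / m + B * (?l 0 + ?l (1 - 0)) - \<sigma> * v 0"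
      "0 \<le> A / m + B * (?l 1 + ?l (1 - 1)) - \<sigma> * v 1"
      unfolding diff_zero diff_self by linarith+
  qed (use x in auto)
  from this[of 1] this[of "- 1"] show ?thesis by (auto simp: layers_def)
qed

text \<open>
  Applied to \<open>v = f x (y x) = \<epsilon>\<^sup>2 y''\<close>. Its equation has the source term \<open>\<epsilon>\<^sup>2 (y')\<^sup>2\<close>, which is
  \<open>O(\<epsilon>\<^sup>2)\<close> plus a multiple of the squared layer functions \<open>e\<^sup>2\<close>. The barrier \<open>2 e - e\<^sup>2\<close> absorbs it without loss in the decay rate:
  \<open>\<epsilon>\<^sup>2 (2 e - e\<^sup>2)'' - m (2 e - e\<^sup>2) = - 3 m e\<^sup>2\<close>, while \<open>e \<le> 2 e - e\<^sup>2 \<le> 2 e\<close>.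
\<close>

lemma layer_bound_of_layer_source:
  fixes m \<epsilon> A B :: real
  assumes m_pos: "0 < m" and \<epsilon>: "0 < \<epsilon>"
    and v1: "\<And>x. x \<in> {0..1} \<Longrightarrow> (v has_real_derivative v1 x) (at x within {0..1})"
    and v2: "\<And>x. x \<in> {0..1} \<Longrightarrow> (v1 has_real_derivative a x + b x * v x / \<epsilon>\<^sup>2) (at x within {0..1})"
    and a: "\<And>x. x \<in> {0..1} \<Longrightarrow> \<epsilon>\<^sup>2 * \<bar>a x\<bar> \<le> A * (\<epsilon>\<^sup>2 + (layer m \<epsilon> x)\<^sup>2 + (layer m \<epsilon> (1 - x))\<^sup>2)"
    and b: "\<And>x. x \<in> {0..1} \<Longrightarrow> m \<le> b x"
    and AB: "A \<le> m * B" "0 \<le> A"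
    and bd: "\<bar>v 0\<bar> \<le> B" "\<bar>v 1\<bar> \<le> B" and x: "x \<in> {0..1}"
  shows "\<bar>v x\<bar> \<le> B * \<epsilon>\<^sup>2 + 2 * B * layers m \<epsilon> x"
proof -
  have B: "0 \<le> B" using bd by force
  have at: "at x within {0..1} = at x" if "0 < x" "x < 1" for x :: real
    using that by (intro at_within_interior) auto
  let ?l = "layer m \<epsilon>"
  define g where "g = (\<lambda>x. 2 * ?l x - (?l x)\<^sup>2)"
  have g: "0 \<le> g x" "g x \<le> 2 * ?l x" if "0 \<le> x" for x
    using mult_left_le_one_le[of "?l x" "?l x"] layer_le_1[of m \<epsilon> x] that m_pos \<epsilon>
    by (auto simp: g_def power2_eq_square less_imp_le intro: add_increasing)
  have main: "0 \<le> B * \<epsilon>\<^sup>2 + B * (g x + g (1 - x)) - \<sigma> * v x" if \<sigma>: "\<sigma> = 1 \<or> \<sigma> = - 1" for \<sigma> :: real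
  proof (rule continuous_minimum_principle[where w = "\<lambda>x. B * \<epsilon>\<^sup>2 + B * (g x + g (1 - x)) - \<sigma> * v x" and
        w' = "\<lambda>x. B * (sqrt m / \<epsilon>) * (2 * ?l (1 - x) - 2 * ?l x + 2 * (?l x)\<^sup>2 - 2 * (?l (1 - x))\<^sup>2) - \<sigma> * v1 x" and
        w'' = "\<lambda>x. (B * m * (2 * ?l (1 - x) + 2 * ?l x - 4 * (?l x)\<^sup>2 - 4 * (?l (1 - x))\<^sup>2)) / \<epsilon>\<^sup>2
            - \<sigma> * (a x + b x * v x / \<epsilon>\<^sup>2)"])
    show "continuous_on {0..1} (\<lambda>x. B * \<epsilon>\<^sup>2 + B * (g x + g (1 - x)) - \<sigma> * v x)"
      unfolding g_def using v1 layer_deriv layer_reflected_deriv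
      by (intro continuous_intros DERIV_continuous_on) auto
    fix x :: real assume x: "0 < x" "x < 1"
    then have x': "x \<in> {0..1}" by auto
    note l = layer_deriv[of m \<epsilon> x UNIV] layer_reflected_deriv[of m \<epsilon> x UNIV]
    show "((\<lambda>x. B * \<epsilon>\<^sup>2 + B * (g x + g (1 - x)) - \<sigma> * v x) has_real_derivative
       B * (sqrt m / \<epsilon>) * (2 * ?l (1 - x) - 2 * ?l x + 2 * (?l x)\<^sup>2 - 2 * (?l (1 - x))\<^sup>2) - \<sigma> * v1 x) (at x)"
      unfolding g_def using v1[OF x'] at[OF x] l
      by (auto intro!: derivative_eq_intros simp: algebra_simps power2_eq_square)
    show "((\<lambda>x. B * (sqrt m / \<epsilon>) * (2 * ?l (1 - x) - 2 * ?l x + 2 * (?l x)\<^sup>2 - 2 * (?l (1 - x))\<^sup>2) - \<sigma> * v1 x)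
       has_real_derivative
       (B * m * (2 * ?l (1 - x) + 2 * ?l x - 4 * (?l x)\<^sup>2 - 4 * (?l (1 - x))\<^sup>2)) / \<epsilon>\<^sup>2
            - \<sigma> * (a x + b x * v x / \<epsilon>\<^sup>2)) (at x)"
      using v2[OF x'] at[OF x] l m_pos \<epsilon>
      by (auto intro!: derivative_eq_intros simp: field_simps power2_eq_square sqrt_sqrt_times)
    assume neg: "B * \<epsilon>\<^sup>2 + B * (g x + g (1 - x)) - \<sigma> * v x < 0"
    have p: "0 \<le> B * \<epsilon>\<^sup>2" "0 \<le> B * (g x + g (1 - x))"
      using B g[of x] g[of "1 - x"] x by (auto intro!: mult_nonneg_nonneg)
    define S where "S = (?l x)\<^sup>2 + (?l (1 - x))\<^sup>2"
    have "m * (B * \<epsilon>\<^sup>2 + B * (g x + g (1 - x))) < m * (\<sigma> * v x)"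
      using neg m_pos by (intro mult_strict_left_mono) auto
    also have "\<dots> \<le> b x * (\<sigma> * v x)" using neg p b[OF x'] by (intro mult_right_mono) auto
    finally have 1: "m * (B * \<epsilon>\<^sup>2 + B * (g x + g (1 - x))) < \<sigma> * (b x * v x)" by (simp add: algebra_simps)
    have "\<bar>\<epsilon>\<^sup>2 * a x\<bar> \<le> A * (\<epsilon>\<^sup>2 + S)"
      using a[OF x'] unfolding S_def abs_mult by (simp add: add.assoc)
    then have 2: "- (\<sigma> * (\<epsilon>\<^sup>2 * a x)) \<le> A * (\<epsilon>\<^sup>2 + S)" using \<sigma> by auto
    have 3: "A * (\<epsilon>\<^sup>2 + S) \<le> m * B * (\<epsilon>\<^sup>2 + S)" using AB by (intro mult_right_mono) (auto simp: S_def)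
    have 4: "0 \<le> m * B * S" using m_pos B by (auto simp: S_def)
    have eq: "\<epsilon>\<^sup>2 * (B * m * (2 * ?l (1 - x) + 2 * ?l x - 4 * (?l x)\<^sup>2 - 4 * (?l (1 - x))\<^sup>2) / \<epsilon>\<^sup>2
            - \<sigma> * (a x + b x * v x / \<epsilon>\<^sup>2))
      = m * B * (g x + g (1 - x)) - 3 * (m * B * S) - \<sigma> * (\<epsilon>\<^sup>2 * a x) - \<sigma> * (b x * v x)"
      using \<epsilon> by (simp add: g_def S_def field_simps)
    have "\<dots> < 0" using 1 2 3 4 by (simp add: algebra_simps)
    then show "B * m * (2 * ?l (1 - x) + 2 * ?l x - 4 * (?l x)\<^sup>2 - 4 * (?l (1 - x))\<^sup>2) / \<epsilon>\<^sup>2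
            - \<sigma> * (a x + b x * v x / \<epsilon>\<^sup>2) < 0"
      unfolding eq[symmetric] using \<epsilon> by (simp add: mult_less_0_iff)
  next
    have g0: "g 0 = 1" by (simp add: g_def layer_def)
    have "0 \<le> B * g 1" "0 \<le> B * \<epsilon>\<^sup>2" using B g(1)[of 1] by auto
    moreover have "\<sigma> * v 0 \<le> B" "\<sigma> * v 1 \<le> B" using bd \<sigma> by auto
    ultimately show "0 \<le> B * \<epsilon>\<^sup>2 + B * (g 0 + g (1 - 0)) - \<sigma> * v 0"
      "0 \<le> B * \<epsilon>\<^sup>2 + B * (g 1 + g (1 - 1)) - \<sigma> * v 1"
      unfolding diff_zero diff_self g0 distrib_left by linarith+
  qed (use x in auto)
  have "\<bar>v x\<bar> \<le> B * \<epsilon>\<^sup>2 + B * (g x + g (1 - x))" using main[of 1] main[of "- 1"] by auto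
  also have "\<dots> \<le> B * \<epsilon>\<^sup>2 + B * (2 * layers m \<epsilon> x)"
    using g[of x] g[of "1 - x"] x B by (intro add_left_mono mult_left_mono) (auto simp: layers_def)
  finally show ?thesis by simp
qed

context monotone_C2_reaction
begin

lemma solution_layer_bounded:
  "\<exists>C>0. \<forall>\<epsilon> y. 0 < \<epsilon> \<longrightarrow> \<epsilon> < 1 \<longrightarrow> bvp_solution \<epsilon> f y \<longrightarrow>
     (\<exists>D. D 0 = y \<and> (\<forall>x\<in>{0..1}. D 2 x = f x (y x) / \<epsilon>\<^sup>2) \<and> layer_bounded C m \<epsilon> D)"
proof -
  obtain F where F: "0 \<le> F" "\<And>x. x \<in> {0..1} \<Longrightarrow> \<bar>f x 0\<bar> \<le> F"
    using bounded_on_strip_slab[of f 0] continuous_partials by force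
  define M where "M = F / m"
  have M: "0 \<le> M" unfolding M_def using F m_pos by simp
  have "\<forall>g\<in>{f, fx, fy, fxx, fxy, fyx, fyy}. \<exists>B\<ge>0. \<forall>x\<in>{0..1}. \<forall>y. \<bar>y\<bar> \<le> M \<longrightarrow> \<bar>g x y\<bar> \<le> B"
    using continuous_partials bounded_on_strip_slab by blast
  then obtain b where b: "\<And>g. g \<in> {f, fx, fy, fxx, fxy, fyx, fyy} \<Longrightarrow>
      0 \<le> b g \<and> (\<forall>x\<in>{0..1}. \<forall>y. \<bar>y\<bar> \<le> M \<longrightarrow> \<bar>g x y\<bar> \<le> b g)" by metis
  define B where "B = (\<Sum>g\<in>{f, fx, fy, fxx, fxy, fyx, fyy}. b g)"
  have B0: "0 \<le> B" unfolding B_def using b by (intro sum_nonneg) blast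
  have B: "\<bar>g x y\<bar> \<le> B" if "g \<in> {f, fx, fy, fxx, fxy, fyx, fyy}" "x \<in> {0..1}" "\<bar>y\<bar> \<le> M" for g x y
  proof -
    have "b g \<le> B" unfolding B_def using b by (intro member_le_sum that) blast+
    with b[OF that(1)] that show ?thesis by force
  qed
  define K where "K = B / m + (2 * M + B)"
  have K: "0 \<le> K" "B / m \<le> K" "2 * M + B \<le> K" unfolding K_def using B0 M m_pos by auto
  define A where "A = 3 * B * (1 + K)\<^sup>2"
  have A: "0 \<le> A" unfolding A_def using B0 by simp
  define Q where "Q = A / m + B"
  have Q: "A \<le> m * Q" "B \<le> Q" "0 \<le> Q" unfolding Q_def using A B0 m_pos by (auto simp: distrib_left)
  define C where "C = K + 2 * Q + B * (1 + K) + (A + 2 * (B * Q)) + 1"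
  have nn: "0 \<le> B * (1 + K)" "0 \<le> B * Q" using B0 K Q by auto
  have C: "0 < C" "K \<le> C" "2 * Q \<le> C" "B * (1 + K) \<le> C" "A + 2 * (B * Q) \<le> C"
    unfolding C_def using nn A K(1) Q(3) by linarith+
  have "\<exists>D. D 0 = y \<and> (\<forall>x\<in>{0..1}. D 2 x = f x (y x) / \<epsilon>\<^sup>2) \<and> layer_bounded C m \<epsilon> D"
    if \<epsilon>: "0 < \<epsilon>" "\<epsilon> < 1" and sol: "bvp_solution \<epsilon> f y" for \<epsilon> y
  proof -
    obtain y1 where y1: "\<And>x. x \<in> {0..1} \<Longrightarrow> (y has_real_derivative y1 x) (at x within {0..1})"
      and y2: "\<And>x. x \<in> {0..1} \<Longrightarrow> (y1 has_real_derivative f x (y x) / \<epsilon>\<^sup>2) (at x within {0..1})"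
      using bvp_solution_closed_interval[OF continuous_partials \<epsilon>(1) sol] by blast
    have yM: "\<bar>y x\<bar> \<le> M" if "x \<in> {0..1}" for x
      using solution_bound[OF \<epsilon>(1) sol F(2) that] unfolding M_def by simp
    have Bx: "\<bar>f x (y x)\<bar> \<le> B" "\<bar>fx x (y x)\<bar> \<le> B" "\<bar>fy x (y x)\<bar> \<le> B"
      "\<bar>fxx x (y x)\<bar> \<le> B" "\<bar>fxy x (y x)\<bar> \<le> B" "\<bar>fyx x (y x)\<bar> \<le> B"
      "\<bar>fyy x (y x)\<bar> \<le> B" if "x \<in> {0..1}" for x
      using that yM[OF that] by (auto intro: B)
    let ?L = "layers m \<epsilon>" and ?l = "layer m \<epsilon>"
    define z1 where "z1 = (\<lambda>x. fx x (y x) + fy x (y x) * y1 x)"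
    define a where "a = (\<lambda>x. fxx x (y x) + fxy x (y x) * y1 x + (fyx x (y x) + fyy x (y x) * y1 x) * y1 x)"
    have z1: "((\<lambda>x. f x (y x)) has_real_derivative z1 x) (at x within {0..1})" if "x \<in> {0..1}" for x
      unfolding z1_def using that partial_x partial_y continuous_partials y1
      by (intro has_real_derivative_along_curve) auto
    have z2: "(z1 has_real_derivative a x + fy x (y x) * f x (y x) / \<epsilon>\<^sup>2) (at x within {0..1})"
      if "x \<in> {0..1}" for x
    proof -
      have "((\<lambda>x. fx x (y x)) has_real_derivative fxx x (y x) + fxy x (y x) * y1 x) (at x within {0..1})"
        using that partial_x partial_y continuous_partials y1
        by (intro has_real_derivative_along_curve) auto
      moreover have "((\<lambda>x. fy x (y x)) has_real_derivative fyx x (y x) + fyy x (y x) * y1 x) (at x within {0..1})"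
        using that partial_x partial_y continuous_partials y1
        by (intro has_real_derivative_along_curve) auto
      ultimately show ?thesis unfolding z1_def a_def using y2[OF that]
        by (auto intro!: derivative_eq_intros simp: algebra_simps)
    qed
    have y1_bound: "\<bar>y1 x\<bar> \<le> K * (1 + ?L x / \<epsilon>)" if x: "x \<in> {0..1}" for x
    proof -
      have e: "\<bar>y1 c\<bar> \<le> (2 * M + B) / \<epsilon>" if "c = 0 \<or> c = 1" for c
        using \<epsilon> by (intro endpoint_derivative_bound[OF \<epsilon> y1 y2 yM _ that])
          (auto simp: abs_div divide_right_mono Bx)
      have "\<bar>y1 x\<bar> \<le> B / m + (2 * M + B) / \<epsilon> * ?L x"
      proof (rule layer_bound_of_bounded_source[OF m_pos \<epsilon>(1) y2 _ _ _ _ _ x])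
        fix s :: real assume s: "s \<in> {0..1}"
        show "((\<lambda>x. f x (y x) / \<epsilon>\<^sup>2) has_real_derivative (fx s (y s) + fy s (y s) * y1 s) / \<epsilon>\<^sup>2) (at s within {0..1})"
          using z1[OF s] unfolding z1_def by (rule DERIV_cdivide)
      qed (use e Bx fy_bounds in auto)
      also have "\<dots> \<le> K + K / \<epsilon> * ?L x"
        using K \<epsilon> by (intro add_mono mult_right_mono divide_right_mono) auto
      finally show ?thesis by (simp add: algebra_simps)
    qed
    have sum1: "1 + \<bar>y1 x\<bar> \<le> (1 + K) * (1 + ?L x / \<epsilon>)" if "x \<in> {0..1}" for x
    proof -
      have "(1 + K) * (1 + ?L x / \<epsilon>) = 1 + ?L x / \<epsilon> + K * (1 + ?L x / \<epsilon>)"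
        by (simp only: distrib_right mult_1_left)
      moreover have "0 \<le> ?L x / \<epsilon>" using \<epsilon> by simp
      ultimately show ?thesis using y1_bound[OF that] by linarith
    qed
    have a_bound: "\<epsilon>\<^sup>2 * \<bar>a x\<bar> \<le> A * (\<epsilon>\<^sup>2 + (?l x)\<^sup>2 + (?l (1 - x))\<^sup>2)" if x: "x \<in> {0..1}" for x
    proof -
      have "\<bar>a x\<bar> \<le> \<bar>fxx x (y x)\<bar> + \<bar>fxy x (y x)\<bar> * \<bar>y1 x\<bar> + (\<bar>fyx x (y x)\<bar> + \<bar>fyy x (y x)\<bar> * \<bar>y1 x\<bar>) * \<bar>y1 x\<bar>"
        unfolding a_def abs_mult[symmetric]
        by (intro order_trans[OF abs_triangle_ineq] add_mono order_refl)
          (auto simp: abs_mult intro!: mult_right_mono order_trans[OF abs_triangle_ineq])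
      also have "\<dots> \<le> B + B * \<bar>y1 x\<bar> + (B + B * \<bar>y1 x\<bar>) * \<bar>y1 x\<bar>"
        using Bx[OF x] by (intro add_mono mult_right_mono) auto
      also have "\<dots> \<le> B * (1 + \<bar>y1 x\<bar>)\<^sup>2" using B0
        by (simp add: power2_eq_square algebra_simps)
      finally have "\<epsilon>\<^sup>2 * \<bar>a x\<bar> \<le> \<epsilon>\<^sup>2 * (B * (1 + \<bar>y1 x\<bar>)\<^sup>2)" by (intro mult_left_mono) auto
      also have "\<dots> \<le> \<epsilon>\<^sup>2 * (B * ((1 + K) * (1 + ?L x / \<epsilon>))\<^sup>2)"
        using sum1[OF x] B0 by (intro mult_left_mono power_mono) auto
      also have "\<dots> = B * (1 + K)\<^sup>2 * (\<epsilon> + ?l x + ?l (1 - x))\<^sup>2"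
        using \<epsilon> by (simp add: layers_def power2_eq_square field_simps)
      also have "\<dots> \<le> B * (1 + K)\<^sup>2 * (3 * (\<epsilon>\<^sup>2 + (?l x)\<^sup>2 + (?l (1 - x))\<^sup>2))"
      proof (intro mult_left_mono)
        have "(p + q + r)\<^sup>2 \<le> 3 * (p\<^sup>2 + q\<^sup>2 + r\<^sup>2)" for p q r :: real
          using sum_squares_ge_zero[of "p - q" "q - r"] zero_le_power2[of "p - r"]
          by (simp add: power2_eq_square algebra_simps)
        then show "(\<epsilon> + ?l x + ?l (1 - x))\<^sup>2 \<le> 3 * (\<epsilon>\<^sup>2 + (?l x)\<^sup>2 + (?l (1 - x))\<^sup>2)" .
      qed (use B0 in auto)
      finally show ?thesis unfolding A_def by (simp add: algebra_simps)
    qed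
    have z_bound: "\<bar>f x (y x)\<bar> \<le> Q * \<epsilon>\<^sup>2 + 2 * Q * ?L x" if x: "x \<in> {0..1}" for x
    proof (rule layer_bound_of_layer_source[OF m_pos \<epsilon>(1) z1 z2 a_bound _ Q(1) A _ _ x])
      show "\<bar>f 0 (y 0)\<bar> \<le> Q" "\<bar>f 1 (y 1)\<bar> \<le> Q"
        using Bx(1)[of 0] Bx(1)[of 1] Q(2) by auto
    qed (use fy_bounds in auto)
    have y2_bound: "\<bar>f x (y x) / \<epsilon>\<^sup>2\<bar> \<le> 2 * Q * (1 + ?L x / \<epsilon>\<^sup>2)" if x: "x \<in> {0..1}" for x
    proof -
      have "\<bar>f x (y x) / \<epsilon>\<^sup>2\<bar> \<le> (2 * Q * \<epsilon>\<^sup>2 + 2 * Q * ?L x) / \<epsilon>\<^sup>2"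
      proof -
        have "0 \<le> Q * \<epsilon>\<^sup>2" using Q(3) by simp
        then have "\<bar>f x (y x)\<bar> \<le> 2 * Q * \<epsilon>\<^sup>2 + 2 * Q * ?L x" using z_bound[OF x] by linarith
        then show ?thesis unfolding abs_divide using \<epsilon> by (simp add: divide_right_mono)
      qed
      then show ?thesis using \<epsilon> by (simp add: field_simps)
    qed
    define D where "D = (\<lambda>i. [y, y1, \<lambda>x. f x (y x) / \<epsilon>\<^sup>2, \<lambda>x. z1 x / \<epsilon>\<^sup>2,
       \<lambda>x. (a x + fy x (y x) * f x (y x) / \<epsilon>\<^sup>2) / \<epsilon>\<^sup>2] ! i)"
    have D: "D 0 = y" "D 1 = y1" "D 2 = (\<lambda>x. f x (y x) / \<epsilon>\<^sup>2)" "D 3 = (\<lambda>x. z1 x / \<epsilon>\<^sup>2)"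
      "D 4 = (\<lambda>x. (a x + fy x (y x) * f x (y x) / \<epsilon>\<^sup>2) / \<epsilon>\<^sup>2)"
      by (simp_all add: D_def numeral_eq_Suc)
    have "layer_bounded C m \<epsilon> D"
      unfolding layer_bounded_def
    proof (intro conjI allI impI ballI)
      fix i :: nat and x :: real assume i: "i < 4" and x: "x \<in> {0..1}"
      consider "i = 0" | "i = 1" | "i = 2" | "i = 3" using i by linarith
      then show "(D i has_real_derivative D (Suc i) x) (at x within {0..1})"
      proof cases
        case 1 then show ?thesis using y1[OF x] D by simp
      next
        case 2 then show ?thesis using y2[OF x] D by (simp add: numeral_2_eq_2)
      next
        case 3
        then have "Suc i = 3" by simp
        with 3 show ?thesis using DERIV_cdivide[OF z1[OF x]] by (simp only: D)
      next
        case 4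
        then have "Suc i = 4" by simp
        with 4 show ?thesis using DERIV_cdivide[OF z2[OF x]] by (simp only: D)
      qed
    next
      fix x :: real assume x: "x \<in> {0..1}"
      have L: "0 \<le> 1 + ?L x / \<epsilon>" "0 \<le> 1 + ?L x / \<epsilon>\<^sup>2" using \<epsilon> by (auto intro!: add_nonneg_nonneg)
      show "\<bar>D 1 x\<bar> \<le> C * (1 + ?L x / \<epsilon>)"
        unfolding D using y1_bound[OF x] mult_right_mono[OF C(2) L(1)] by linarith
      show "\<bar>D 2 x\<bar> \<le> C * (1 + ?L x / \<epsilon>\<^sup>2)"
        unfolding D using y2_bound[OF x] mult_right_mono[OF C(3) L(2)] by linarith
      have "\<epsilon>\<^sup>2 * \<bar>D 3 x\<bar> = \<bar>z1 x\<bar>" unfolding D using \<epsilon> by (simp add: abs_divide)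
      also have "\<dots> \<le> B + B * \<bar>y1 x\<bar>"
        unfolding z1_def using Bx(2)[OF x] mult_right_mono[OF Bx(3)[OF x], of "\<bar>y1 x\<bar>"]
        by (intro order_trans[OF abs_triangle_ineq] add_mono) (auto simp: abs_mult)
      also have "\<dots> \<le> B * ((1 + K) * (1 + ?L x / \<epsilon>))"
        using mult_left_mono[OF sum1[OF x] B0] by (simp add: distrib_left)
      also have "\<dots> \<le> C * (1 + ?L x / \<epsilon>)"
        using mult_right_mono[OF C(4) L(1)] by (simp add: mult.assoc)
      finally show "\<epsilon>\<^sup>2 * \<bar>D 3 x\<bar> \<le> C * (1 + ?L x / \<epsilon>)" .
      have sq: "(?l x)\<^sup>2 + (?l (1 - x))\<^sup>2 \<le> ?L x"
      proof -
        have "(?l s)\<^sup>2 \<le> ?l s" if "0 \<le> s" for s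
          using mult_left_le_one_le[of "?l s" "?l s"] layer_le_1[of m \<epsilon> s] m_pos \<epsilon> that
          by (simp add: power2_eq_square less_imp_le)
        then show ?thesis using x unfolding layers_def by (intro add_mono) auto
      qed
      have "A * (\<epsilon>\<^sup>2 + (?l x)\<^sup>2 + (?l (1 - x))\<^sup>2) \<le> A * (\<epsilon>\<^sup>2 + ?L x)"
        using sq A by (intro mult_left_mono) auto
      with a_bound[OF x] have "\<epsilon>\<^sup>2 * \<bar>a x\<bar> \<le> A * (\<epsilon>\<^sup>2 + ?L x)" by linarith
      then have aA: "\<bar>a x\<bar> \<le> A * (1 + ?L x / \<epsilon>\<^sup>2)" using \<epsilon> by (simp add: field_simps)
      have "\<epsilon>\<^sup>2 * \<bar>D 4 x\<bar> = \<bar>a x + fy x (y x) * (f x (y x) / \<epsilon>\<^sup>2)\<bar>"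
        unfolding D using \<epsilon> by (simp add: abs_divide)
      also have "\<dots> \<le> \<bar>a x\<bar> + \<bar>fy x (y x)\<bar> * \<bar>f x (y x) / \<epsilon>\<^sup>2\<bar>"
        by (metis abs_mult abs_triangle_ineq)
      also have "\<dots> \<le> A * (1 + ?L x / \<epsilon>\<^sup>2) + B * (2 * Q * (1 + ?L x / \<epsilon>\<^sup>2))"
        using aA y2_bound[OF x] B0 Bx(3)[OF x] by (intro add_mono mult_mono) auto
      also have "\<dots> = (A + 2 * (B * Q)) * (1 + ?L x / \<epsilon>\<^sup>2)"
        by (simp only: distrib_right mult.assoc mult.left_commute[of B 2])
      also have "\<dots> \<le> C * (1 + ?L x / \<epsilon>\<^sup>2)" using C(5) L(2) by (intro mult_right_mono) auto
      finally show "\<epsilon>\<^sup>2 * \<bar>D 4 x\<bar> \<le> C * (1 + ?L x / \<epsilon>\<^sup>2)" .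
    qed
    with D show ?thesis by (intro exI[of _ D]) auto
  qed
  with C(1) show ?thesis by blast
qed

end

section \<open>The local truncation error\<close>

text \<open>
  The residual of a function \<open>u\<close> with second derivative \<open>g\<close> at a node \<open>x\<close> with left step \<open>h\<close> and right
  step \<open>k\<close>; for the exact solution \<open>g / \<beta>\<^sup>2 = f / \<gamma>\<close>.
\<close>

definition truncation :: "real \<Rightarrow> (real \<Rightarrow> real) \<Rightarrow> (real \<Rightarrow> real) \<Rightarrow> real \<Rightarrow> real \<Rightarrow> real \<Rightarrow> real" where
  "truncation \<beta> u g x h k =
     (u (x + k) - u x) / tanh (\<beta> * k / 2) - (u x - u (x - h)) / tanh (\<beta> * h / 2)
     - (tanh (\<beta> * h / 2) * (g (x - h) + g x) + tanh (\<beta> * k / 2) * (g x + g (x + k))) / \<beta>\<^sup>2"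

lemma truncation_reflect:
  "truncation \<beta> (\<lambda>s. u (1 - s)) (\<lambda>s. g (1 - s)) (1 - x) k h = truncation \<beta> u g x h k"
proof -
  have "1 - (1 - x + h) = x - h" "1 - (1 - x - k) = x + k" "1 - (1 - x) = x" by simp_all
  then show ?thesis unfolding truncation_def
    by (simp only:) (simp add: diff_divide_distrib algebra_simps)
qed

text \<open>
  The first term measures the change of the step, the second is a difference of difference
  quotients that the third one balances.
\<close>

lemma truncation_split:
  fixes \<beta> h k :: real
  assumes "0 < \<beta>" "0 < h" "0 < k"
  defines "z \<equiv> \<beta> * h / 2" and "w \<equiv> \<beta> * k / 2"
  shows "truncation \<beta> u g x h k =
     2 / \<beta> * (w / tanh w - z / tanh z) * ((u (x + k) - u x) / k)
     + 2 / \<beta> * (z / tanh z) * ((u (x + k) - u x) / k - (u x - u (x - h)) / h)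
     - (tanh z * (g (x - h) + g x) + tanh w * (g x + g (x + k))) / \<beta>\<^sup>2"
proof -
  have zw: "0 < tanh z" "0 < tanh w" using assms by auto
  have k: "2 / \<beta> * w = k" "2 / \<beta> * z = h" using assms by (auto simp: z_def w_def)
  have 1: "2 / \<beta> * (w / tanh w - z / tanh z) = k / tanh w - h / tanh z"
    using k by (simp add: right_diff_distrib)
  have 2: "2 / \<beta> * (z / tanh z) = h / tanh z" using k by simp
  have 3: "(k / T - h / S) * (p / k) + h / S * (p / k - q / h) = p / T - q / S"
    if "T \<noteq> 0" "S \<noteq> 0" for p q T S :: real
    using assms(2,3) that by (simp add: field_simps)
  show ?thesis
    unfolding 1 2 truncation_def z_def[symmetric] w_def[symmetric]
    using 3[of "tanh w" "tanh z" "u (x + k) - u x" "u x - u (x - h)"] zw by simp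
qed

lemma cubic_Taylor_bound:
  fixes D :: "nat \<Rightarrow> real \<Rightarrow> real"
  assumes D: "\<And>i x. i < 4 \<Longrightarrow> x \<in> {a..b} \<Longrightarrow> (D i has_real_derivative D (Suc i) x) (at x within {a..b})"
    and M: "\<And>x. x \<in> {a..b} \<Longrightarrow> \<bar>D 4 x\<bar> \<le> M" and x: "x \<in> {a..b}" "x + s \<in> {a..b}"
  shows "\<bar>D 0 (x + s) - (D 0 x + D 1 x * s + D 2 x * s\<^sup>2 / 2 + D 3 x * s ^ 3 / 6)\<bar> \<le> M * \<bar>s\<bar> ^ 4 / 6"
    and "\<bar>D 2 (x + s) - (D 2 x + D 3 x * s)\<bar> \<le> M * s\<^sup>2"
proof -
  have "norm (D 0 (x + s) - (\<Sum>i\<le>3. D i x * (x + s - x) ^ i / fact i)) \<le> M * norm (x + s - x) ^ Suc 3 / fact 3"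
    using M by (intro field_Taylor[of "{a..b}"] D x) (auto simp: numeral_eq_Suc)
  moreover have "(\<Sum>i\<le>3. D i x * (x + s - x) ^ i / fact i) =
      D 0 x + D 1 x * s + D 2 x * s\<^sup>2 / 2 + D 3 x * s ^ 3 / 6"
    by (simp add: numeral_eq_Suc fact_reduce)
  ultimately show "\<bar>D 0 (x + s) - (D 0 x + D 1 x * s + D 2 x * s\<^sup>2 / 2 + D 3 x * s ^ 3 / 6)\<bar> \<le> M * \<bar>s\<bar> ^ 4 / 6"
    by (simp add: fact_numeral)
  have "norm (D (0 + 2) (x + s) - (\<Sum>i\<le>1. D (i + 2) x * (x + s - x) ^ i / fact i)) \<le> M * norm (x + s - x) ^ Suc 1 / fact 1"
  proof (rule field_Taylor[of "{a..b}" 1 "\<lambda>i. D (i + 2)"])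
    fix i :: nat and y assume "y \<in> {a..b}" "i \<le> 1"
    then show "(D (i + 2) has_real_derivative D (Suc i + 2) y) (at y within {a..b})"
      using D[of "i + 2" y] by simp
  next
    fix y assume "y \<in> {a..b}" then show "norm (D (Suc 1 + 2) y) \<le> M" using M[of y] by (simp add: numeral_eq_Suc)
  qed (use x in auto)
  then show "\<bar>D 2 (x + s) - (D 2 x + D 3 x * s)\<bar> \<le> M * s\<^sup>2"
    by (simp add: numeral_3_eq_3 numeral_2_eq_2)
qed

text \<open>
  In the Taylor expansion at \<open>x\<close> the coefficient of \<open>u''\<close> is cubic in the step because
  \<open>z / tanh z = 1 + O(z\<^sup>2)\<close> and \<open>tanh z = z + O(z\<^sup>3)\<close>, the coefficient of \<open>u'''\<close> carries the factor \<open>k - h\<close>,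
  and what remains is of fourth order. One factor \<open>\<beta> k\<close> is turned into \<open>tanh (\<beta> k / 2)\<close>, the weight in
  the stability estimate.
\<close>

lemma truncation_fine:
  fixes D :: "nat \<Rightarrow> real \<Rightarrow> real"
  assumes \<beta>: "0 < \<beta>" and hk: "0 < h" "h \<le> k" and Z: "\<beta> * k / 2 \<le> Z"
    and D: "\<And>i s. i < 4 \<Longrightarrow> s \<in> {x - h..x + k} \<Longrightarrow>
        (D i has_real_derivative D (Suc i) s) (at s within {x - h..x + k})"
    and M: "\<And>s. s \<in> {x - h..x + k} \<Longrightarrow>
        \<bar>D 1 s\<bar> \<le> M1 \<and> \<bar>D 2 s\<bar> \<le> M2 \<and> \<bar>D 3 s\<bar> / \<beta>\<^sup>2 \<le> M3 \<and> \<bar>D 4 s\<bar> / \<beta>\<^sup>2 \<le> M4"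
  shows "\<bar>truncation \<beta> (D 0) (D 2) x h k\<bar>
    \<le> 8 * (1 + Z)\<^sup>2 * tanh (\<beta> * k / 2) * ((k - h) * (M1 + M3) + k\<^sup>2 * (M2 + M4))"
proof -
  define z where "z = \<beta> * h / 2"
  define w where "w = \<beta> * k / 2"
  have z0: "0 < z" "z \<le> w" "w \<le> Z" using \<beta> hk Z by (auto simp: z_def w_def)
  have w0: "0 < w" using z0 by simp
  have k: "k = 2 * w / \<beta>" "h = 2 * z / \<beta>" using \<beta> by (auto simp: z_def w_def)
  have x: "x \<in> {x - h..x + k}" using hk by auto
  have Mx: "\<bar>D 1 x\<bar> \<le> M1" "\<bar>D 2 x\<bar> \<le> M2" "\<bar>D 3 x\<bar> / \<beta>\<^sup>2 \<le> M3" "\<bar>D 4 x\<bar> / \<beta>\<^sup>2 \<le> M4" using M[OF x] by auto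
  have M0: "0 \<le> M1" "0 \<le> M2" "0 \<le> M3" "0 \<le> M4"
    by (rule order_trans[OF _ Mx(1)] order_trans[OF _ Mx(2)] order_trans[OF _ Mx(3)]
        order_trans[OF _ Mx(4)], simp)+
  define Q where "Q = M4 * \<beta>\<^sup>2"
  have Q: "0 \<le> Q" "Q / \<beta>\<^sup>2 = M4" using M0 \<beta> by (auto simp: Q_def)
  have D4: "\<bar>D 4 s\<bar> \<le> Q" if "s \<in> {x - h..x + k}" for s
    using M[OF that] \<beta> unfolding Q_def by (simp add: divide_le_eq)
  note T = cubic_Taylor_bound[of "x - h" "x + k" D Q x, OF D D4 x]
  define R where "R = D 0 (x + k) - (D 0 x + D 1 x * k + D 2 x * k\<^sup>2 / 2 + D 3 x * k ^ 3 / 6)"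
  define R' where "R' = D 0 (x - h) - (D 0 x - D 1 x * h + D 2 x * h\<^sup>2 / 2 - D 3 x * h ^ 3 / 6)"
  define S where "S = D 2 (x + k) - (D 2 x + D 3 x * k)"
  define S' where "S' = D 2 (x - h) - (D 2 x - D 3 x * h)"
  have R: "\<bar>R\<bar> \<le> Q * k ^ 4 / 6" unfolding R_def using T(1)[of k] hk by simp
  have R': "\<bar>R'\<bar> \<le> Q * h ^ 4 / 6" unfolding R'_def using T(1)[of "- h"] hk by simp
  have S: "\<bar>S\<bar> \<le> Q * k\<^sup>2" unfolding S_def using T(2)[of k] hk by simp
  have S': "\<bar>S'\<bar> \<le> Q * h\<^sup>2" unfolding S'_def using T(2)[of "- h"] hk by simp
  define G where "G = z / tanh z"
  have tz: "0 < tanh z" "tanh z \<le> z" "0 < tanh w" "tanh w \<le> w" "tanh z \<le> tanh w"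
    using z0 w0 tanh_le_self by auto
  have G: "0 \<le> G - 1" "G - 1 \<le> z\<^sup>2" "G \<le> 1 + z"
    using self_le_tanh_times_square[of z] self_le_tanh_times[of z] z0 tz
    by (auto simp: G_def field_simps)
  have slope: "\<bar>(D 0 (x + k) - D 0 x) / k\<bar> \<le> M1"
  proof -
    have "norm (D 0 (x + k) - D 0 x) \<le> M1 * norm (x + k - x)"
      using D[of 0] M hk by (intro field_differentiable_bound[of "{x - h..x + k}" "D 0" "D 1"]) auto
    then show ?thesis using hk by (simp add: abs_divide divide_le_eq)
  qed
  have split: "truncation \<beta> (D 0) (D 2) x h k =
       2 / \<beta> * (w / tanh w - z / tanh z) * ((D 0 (x + k) - D 0 x) / k)
     + 2 / \<beta>\<^sup>2 * ((G - 1) * (z + w) + (z - tanh z) + (w - tanh w)) * D 2 x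
     + (2 / \<beta> * G * ((k\<^sup>2 - h\<^sup>2) / 6) - 2 / \<beta> * (w * tanh w - z * tanh z) / \<beta>\<^sup>2) * D 3 x
     + (2 / \<beta> * G * (R / k + R' / h) - (tanh z * S' + tanh w * S) / \<beta>\<^sup>2)"
  proof -
    have e1: "(D 0 (x + k) - D 0 x) / k = D 1 x + D 2 x * k / 2 + D 3 x * k\<^sup>2 / 6 + R / k"
      unfolding R_def using hk by (simp add: field_simps power2_eq_square power3_eq_cube)
    have e2: "(D 0 x - D 0 (x - h)) / h = D 1 x - D 2 x * h / 2 + D 3 x * h\<^sup>2 / 6 - R' / h"
      unfolding R'_def using hk by (simp add: field_simps power2_eq_square power3_eq_cube)
    have e3: "D 2 (x + k) = D 2 x + D 3 x * k + S" "D 2 (x - h) = D 2 x - D 3 x * h + S'"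
      by (auto simp: S_def S'_def)
    have "2 / \<beta> * G * ((D 0 (x + k) - D 0 x) / k - (D 0 x - D 0 (x - h)) / h)
      - (tanh z * (D 2 (x - h) + D 2 x) + tanh w * (D 2 x + D 2 (x + k))) / \<beta>\<^sup>2
     = 2 / \<beta>\<^sup>2 * ((G - 1) * (z + w) + (z - tanh z) + (w - tanh w)) * D 2 x
     + (2 / \<beta> * G * ((k\<^sup>2 - h\<^sup>2) / 6) - 2 / \<beta> * (w * tanh w - z * tanh z) / \<beta>\<^sup>2) * D 3 x
     + (2 / \<beta> * G * (R / k + R' / h) - (tanh z * S' + tanh w * S) / \<beta>\<^sup>2)"
    proof -
      (* with b the divisions become products and the identity is polynomial *)
      define b where "b = 1 / \<beta>"
      have b: "X / \<beta> = X * b" "X / \<beta>\<^sup>2 = X * b\<^sup>2" for X by (simp_all add: b_def power_one_over)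
      have poly: "2 * b * G * ((d1 + d2 * k / 2 + d3 * k\<^sup>2 / 6 + r) - (d1 - d2 * h / 2 + d3 * h\<^sup>2 / 6 - r'))
          - (tz * (d2 - d3 * h + s' + d2) + tw * (d2 + (d2 + d3 * k + s))) * b\<^sup>2
        = 2 * b\<^sup>2 * ((G - 1) * (z + w) + (z - tz) + (w - tw)) * d2
          + (2 * b * G * ((k\<^sup>2 - h\<^sup>2) / 6) - 2 * b * (w * tw - z * tz) * b\<^sup>2) * d3
          + (2 * b * G * (r + r') - (tz * s' + tw * s) * b\<^sup>2)"
        for d1 d2 d3 r r' s s' tz tw
        unfolding k b by (simp add: algebra_simps power2_eq_square diff_divide_distrib)
      show ?thesis unfolding e1 e2 e3 b by (rule poly)
    qed
    with truncation_split[OF \<beta> hk(1), of k "D 0" "D 2" x] hk show ?thesis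
      unfolding G_def z_def w_def by (simp add: algebra_simps)
  qed
  have wk: "w * k\<^sup>2 = 4 * w ^ 3 / \<beta>\<^sup>2" unfolding w_def using \<beta> by (simp add: field_simps power2_eq_square power3_eq_cube)
  have b1: "\<bar>2 / \<beta> * (w / tanh w - z / tanh z) * ((D 0 (x + k) - D 0 x) / k)\<bar> \<le> w * ((k - h) * M1)"
  proof -
    have "\<bar>2 / \<beta> * (w / tanh w - z / tanh z)\<bar> \<le> 2 / \<beta> * (w * (w - z))"
      using coth_weight_diff[OF z0(1,2)] \<beta> by (simp add: abs_mult divide_right_mono)
    also have "\<dots> = w * (k - h)" unfolding w_def z_def using \<beta> by (simp add: field_simps)
    finally show ?thesis
      using mult_mono[OF _ slope] w0 hk unfolding abs_mult[of "2 / \<beta> * _"] by (metis (no_types, lifting)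
          abs_ge_zero diff_ge_0_iff_ge less_imp_le mult.assoc mult_nonneg_nonneg)
  qed
  have b2: "\<bar>2 / \<beta>\<^sup>2 * ((G - 1) * (z + w) + (z - tanh z) + (w - tanh w)) * D 2 x\<bar> \<le> 2 * w * (k\<^sup>2 * M2)"
  proof -
    have "(G - 1) * (z + w) \<le> w\<^sup>2 * (w + w)"
      using order_trans[OF G(2) power_mono[OF z0(2)]] z0 by (intro mult_mono) auto
    moreover have "z - tanh z \<le> w ^ 3"
      using self_minus_tanh_le_cube[of z] power_mono[of z w 3] z0 by linarith
    moreover have "w - tanh w \<le> w ^ 3" using self_minus_tanh_le_cube[of w] w0 by simp
    ultimately have "(G - 1) * (z + w) + (z - tanh z) + (w - tanh w) \<le> 4 * w ^ 3"
      by (simp add: power2_eq_square power3_eq_cube)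
    moreover have "0 \<le> (G - 1) * (z + w) + (z - tanh z) + (w - tanh w)"
      using G tz z0 by (intro add_nonneg_nonneg mult_nonneg_nonneg) auto
    ultimately have "\<bar>2 / \<beta>\<^sup>2 * ((G - 1) * (z + w) + (z - tanh z) + (w - tanh w))\<bar> \<le> 2 / \<beta>\<^sup>2 * (4 * w ^ 3)"
      using \<beta> by (simp add: abs_mult divide_right_mono)
    also have "\<dots> = 2 * (w * k\<^sup>2)" unfolding wk by simp
    finally have *: "\<bar>2 / \<beta>\<^sup>2 * ((G - 1) * (z + w) + (z - tanh z) + (w - tanh w))\<bar> \<le> 2 * (w * k\<^sup>2)" .
    show ?thesis unfolding abs_mult[of "2 / \<beta>\<^sup>2 * _"]
      by (rule order_trans[OF mult_mono[OF * Mx(2)]]) (use w0 in \<open>auto simp: mult.assoc\<close>)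
  qed
  have b3: "\<bar>(2 / \<beta> * G * ((k\<^sup>2 - h\<^sup>2) / 6) - 2 / \<beta> * (w * tanh w - z * tanh z) / \<beta>\<^sup>2) * D 3 x\<bar>
      \<le> w * (4 + 2 * Z) * ((k - h) * M3)"
  proof -
    have "2 / \<beta> * G * ((k\<^sup>2 - h\<^sup>2) / 6) = 2 / \<beta> * G * ((k - h) * (k + h) / 6)"
      by (simp add: power2_eq_square algebra_simps)
    also have "\<dots> \<le> 2 / \<beta> * (1 + Z) * ((k - h) * (k + k) / 6)"
      using G z0 hk \<beta> by (intro mult_mono divide_right_mono mult_left_mono) auto
    also have "\<dots> = 4 / 3 * (1 + Z) * w * (k - h) / \<beta>\<^sup>2"
      unfolding w_def using \<beta> by (simp add: field_simps power2_eq_square)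
    finally have p: "2 / \<beta> * G * ((k\<^sup>2 - h\<^sup>2) / 6) \<le> 4 / 3 * (1 + Z) * w * (k - h) / \<beta>\<^sup>2" .
    have "2 / \<beta> * (w * tanh w - z * tanh z) \<le> 2 / \<beta> * (2 * w * (w - z))"
      using self_tanh_diff_le[of z w] z0 \<beta> by (intro mult_left_mono) auto
    also have "\<dots> = 2 * w * (k - h)" unfolding w_def z_def using \<beta> by (simp add: field_simps)
    finally have q: "2 / \<beta> * (w * tanh w - z * tanh z) / \<beta>\<^sup>2 \<le> 2 * w * (k - h) / \<beta>\<^sup>2"
      by (intro divide_right_mono) auto
    have p0: "0 \<le> 2 / \<beta> * G * ((k\<^sup>2 - h\<^sup>2) / 6)"
      using G \<beta> hk by (auto intro!: mult_nonneg_nonneg)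
    have q0: "0 \<le> 2 / \<beta> * (w * tanh w - z * tanh z) / \<beta>\<^sup>2"
      using self_tanh_diff_le[of z w] z0 \<beta> by (auto intro!: mult_nonneg_nonneg divide_nonneg_nonneg)
    have "4 / 3 * (1 + Z) * w * (k - h) / \<beta>\<^sup>2 + 2 * w * (k - h) / \<beta>\<^sup>2
        = (4 / 3 * (1 + Z) + 2) * (w * (k - h) / \<beta>\<^sup>2)" using \<beta> by (simp add: field_simps)
    also have "\<dots> \<le> (4 + 2 * Z) * (w * (k - h) / \<beta>\<^sup>2)"
      using z0 w0 hk by (intro mult_right_mono) auto
    finally have "\<bar>2 / \<beta> * G * ((k\<^sup>2 - h\<^sup>2) / 6) - 2 / \<beta> * (w * tanh w - z * tanh z) / \<beta>\<^sup>2\<bar>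
        \<le> (4 + 2 * Z) * (w * (k - h) / \<beta>\<^sup>2)" using p q p0 q0 by linarith
    then have "\<bar>(2 / \<beta> * G * ((k\<^sup>2 - h\<^sup>2) / 6) - 2 / \<beta> * (w * tanh w - z * tanh z) / \<beta>\<^sup>2) * D 3 x\<bar>
        \<le> (4 + 2 * Z) * (w * (k - h) / \<beta>\<^sup>2) * \<bar>D 3 x\<bar>"
      unfolding abs_mult by (intro mult_right_mono) auto
    also have "\<dots> = (4 + 2 * Z) * (w * (k - h)) * (\<bar>D 3 x\<bar> / \<beta>\<^sup>2)" by simp
    also have "\<dots> \<le> (4 + 2 * Z) * (w * (k - h)) * M3"
      using Mx(3) z0 w0 hk by (intro mult_left_mono) auto
    finally show ?thesis by (simp add: algebra_simps)
  qed
  have b4: "\<bar>2 / \<beta> * G * (R / k + R' / h) - (tanh z * S' + tanh w * S) / \<beta>\<^sup>2\<bar> \<le> w * (4 + 2 * Z) * (k\<^sup>2 * M4)"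
  proof -
    have "\<bar>R / k\<bar> \<le> Q * k ^ 3 / 6" "\<bar>R' / h\<bar> \<le> Q * h ^ 3 / 6"
      using R R' hk by (auto simp: abs_divide divide_le_eq power_numeral_reduce algebra_simps)
    moreover have "Q * h ^ 3 \<le> Q * k ^ 3" using hk Q by (intro mult_left_mono power_mono) auto
    ultimately have "\<bar>R / k + R' / h\<bar> \<le> Q * k ^ 3 / 3" by linarith
    then have "\<bar>2 / \<beta> * G * (R / k + R' / h)\<bar> \<le> 2 / \<beta> * (1 + Z) * (Q * k ^ 3 / 3)"
      unfolding abs_mult using G z0 \<beta> by (intro mult_mono) auto
    also have "\<dots> = 4 / 3 * (1 + Z) * (w * k\<^sup>2 * M4)"
      unfolding Q_def w_def using \<beta> by (simp add: field_simps power2_eq_square power3_eq_cube)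
    finally have p: "\<bar>2 / \<beta> * G * (R / k + R' / h)\<bar> \<le> 4 / 3 * (1 + Z) * (w * k\<^sup>2 * M4)" .
    have "\<bar>tanh z * S' + tanh w * S\<bar> \<le> tanh z * \<bar>S'\<bar> + tanh w * \<bar>S\<bar>"
      using tz by (intro order_trans[OF abs_triangle_ineq]) (auto simp: abs_mult)
    also have "\<dots> \<le> w * (Q * k\<^sup>2) + w * (Q * k\<^sup>2)"
      using tz S S' hk Q power_mono[of h k 2] mult_left_mono[of "h\<^sup>2" "k\<^sup>2" Q]
      by (intro add_mono mult_mono) auto
    finally have "\<bar>tanh z * S' + tanh w * S\<bar> \<le> 2 * (w * k\<^sup>2 * Q)" by (simp add: algebra_simps)
    then have "\<bar>tanh z * S' + tanh w * S\<bar> / \<beta>\<^sup>2 \<le> 2 * (w * k\<^sup>2 * Q) / \<beta>\<^sup>2" by (intro divide_right_mono) auto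
    then have q: "\<bar>(tanh z * S' + tanh w * S) / \<beta>\<^sup>2\<bar> \<le> 2 * (w * k\<^sup>2 * M4)"
      using Q(2) by (simp add: abs_divide mult.assoc flip: Q(2))
    have "\<bar>2 / \<beta> * G * (R / k + R' / h) - (tanh z * S' + tanh w * S) / \<beta>\<^sup>2\<bar>
      \<le> 4 / 3 * (1 + Z) * (w * k\<^sup>2 * M4) + 2 * (w * k\<^sup>2 * M4)"
      using p q by linarith
    also have "\<dots> = (4 / 3 * (1 + Z) + 2) * (w * k\<^sup>2 * M4)" by (simp only: distrib_right)
    also have "\<dots> \<le> (4 + 2 * Z) * (w * k\<^sup>2 * M4)"
      using z0 w0 M0 by (intro mult_right_mono) auto
    also have "\<dots> = w * (4 + 2 * Z) * (k\<^sup>2 * M4)" by (simp add: algebra_simps)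
    finally show ?thesis .
  qed
  define P where "P = (k - h) * (M1 + M3) + k\<^sup>2 * (M2 + M4)"
  have P0: "0 \<le> P" "0 \<le> (k - h) * M1" "0 \<le> (k - h) * M3" "0 \<le> k\<^sup>2 * M2" "0 \<le> k\<^sup>2 * M4"
    unfolding P_def using M0 hk by auto
  have c: "a * b \<le> (4 + 2 * Z) * w * b" if "0 \<le> b" "a \<le> 2 * w" for a b
    using that z0 w0 mult_right_mono[of 2 "4 + 2 * Z" w] by (intro mult_right_mono) linarith+
  have "\<bar>truncation \<beta> (D 0) (D 2) x h k\<bar> \<le> w * ((k - h) * M1) + 2 * w * (k\<^sup>2 * M2)
       + w * (4 + 2 * Z) * ((k - h) * M3) + w * (4 + 2 * Z) * (k\<^sup>2 * M4)"
    unfolding split using b1 b2 b3 b4 by linarith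
  also have "\<dots> \<le> (4 + 2 * Z) * w * ((k - h) * M1) + (4 + 2 * Z) * w * (k\<^sup>2 * M2)
       + (4 + 2 * Z) * w * ((k - h) * M3) + (4 + 2 * Z) * w * (k\<^sup>2 * M4)"
    using c[OF P0(2), of w] c[OF P0(4), of "2 * w"] w0 unfolding mult.commute[of w "4 + 2 * Z"] by linarith
  also have "\<dots> = (4 + 2 * Z) * w * P" unfolding P_def by (simp add: algebra_simps)
  also have "\<dots> \<le> (4 + 2 * Z) * (tanh w * (1 + Z)) * P"
  proof -
    have "w \<le> tanh w * (1 + Z)"
      using self_le_tanh_times[of w] mult_left_mono[of "1 + w" "1 + Z" "tanh w"] w0 z0 tz by linarith
    then show ?thesis using z0 w0 P0 by (intro mult_right_mono mult_left_mono) auto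
  qed
  also have "\<dots> = (4 + 2 * Z) * (1 + Z) * (tanh w * P)" by simp
  also have "\<dots> \<le> 8 * (1 + Z)\<^sup>2 * (tanh w * P)"
    using z0 w0 tz P0 by (intro mult_right_mono) (auto simp: power2_eq_square algebra_simps)
  finally show ?thesis unfolding P_def w_def by (simp add: mult.assoc)
qed

lemma layer_drop:
  assumes "0 \<le> m" "0 < \<epsilon>" "0 \<le> h"
  shows "layer m \<epsilon> x - layer m \<epsilon> (x + h) \<le> layer m \<epsilon> x * (sqrt m * h / \<epsilon>)"
    "layer m \<epsilon> x - layer m \<epsilon> (x + h) \<le> layer m \<epsilon> x"
proof -
  have "1 - sqrt m * h / \<epsilon> \<le> layer m \<epsilon> h"
    using exp_ge_add_one_self[of "- (sqrt m * h / \<epsilon>)"] by (simp add: layer_def)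
  from mult_left_mono[OF this, of "layer m \<epsilon> x"]
  show "layer m \<epsilon> x - layer m \<epsilon> (x + h) \<le> layer m \<epsilon> x * (sqrt m * h / \<epsilon>)"
    by (simp add: layer_add algebra_simps less_imp_le)
  show "layer m \<epsilon> x - layer m \<epsilon> (x + h) \<le> layer m \<epsilon> x" by (simp add: less_imp_le)
qed

text \<open>
  Both estimates compare \<open>D 0\<close> with explicit functions: \<open>C (s + (e\<^sub>r - e\<^sub>l) / sqrt m) \<plusminus> D 0\<close> is
  nondecreasing and \<open>C (s\<^sup>2 / 2 + (e\<^sub>l + e\<^sub>r) / m) \<plusminus> D 0\<close> is convex, where \<open>e\<^sub>l, e\<^sub>r\<close> are the left and right
  layer functions. In the divided second difference of the layer functions the nonpositive terms
  are dropped; the others can be estimated on steps of any size relative to \<open>\<epsilon>\<close>.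
\<close>

lemma difference_quotient_bounds:
  fixes D :: "nat \<Rightarrow> real \<Rightarrow> real"
  assumes D: "layer_bounded C m \<epsilon> D" and C: "0 \<le> C" and m: "0 < m" and \<epsilon>: "0 < \<epsilon>"
    and hk: "0 < h" "0 < k" and x: "0 \<le> x - h" "x + k \<le> 1"
  shows "\<bar>D 0 (x + k) - D 0 x\<bar> \<le> C * (k + (layer m \<epsilon> x + layer m \<epsilon> (1 - (x + k))) / sqrt m)"
    and "\<bar>(D 0 (x + k) - D 0 x) / k - (D 0 x - D 0 (x - h)) / h\<bar>
      \<le> C * ((h + k) + ((layer m \<epsilon> (x - h) - layer m \<epsilon> x) / h
           + (layer m \<epsilon> (1 - (x + k)) - layer m \<epsilon> (1 - x)) / k) / m)"
proof -
  let ?l = "layer m \<epsilon>"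
  have at: "at s within {0..1} = at s" if "0 < s" "s < 1" for s :: real
    using that by (intro at_within_interior) auto
  have cont: "continuous_on {a..b} (D 0)" if "0 \<le> a" "b \<le> 1" for a b
    using D that by (intro continuous_on_subset[OF DERIV_continuous_on[of "{0..1}" "D 0" "D 1"]])
      (auto simp: layer_bounded_def)
  have d0: "(D 0 has_real_derivative D 1 s) (at s)" and d1: "(D 1 has_real_derivative D 2 s) (at s)"
    and b1: "\<bar>D 1 s\<bar> \<le> C * (1 + layers m \<epsilon> s / \<epsilon>)" and b2: "\<bar>D 2 s\<bar> \<le> C * (1 + layers m \<epsilon> s / \<epsilon>\<^sup>2)"
    if s: "0 < s" "s < 1" for s
  proof -
    have "s \<in> {0..1}" using s by auto
    moreover have "\<forall>i<4. \<forall>s\<in>{0..1}. (D i has_real_derivative D (Suc i) s) (at s within {0..1})"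
      using D by (simp add: layer_bounded_def)
    ultimately have "\<forall>i<4. (D i has_real_derivative D (Suc i) s) (at s)"
      using at[OF s] by metis
    from this[rule_format, of 0] this[rule_format, of 1]
    show "(D 0 has_real_derivative D 1 s) (at s)" "(D 1 has_real_derivative D 2 s) (at s)"
      by (simp_all add: numeral_2_eq_2)
    show "\<bar>D 1 s\<bar> \<le> C * (1 + layers m \<epsilon> s / \<epsilon>)" "\<bar>D 2 s\<bar> \<le> C * (1 + layers m \<epsilon> s / \<epsilon>\<^sup>2)"
      using D \<open>s \<in> {0..1}\<close> by (auto simp: layer_bounded_def)
  qed
  have sm: "0 < sqrt m" "sqrt m * sqrt m = m" using m by auto
  have sms: "sqrt m * (sqrt m * X) = m * X" for X using m by (simp add: sqrt_sqrt_times)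
  have "0 \<le> C * (k + (?l x - ?l (x + k) + (?l (1 - (x + k)) - ?l (1 - x))) / sqrt m) - \<sigma> * (D 0 (x + k) - D 0 x)"
    if \<sigma>: "\<sigma> = 1 \<or> \<sigma> = - 1" for \<sigma> :: real
  proof -
    define W where "W = (\<lambda>s. C * (s + (?l (1 - s) - ?l s) / sqrt m) - \<sigma> * D 0 s)"
    have "W x \<le> W (x + k)"
    proof (rule DERIV_nonneg_imp_increasing_open[of x "x + k" W])
      fix s assume s: "x < s" "s < x + k"
      then have s01: "0 < s" "s < 1" using x hk by auto
      have "(W has_real_derivative C * (1 + layers m \<epsilon> s / \<epsilon>) - \<sigma> * D 1 s) (at s)"
        unfolding W_def using d0[OF s01] layer_deriv[of m \<epsilon> s UNIV] layer_reflected_deriv[of m \<epsilon> s UNIV] sm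
        by (auto intro!: derivative_eq_intros simp: layers_def field_simps sms add_divide_distrib)
      moreover have "0 \<le> C * (1 + layers m \<epsilon> s / \<epsilon>) - \<sigma> * D 1 s" using b1[OF s01] \<sigma> by auto
      ultimately show "\<exists>y. (W has_real_derivative y) (at s) \<and> 0 \<le> y" by blast
    next
      show "continuous_on {x..x + k} W"
        unfolding W_def using x hk layer_deriv layer_reflected_deriv sm
        by (intro continuous_intros cont DERIV_continuous_on[of _ "?l"] DERIV_continuous_on[of _ "\<lambda>s. ?l (1 - s)"]) auto
    qed (use hk in auto)
    then show ?thesis unfolding W_def by (simp add: algebra_simps diff_divide_distrib add_divide_distrib)
  qed
  from this[of 1] this[of "- 1"]
  have "\<bar>D 0 (x + k) - D 0 x\<bar> \<le> C * (k + (?l x - ?l (x + k) + (?l (1 - (x + k)) - ?l (1 - x))) / sqrt m)"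
    by auto
  also have "\<dots> \<le> C * (k + (?l x + ?l (1 - (x + k))) / sqrt m)"
    using C sm layer_pos[of m \<epsilon> "x + k"] layer_pos[of m \<epsilon> "1 - x"]
    by (intro mult_left_mono add_left_mono divide_right_mono) linarith+
  finally show "\<bar>D 0 (x + k) - D 0 x\<bar> \<le> C * (k + (?l x + ?l (1 - (x + k))) / sqrt m)" .
  define E where "E = (\<lambda>s. s\<^sup>2 / 2 + layers m \<epsilon> s / m)"
  define E1 where "E1 = (\<lambda>s. s + (?l (1 - s) - ?l s) / (sqrt m * \<epsilon>))"
  have dE: "(E has_real_derivative E1 s) (at s)" for s
  proof -
    have "((\<lambda>s. s\<^sup>2 / 2) has_real_derivative s) (at s)"
      by (auto intro!: derivative_eq_intros)
    from DERIV_add[OF this DERIV_cdivide[OF DERIV_add[OF layer_deriv layer_reflected_deriv]]]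
    have "(E has_real_derivative s + (- (sqrt m / \<epsilon>) * ?l s + sqrt m / \<epsilon> * ?l (1 - s)) / m) (at s)"
      unfolding E_def layers_def .
    moreover have "(- (sqrt m / \<epsilon>) * ?l s + sqrt m / \<epsilon> * ?l (1 - s)) / m
        = sqrt m / m * ((?l (1 - s) - ?l s) / \<epsilon>)"
      by (simp add: diff_divide_distrib add_divide_distrib algebra_simps)
    moreover have "sqrt m / m = 1 / sqrt m" using m by (simp add: field_simps)
    ultimately show ?thesis unfolding E1_def by simp
  qed
  have dE1: "(E1 has_real_derivative 1 + layers m \<epsilon> s / \<epsilon>\<^sup>2) (at s)" for s
  proof -
    have "(E1 has_real_derivative 1 + (sqrt m / \<epsilon> * ?l (1 - s) - - (sqrt m / \<epsilon>) * ?l s) / (sqrt m * \<epsilon>)) (at s)"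
      unfolding E1_def
      by (intro DERIV_add DERIV_ident DERIV_cdivide DERIV_diff layer_deriv layer_reflected_deriv)
    moreover have "(sqrt m / \<epsilon> * ?l (1 - s) - - (sqrt m / \<epsilon>) * ?l s) / (sqrt m * \<epsilon>)
        = sqrt m * (?l s + ?l (1 - s)) / \<epsilon> / (sqrt m * \<epsilon>)"
      by (simp add: diff_divide_distrib add_divide_distrib algebra_simps)
    moreover have "\<dots> = layers m \<epsilon> s / \<epsilon>\<^sup>2"
      using sm(1) \<epsilon> by (simp add: layers_def power2_eq_square)
    ultimately show ?thesis by simp
  qed
  have conv: "0 \<le> C * ((E (x + k) - E x) / k - (E x - E (x - h)) / h)
        - \<sigma> * ((D 0 (x + k) - D 0 x) / k - (D 0 x - D 0 (x - h)) / h)"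
    if \<sigma>: "\<sigma> = 1 \<or> \<sigma> = - 1" for \<sigma> :: real
  proof -
    define W where "W = (\<lambda>s. C * E s - \<sigma> * D 0 s)"
    define W1 where "W1 = (\<lambda>s. C * E1 s - \<sigma> * D 1 s)"
    have W: "(W has_real_derivative W1 s) (at s)" if "0 < s" "s < 1" for s
      unfolding W_def W1_def using d0[OF that] dE[of s] by (auto intro!: derivative_eq_intros)
    have W1: "(W1 has_real_derivative C * (1 + layers m \<epsilon> s / \<epsilon>\<^sup>2) - \<sigma> * D 2 s) (at s)" if "0 < s" "s < 1" for s
      unfolding W1_def using d1[OF that] dE1[of s] by (auto intro!: derivative_eq_intros)
    have contW: "continuous_on {a..b} W" if "0 \<le> a" "b \<le> 1" for a b
      unfolding W_def using that dE
      by (intro continuous_intros cont DERIV_continuous_on[of _ E]) (auto intro: has_field_derivative_at_within)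
    have mvt: "\<exists>\<xi>. a < \<xi> \<and> \<xi> < b \<and> W b - W a = (b - a) * W1 \<xi>" if ab: "0 \<le> a" "a < b" "b \<le> 1" for a b
    proof -
      have "W differentiable (at s)" if "a < s" "s < b" for s
        using W[of s] that ab by (auto simp: real_differentiable_def)
      then obtain l \<xi> where l: "a < \<xi>" "\<xi> < b" "(W has_real_derivative l) (at \<xi>)" "W b - W a = (b - a) * l"
        using MVT[OF ab(2) contW[OF ab(1,3)]] by blast
      have "l = W1 \<xi>" using l ab by (intro DERIV_unique[OF l(3) W]) auto
      with l show ?thesis by blast
    qed
    obtain \<xi> where \<xi>: "x < \<xi>" "\<xi> < x + k" "W (x + k) - W x = k * W1 \<xi>"
      using mvt[of x "x + k"] x hk by auto
    obtain \<eta> where \<eta>: "x - h < \<eta>" "\<eta> < x" "W x - W (x - h) = h * W1 \<eta>"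
      using mvt[of "x - h" x] x hk by auto
    have "W1 \<eta> \<le> W1 \<xi>"
    proof (rule DERIV_nonneg_imp_nondecreasing[of \<eta> \<xi> W1])
      fix s assume "\<eta> \<le> s" "s \<le> \<xi>"
      then have s: "0 < s" "s < 1" using \<xi> \<eta> x hk by auto
      have "0 \<le> C * (1 + layers m \<epsilon> s / \<epsilon>\<^sup>2) - \<sigma> * D 2 s" using b2[OF s] \<sigma> by auto
      then show "\<exists>y. (W1 has_real_derivative y) (at s) \<and> 0 \<le> y" using W1[OF s] by blast
    qed (use \<xi> \<eta> in auto)
    then have "(W x - W (x - h)) / h \<le> (W (x + k) - W x) / k" using \<xi> \<eta> hk by simp
    moreover have "(W (x + k) - W x) / k - (W x - W (x - h)) / h =
        C * ((E (x + k) - E x) / k - (E x - E (x - h)) / h)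
        - \<sigma> * ((D 0 (x + k) - D 0 x) / k - (D 0 x - D 0 (x - h)) / h)"
      unfolding W_def by (simp add: algebra_simps diff_divide_distrib add_divide_distrib)
    ultimately show ?thesis by simp
  qed
  have "(E (x + k) - E x) / k - (E x - E (x - h)) / h
     = (h + k) / 2 + ((?l (x + k) - ?l x) / k + (?l (x - h) - ?l x) / h
        + (?l (1 - (x + k)) - ?l (1 - x)) / k + (?l (1 - (x - h)) - ?l (1 - x)) / h) / m"
  proof -
    have "((x + k)\<^sup>2 / 2 - x\<^sup>2 / 2) / k - (x\<^sup>2 / 2 - (x - h)\<^sup>2 / 2) / h = (h + k) / 2"
      using hk by (simp add: field_simps power2_eq_square)
    then show ?thesis unfolding E_def layers_def
      by (simp add: algebra_simps diff_divide_distrib add_divide_distrib)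
  qed
  also have "\<dots> \<le> (h + k) + ((?l (x - h) - ?l x) / h + (?l (1 - (x + k)) - ?l (1 - x)) / k) / m"
  proof -
    have "(?l (x + k) - ?l x) / k \<le> 0" "(?l (1 - (x - h)) - ?l (1 - x)) / h \<le> 0"
      using hk m \<epsilon> by (auto simp: divide_le_0_iff intro!: layer_antimono)
    then have "(?l (x + k) - ?l x) / k + (?l (x - h) - ?l x) / h
        + (?l (1 - (x + k)) - ?l (1 - x)) / k + (?l (1 - (x - h)) - ?l (1 - x)) / h
      \<le> (?l (x - h) - ?l x) / h + (?l (1 - (x + k)) - ?l (1 - x)) / k" by linarith
    then show ?thesis using hk m by (intro add_mono[OF _ divide_right_mono]) auto
  qed
  finally have Eb: "(E (x + k) - E x) / k - (E x - E (x - h)) / h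
     \<le> (h + k) + ((?l (x - h) - ?l x) / h + (?l (1 - (x + k)) - ?l (1 - x)) / k) / m" .
  have "\<bar>(D 0 (x + k) - D 0 x) / k - (D 0 x - D 0 (x - h)) / h\<bar>
     \<le> C * ((E (x + k) - E x) / k - (E x - E (x - h)) / h)"
    using conv[of 1] conv[of "- 1"] by auto
  also have "\<dots> \<le> C * ((h + k) + ((?l (x - h) - ?l x) / h + (?l (1 - (x + k)) - ?l (1 - x)) / k) / m)"
    using Eb C by (rule mult_left_mono)
  finally show "\<bar>(D 0 (x + k) - D 0 x) / k - (D 0 x - D 0 (x - h)) / h\<bar>
     \<le> C * ((h + k) + ((?l (x - h) - ?l x) / h + (?l (1 - (x + k)) - ?l (1 - x)) / k) / m)" .
qed

text \<open>
  With \<open>k\<close> at least a multiple of \<open>\<epsilon>\<close> no cancellation between the terms is needed: \<open>\<epsilon>\<close> may be replaced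
  by \<open>k\<close> wherever it multiplies the smooth part, and the layer part is bounded by the layer
  functions themselves, since each difference quotient of them is at most a constant times their
  value divided by the larger of the step and \<open>\<epsilon>\<close>. The assumption \<open>h \<le> k\<close> makes \<open>(z / tanh z) / \<beta>\<close> of order \<open>k\<close>.
\<close>

lemma truncation_coarse:
  assumes C: "0 \<le> C" and m: "0 < m" and \<gamma>: "0 < \<gamma>" and K: "0 < K"
  shows "\<exists>B\<ge>0. \<forall>\<epsilon> D x h k. 0 < \<epsilon> \<longrightarrow> layer_bounded C m \<epsilon> D \<longrightarrow> 0 < h \<longrightarrow> h \<le> k \<longrightarrow>
      0 \<le> x - h \<longrightarrow> x + k \<le> 1 \<longrightarrow> K * \<epsilon> \<le> k \<longrightarrow>
      \<bar>truncation (sqrt \<gamma> / \<epsilon>) (D 0) (D 2) x h k\<bar>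
        \<le> B * ((k - h) + k\<^sup>2 + (layer m \<epsilon> (x - h) + layer m \<epsilon> (1 - (x + k))))"
proof -
  define g where "g = sqrt \<gamma>"
  define c where "c = 1 + 2 / (g * K)"
  define d where "d = 2 / g * sqrt m + 1"
  define B where "B = C * (2 / sqrt m + 4 * c + 2 * d / m + 2 * c / m + 4 / (\<gamma> * K\<^sup>2) + 8 / \<gamma> + 1)"
  have g: "0 < g" "g\<^sup>2 = \<gamma>" using \<gamma> by (auto simp: g_def)
  have c1: "1 \<le> c" "1 \<le> d" using g K m by (auto simp: c_def d_def)
  have "0 \<le> B" unfolding B_def using C m \<gamma> c1 by (intro mult_nonneg_nonneg add_nonneg_nonneg) auto
  moreover have "\<bar>truncation (sqrt \<gamma> / \<epsilon>) (D 0) (D 2) x h k\<bar>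
        \<le> B * ((k - h) + k\<^sup>2 + (layer m \<epsilon> (x - h) + layer m \<epsilon> (1 - (x + k))))"
    if \<epsilon>: "0 < \<epsilon>" and D: "layer_bounded C m \<epsilon> D" and hk: "0 < h" "h \<le> k"
      and x: "0 \<le> x - h" "x + k \<le> 1" and \<epsilon>K: "K * \<epsilon> \<le> k" for \<epsilon> D x h k
  proof -
    let ?l = "layer m \<epsilon>"
    define \<beta> where "\<beta> = sqrt \<gamma> / \<epsilon>"
    define z where "z = \<beta> * h / 2"
    define w where "w = \<beta> * k / 2"
    define E where "E = ?l (x - h) + ?l (1 - (x + k))"
    have sm: "0 < sqrt m" using m by simp
    have \<beta>: "0 < \<beta>" "2 / \<beta> = 2 / g * \<epsilon>" "1 / \<beta>\<^sup>2 = \<epsilon>\<^sup>2 / \<gamma>"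
      using g \<epsilon> unfolding \<beta>_def g_def[symmetric] by (auto simp: power_divide)
    have E0: "0 \<le> E" "0 \<le> ?l (x - h)" "0 \<le> ?l (1 - (x + k))"
      unfolding E_def by (intro add_nonneg_nonneg less_imp_le layer_pos)+
    have z0: "0 < z" "z \<le> w" "0 < w" using \<beta> hk by (auto simp: z_def w_def mult_left_mono)
    have \<epsilon>k: "\<epsilon> \<le> k / K" using K \<epsilon>K by (simp add: field_simps)
    have D1: "\<bar>2 / \<beta> * (w / tanh w - z / tanh z) * ((D 0 (x + k) - D 0 x) / k)\<bar>
        \<le> C * ((k - h) + 2 / sqrt m * E)"
    proof -
      have "2 / \<beta> * (w / tanh w - z / tanh z) \<le> 2 / \<beta> * (w - z)"
        using coth_weight_diff[OF z0(1,2)] \<beta>(1) by (intro mult_left_mono) auto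
      also have "\<dots> = k - h" unfolding w_def z_def using \<beta>(1) by (simp add: field_simps)
      finally have 1: "2 / \<beta> * (w / tanh w - z / tanh z) \<le> k - h" .
      have 0: "0 \<le> 2 / \<beta> * (w / tanh w - z / tanh z)"
        using coth_weight_diff[OF z0(1,2)] \<beta>(1) by (intro mult_nonneg_nonneg) auto
      have "\<bar>D 0 (x + k) - D 0 x\<bar> \<le> C * (k + (?l x + ?l (1 - (x + k))) / sqrt m)"
        using difference_quotient_bounds(1)[OF D C m \<epsilon> hk(1) _ x] hk by simp
      also have "\<dots> \<le> C * (k + E / sqrt m)"
        unfolding E_def using C sm m \<epsilon> hk
        by (intro mult_left_mono add_left_mono divide_right_mono add_right_mono layer_antimono) auto
      finally have 2: "\<bar>(D 0 (x + k) - D 0 x) / k\<bar> \<le> C * (k + E / sqrt m) / k"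
        using hk by (simp add: abs_divide divide_right_mono)
      have "\<bar>2 / \<beta> * (w / tanh w - z / tanh z) * ((D 0 (x + k) - D 0 x) / k)\<bar>
          \<le> (k - h) * (C * (k + E / sqrt m) / k)"
        unfolding abs_mult[of "2 / \<beta> * _"] using 0 1 2 hk by (intro mult_mono) auto
      also have "\<dots> = C * ((k - h) + (k - h) / k * (E / sqrt m))"
      proof -
        have "(k - h) * (C * (k + e) / k) = C * ((k - h) + (k - h) / k * e)" for e
          using hk by (simp add: field_simps)
        then show ?thesis .
      qed
      also have "\<dots> \<le> C * ((k - h) + 2 * (E / sqrt m))"
        using C E0 sm hk by (intro mult_left_mono add_left_mono mult_right_mono) (auto simp: divide_le_eq)
      finally show ?thesis by simp
    qed
    have D2: "\<bar>2 / \<beta> * (z / tanh z) * ((D 0 (x + k) - D 0 x) / k - (D 0 x - D 0 (x - h)) / h)\<bar>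
        \<le> C * (2 * c * k\<^sup>2 + (d + c) / m * E)"
    proof -
      have "z / tanh z \<le> 1 + z" using self_le_tanh_times[of z] z0 by (simp add: divide_le_eq mult.commute)
      then have "2 / \<beta> * (z / tanh z) \<le> 2 / \<beta> * (1 + z)" using \<beta>(1) by (intro mult_left_mono) auto
      also have "\<dots> = 2 / g * \<epsilon> + h" unfolding z_def distrib_left \<beta>(2)[symmetric] using \<beta>(1) by simp
      finally have 1: "2 / \<beta> * (z / tanh z) \<le> 2 / g * \<epsilon> + h" .
      have 0: "0 \<le> 2 / \<beta> * (z / tanh z)" using \<beta>(1) z0 by simp
      have P: "2 / g * \<epsilon> + h \<le> c * k" "0 \<le> 2 / g * \<epsilon> + h"
      proof -
        have "2 / g * \<epsilon> \<le> 2 / g * (k / K)" using \<epsilon>k g by (intro mult_left_mono) auto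
        then show "2 / g * \<epsilon> + h \<le> c * k" unfolding c_def distrib_right using hk by simp
        show "0 \<le> 2 / g * \<epsilon> + h" using g \<epsilon> hk by (intro add_nonneg_nonneg mult_nonneg_nonneg) auto
      qed
      define A where "A = (?l (x - h) - ?l x) / h"
      define B where "B = (?l (1 - (x + k)) - ?l (1 - x)) / k"
      have AB0: "0 \<le> A" "0 \<le> B" unfolding A_def B_def using hk m \<epsilon>
        by (auto intro!: divide_nonneg_pos layer_antimono)
      have dA: "?l (x - h) - ?l x \<le> ?l (x - h) * (sqrt m * h / \<epsilon>)" "?l (x - h) - ?l x \<le> ?l (x - h)"
        using layer_drop[of m \<epsilon> h "x - h"] m \<epsilon> hk by auto
      have "(2 / g * \<epsilon> + h) * A = 2 / g * (\<epsilon> * A) + (?l (x - h) - ?l x)"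
        unfolding A_def distrib_right using hk by simp
      moreover have "\<epsilon> * A \<le> ?l (x - h) * sqrt m"
        using dA(1) hk \<epsilon> unfolding A_def by (simp add: field_simps)
      then have "2 / g * (\<epsilon> * A) \<le> 2 / g * (?l (x - h) * sqrt m)" using g by (intro mult_left_mono) auto
      ultimately have "(2 / g * \<epsilon> + h) * A \<le> 2 / g * (?l (x - h) * sqrt m) + ?l (x - h)"
        using dA(2) by linarith
      then have PA: "(2 / g * \<epsilon> + h) * A \<le> d * ?l (x - h)" by (simp add: d_def algebra_simps)
      have "k * B \<le> ?l (1 - (x + k))" unfolding B_def using hk by (simp add: less_imp_le)
      then have "c * (k * B) \<le> c * ?l (1 - (x + k))" using c1 by (intro mult_left_mono) auto
      moreover have "(2 / g * \<epsilon> + h) * B \<le> c * k * B" using P AB0 by (intro mult_right_mono) auto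
      ultimately have PB: "(2 / g * \<epsilon> + h) * B \<le> c * ?l (1 - (x + k))" by simp
      have "d * ?l (x - h) \<le> d * E" "c * ?l (1 - (x + k)) \<le> c * E"
        using E0 c1 unfolding E_def by (auto intro!: mult_left_mono)
      with PA PB have PAB: "(2 / g * \<epsilon> + h) * (A + B) \<le> (d + c) * E"
        unfolding distrib_left[of "2 / g * \<epsilon> + h"] distrib_right[of d] by linarith
      have "(2 / g * \<epsilon> + h) * (h + k) \<le> (c * k) * (k + k)"
        using P hk c1 by (intro mult_mono) auto
      then have Ph: "(2 / g * \<epsilon> + h) * (h + k) \<le> 2 * c * k\<^sup>2" by (simp add: power2_eq_square algebra_simps)
      have "\<bar>2 / \<beta> * (z / tanh z) * ((D 0 (x + k) - D 0 x) / k - (D 0 x - D 0 (x - h)) / h)\<bar>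
        \<le> (2 / g * \<epsilon> + h) * (C * ((h + k) + (A + B) / m))"
        unfolding abs_mult[of "2 / \<beta> * _"] A_def B_def
        using difference_quotient_bounds(2)[OF D C m \<epsilon> hk(1) _ x] 0 1 hk P(2)
        by (intro mult_mono) auto
      also have "\<dots> = C * ((2 / g * \<epsilon> + h) * (h + k) + (2 / g * \<epsilon> + h) * (A + B) / m)"
        by (simp only: distrib_left[of "2 / g * \<epsilon> + h" "h + k"] mult.left_commute[of _ C] times_divide_eq_right)
      also have "\<dots> \<le> C * (2 * c * k\<^sup>2 + (d + c) * E / m)"
        using Ph PAB C m by (intro mult_left_mono add_mono divide_right_mono) auto
      finally show ?thesis by simp
    qed
    have D3: "\<bar>(tanh z * (D 2 (x - h) + D 2 x) + tanh w * (D 2 x + D 2 (x + k))) / \<beta>\<^sup>2\<bar>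
        \<le> C * (4 / (\<gamma> * K\<^sup>2) * k\<^sup>2 + 8 / \<gamma> * E)"
    proof -
      have b: "\<bar>D 2 s\<bar> \<le> C * (1 + 2 * E / \<epsilon>\<^sup>2)" if "x - h \<le> s" "s \<le> x + k" for s
      proof -
        have "layers m \<epsilon> s \<le> ?l (x - h) + ?l (1 - (x + k))" unfolding layers_def
          using that m \<epsilon> by (intro add_mono layer_antimono) auto
        then have "layers m \<epsilon> s \<le> 2 * E" using E0 unfolding E_def by simp
        then have "C * (1 + layers m \<epsilon> s / \<epsilon>\<^sup>2) \<le> C * (1 + 2 * E / \<epsilon>\<^sup>2)"
          using C by (intro mult_left_mono add_left_mono divide_right_mono) auto
        moreover have "\<bar>D 2 s\<bar> \<le> C * (1 + layers m \<epsilon> s / \<epsilon>\<^sup>2)"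
          using D that x unfolding layer_bounded_def by auto
        ultimately show ?thesis by linarith
      qed
      define M where "M = C * (1 + 2 * E / \<epsilon>\<^sup>2)"
      have b': "\<bar>D 2 (x - h)\<bar> \<le> M" "\<bar>D 2 x\<bar> \<le> M" "\<bar>D 2 (x + k)\<bar> \<le> M"
        unfolding M_def using hk by (auto intro!: b)
      have t: "0 < tanh z" "tanh z < 1" "0 < tanh w" "tanh w < 1" using z0 tanh_real_lt_1 by auto
      have "\<bar>tanh z * (D 2 (x - h) + D 2 x)\<bar> \<le> 1 * (2 * M)"
        unfolding abs_mult using t b' by (intro mult_mono) auto
      moreover have "\<bar>tanh w * (D 2 x + D 2 (x + k))\<bar> \<le> 1 * (2 * M)"
        unfolding abs_mult using t b' by (intro mult_mono) auto
      ultimately have "\<bar>tanh z * (D 2 (x - h) + D 2 x) + tanh w * (D 2 x + D 2 (x + k))\<bar> \<le> 4 * M"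
        by linarith
      then have "\<bar>(tanh z * (D 2 (x - h) + D 2 x) + tanh w * (D 2 x + D 2 (x + k))) / \<beta>\<^sup>2\<bar> \<le> 4 * M * (1 / \<beta>\<^sup>2)"
        by (simp add: abs_divide divide_right_mono)
      also have "\<dots> = C * (4 / \<gamma> * \<epsilon>\<^sup>2 + 8 / \<gamma> * E)"
        unfolding \<beta>(3) M_def using \<epsilon> \<gamma> by (simp add: field_simps)
      also have "\<dots> \<le> C * (4 / \<gamma> * (k / K)\<^sup>2 + 8 / \<gamma> * E)"
        using C \<gamma> \<epsilon> \<epsilon>k by (intro mult_left_mono add_right_mono power_mono) auto
      finally show ?thesis by (simp add: power_divide)
    qed
    define S where "S = (k - h) + k\<^sup>2 + E"
    have S: "0 \<le> S" "k - h \<le> S" "k\<^sup>2 \<le> S" "E \<le> S" unfolding S_def using E0 hk by auto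
    have "\<bar>truncation \<beta> (D 0) (D 2) x h k\<bar> \<le> C * ((k - h) + 2 / sqrt m * E)
       + C * (2 * c * k\<^sup>2 + (d + c) / m * E) + C * (4 / (\<gamma> * K\<^sup>2) * k\<^sup>2 + 8 / \<gamma> * E)"
      using truncation_split[OF \<beta>(1) hk(1), of k "D 0" "D 2" x] hk D1 D2 D3
      unfolding z_def[symmetric] w_def[symmetric] by linarith
    also have "\<dots> = C * ((k - h) + 2 / sqrt m * E + 2 * c * k\<^sup>2 + (d + c) / m * E + 4 / (\<gamma> * K\<^sup>2) * k\<^sup>2 + 8 / \<gamma> * E)"
      by (simp only: distrib_left add.assoc)
    also have "\<dots> \<le> C * (1 * S + 2 / sqrt m * S + 4 * c * S + (2 * d / m + 2 * c / m) * S + 4 / (\<gamma> * K\<^sup>2) * S + 8 / \<gamma> * S)"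
    proof (intro mult_left_mono[OF _ C] add_mono)
      show "(d + c) / m * E \<le> (2 * d / m + 2 * c / m) * S"
        using S E0 c1 m by (intro mult_mono) (auto simp: field_simps)
      show "2 * c * k\<^sup>2 \<le> 4 * c * S" using S c1 by (intro mult_mono) auto
      show "2 / sqrt m * E \<le> 2 / sqrt m * S" "4 / (\<gamma> * K\<^sup>2) * k\<^sup>2 \<le> 4 / (\<gamma> * K\<^sup>2) * S"
        "8 / \<gamma> * E \<le> 8 / \<gamma> * S"
        using S sm \<gamma> K by (intro mult_left_mono; simp)+
    qed (use S in simp)
    also have "\<dots> = B * S"
    proof -
      have "C * (1 * S + a1 * S + a2 * S + (a3 + a4) * S + a5 * S + a6 * S)
          = C * (a1 + a2 + a3 + a4 + a5 + a6 + 1) * S" for a1 a2 a3 a4 a5 a6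
        by (simp add: algebra_simps)
      then show ?thesis unfolding B_def .
    qed
    finally show ?thesis unfolding S_def E_def \<beta>_def .
  qed
  ultimately show ?thesis by blast
qed

text \<open>
  Both layer functions are monotone, so \<open>E\<close>, formed from their values at the outer ends, bounds
  their sum on the two cells.
\<close>

lemma truncation_small_steps:
  assumes C: "0 \<le> C" and m: "0 < m" and \<gamma>: "0 < \<gamma>" and K: "0 < K"
  shows "\<exists>B\<ge>0. \<forall>\<epsilon> D x h k. 0 < \<epsilon> \<longrightarrow> layer_bounded C m \<epsilon> D \<longrightarrow> 0 < h \<longrightarrow> h \<le> k \<longrightarrow>
      0 \<le> x - h \<longrightarrow> x + k \<le> 1 \<longrightarrow> k \<le> K * \<epsilon> \<longrightarrow>
      (let E = layer m \<epsilon> (x - h) + layer m \<epsilon> (1 - (x + k)) in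
      \<bar>truncation (sqrt \<gamma> / \<epsilon>) (D 0) (D 2) x h k\<bar>
        \<le> B * tanh (sqrt \<gamma> / \<epsilon> * k / 2) * ((k - h) * (1 + E / \<epsilon>) + k\<^sup>2 * (1 + E / \<epsilon>\<^sup>2)))"
proof -
  define Z where "Z = sqrt \<gamma> * K / 2"
  define B where "B = 8 * (1 + Z)\<^sup>2 * (C * (1 + 1 / \<gamma>))"
  have "0 \<le> B" unfolding B_def using C \<gamma> by simp
  moreover have "\<bar>truncation (sqrt \<gamma> / \<epsilon>) (D 0) (D 2) x h k\<bar>
        \<le> B * tanh (sqrt \<gamma> / \<epsilon> * k / 2) * ((k - h) * (1 + E / \<epsilon>) + k\<^sup>2 * (1 + E / \<epsilon>\<^sup>2))"
    if \<epsilon>: "0 < \<epsilon>" and D: "layer_bounded C m \<epsilon> D" and hk: "0 < h" "h \<le> k"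
      and x: "0 \<le> x - h" "x + k \<le> 1" and \<epsilon>K: "k \<le> K * \<epsilon>"
      and E: "E = layer m \<epsilon> (x - h) + layer m \<epsilon> (1 - (x + k))" for \<epsilon> D x h k E
  proof -
    define \<beta> where "\<beta> = sqrt \<gamma> / \<epsilon>"
    have \<beta>: "0 < \<beta>" "X / \<beta>\<^sup>2 = \<epsilon>\<^sup>2 * X / \<gamma>" for X using \<gamma> \<epsilon> by (auto simp: \<beta>_def power_divide)
    let ?I = "{x - h..x + k}"
    have I: "?I \<subseteq> {0..1}" using x by auto
    define a where "a = 1 + E / \<epsilon>"
    define b where "b = 1 + E / \<epsilon>\<^sup>2"
    have "\<bar>truncation \<beta> (D 0) (D 2) x h k\<bar> \<le> 8 * (1 + Z)\<^sup>2 * tanh (\<beta> * k / 2) *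
        ((k - h) * (C * a + C / \<gamma> * a) + k\<^sup>2 * (C * b + C / \<gamma> * b))"
    proof (rule truncation_fine[OF \<beta>(1) hk])
      have "sqrt \<gamma> * k / \<epsilon> \<le> sqrt \<gamma> * K"
        using \<epsilon>K \<epsilon> \<gamma> by (simp add: divide_le_eq mult.assoc mult_left_mono)
      then show "\<beta> * k / 2 \<le> Z" by (simp add: \<beta>_def Z_def)
      show "(D i has_real_derivative D (Suc i) s) (at s within ?I)" if "i < 4" "s \<in> ?I" for i s
        using D I that unfolding layer_bounded_def by (intro DERIV_subset[OF _ I]) auto
      show "\<bar>D 1 s\<bar> \<le> C * a \<and> \<bar>D 2 s\<bar> \<le> C * b \<and> \<bar>D 3 s\<bar> / \<beta>\<^sup>2 \<le> C / \<gamma> * a \<and> \<bar>D 4 s\<bar> / \<beta>\<^sup>2 \<le> C / \<gamma> * b"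
        if s: "s \<in> ?I" for s
      proof -
        have s01: "s \<in> {0..1}" using s I by auto
        have L: "layers m \<epsilon> s \<le> E" unfolding layers_def E
          using s m \<epsilon> by (intro add_mono layer_antimono) auto
        have a: "C * (1 + layers m \<epsilon> s / \<epsilon>) \<le> C * a"
          unfolding a_def using L C \<epsilon> by (intro mult_left_mono add_left_mono divide_right_mono) auto
        have b: "C * (1 + layers m \<epsilon> s / \<epsilon>\<^sup>2) \<le> C * b"
          unfolding b_def using L C \<epsilon> by (intro mult_left_mono add_left_mono divide_right_mono) auto
        have D': "\<bar>D 1 s\<bar> \<le> C * (1 + layers m \<epsilon> s / \<epsilon>)" "\<bar>D 2 s\<bar> \<le> C * (1 + layers m \<epsilon> s / \<epsilon>\<^sup>2)"
          "\<epsilon>\<^sup>2 * \<bar>D 3 s\<bar> \<le> C * (1 + layers m \<epsilon> s / \<epsilon>)" "\<epsilon>\<^sup>2 * \<bar>D 4 s\<bar> \<le> C * (1 + layers m \<epsilon> s / \<epsilon>\<^sup>2)"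
          using D s01 unfolding layer_bounded_def by auto
        have "\<epsilon>\<^sup>2 * \<bar>D 3 s\<bar> / \<gamma> \<le> C * a / \<gamma>" "\<epsilon>\<^sup>2 * \<bar>D 4 s\<bar> / \<gamma> \<le> C * b / \<gamma>"
          using D'(3,4) a b \<gamma> by (intro divide_right_mono; linarith)+
        then show ?thesis using D'(1,2) a b unfolding \<beta>(2) by simp
      qed
    qed
    also have "\<dots> = B * tanh (\<beta> * k / 2) * ((k - h) * a + k\<^sup>2 * b)"
    proof -
      have "q * T * (u * (C * a + G * a) + v * (C * b + G * b)) = q * (C + G) * T * (u * a + v * b)" for q T u v G
        by (simp add: algebra_simps)
      moreover have "C * (1 + 1 / \<gamma>) = C + C / \<gamma>" by (simp add: distrib_left)
      ultimately show ?thesis unfolding B_def by (simp only:)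
    qed
    finally show ?thesis unfolding \<beta>_def a_def b_def .
  qed
  ultimately show ?thesis unfolding Let_def by blast
qed

section \<open>The modified Shishkin mesh\<close>

text \<open>
  The cubic part of the mesh generating function. It is \<open>C\<^sup>2\<close>, so the second differences of the
  mesh are \<open>O(1 / N\<^sup>2)\<close> across the transition point.
\<close>

definition ramp_cube :: "real \<Rightarrow> real" where
  "ramp_cube u = (max 0 u) ^ 3"

lemma psi_left_ramp: "psi_left l t = 4 * l * t + 32 * (1 - 4 * l) * ramp_cube (t - 1 / 4)"
  by (auto simp: psi_left_def ramp_cube_def max_def)

lemma psi_reflect: "psi l (1 - t) = 1 - psi l t"
proof -
  have "psi_left l (1/2) = 1/2" by (simp add: psi_left_def power3_eq_cube field_simps)
  then show ?thesis
  proof (cases "t = 1/2")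
    case True
    have "1 - t = 1/2" using True by simp
    with \<open>psi_left l (1/2) = 1/2\<close> True show ?thesis by (simp only: psi_def) simp
  qed (auto simp: psi_def)
qed

lemma ramp_cube_mono: "u \<le> v \<Longrightarrow> ramp_cube u \<le> ramp_cube v"
  unfolding ramp_cube_def by (intro power_mono) auto

lemma ramp_cube_Lipschitz:
  assumes "u \<le> v" "v \<le> 1/4"
  shows "ramp_cube v - ramp_cube u \<le> 3 / 16 * (v - u)"
proof -
  define a where "a = max 0 u"
  define b where "b = max 0 v"
  have ab: "0 \<le> a" "a \<le> b" "b \<le> 1/4" "b - a \<le> v - u" using assms by (auto simp: a_def b_def)
  have "ramp_cube v - ramp_cube u = (b - a) * (b * b + a * b + a * a)"
    unfolding ramp_cube_def a_def[symmetric] b_def[symmetric] by (simp add: power3_eq_cube algebra_simps)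
  also have "\<dots> \<le> (v - u) * (1/4 * (1/4) + 1/4 * (1/4) + 1/4 * (1/4))"
    using ab by (intro mult_mono add_mono) auto
  finally show ?thesis by simp
qed

text \<open>
  The transition point \<open>1/4\<close> is a node, so \<open>u\<close> is a multiple of \<open>s\<close>; this leaves three cases, with the
  values \<open>0\<close>, \<open>s\<^sup>3\<close> and \<open>6 u s\<^sup>2\<close>.
\<close>

lemma ramp_cube_second_difference:
  assumes "0 \<le> s" "u \<le> 1/4" "s \<le> 1" "u \<le> - s \<or> u = 0 \<or> s \<le> u"
  shows "0 \<le> ramp_cube (u + s) - 2 * ramp_cube u + ramp_cube (u - s)"
    "ramp_cube (u + s) - 2 * ramp_cube u + ramp_cube (u - s) \<le> 3 / 2 * s\<^sup>2"
proof -
  have s3: "s ^ 3 \<le> s\<^sup>2" using assms by (intro power_decreasing) auto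
  define X where "X = ramp_cube (u + s) - 2 * ramp_cube u + ramp_cube (u - s)"
  from assms(4) have "X = 0 \<or> X = s ^ 3 \<or> X = 6 * u * s\<^sup>2 \<and> 0 \<le> u"
  proof (elim disjE)
    assume "u \<le> - s" then show ?thesis using assms(1) by (simp add: X_def ramp_cube_def)
  next
    assume "u = 0" then show ?thesis using assms(1) by (simp add: X_def ramp_cube_def)
  next
    assume "s \<le> u"
    then have "X = (u + s) ^ 3 - 2 * u ^ 3 + (u - s) ^ 3"
      using assms(1) by (simp add: X_def ramp_cube_def)
    also have "\<dots> = 6 * u * s\<^sup>2" by (simp add: power3_eq_cube power2_eq_square algebra_simps)
    finally show ?thesis using \<open>s \<le> u\<close> assms(1) by simp
  qed
  moreover have "6 * u * s\<^sup>2 \<le> 3 / 2 * s\<^sup>2" using assms(2) by (intro mult_right_mono) auto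
  moreover have "0 \<le> s ^ 3" "0 \<le> s\<^sup>2" using assms(1) by auto
  moreover have "0 \<le> u \<Longrightarrow> 0 \<le> 6 * u * s\<^sup>2" by simp
  ultimately have "0 \<le> X \<and> X \<le> 3 / 2 * s\<^sup>2" using s3 by linarith
  then show "0 \<le> ramp_cube (u + s) - 2 * ramp_cube u + ramp_cube (u - s)"
    "ramp_cube (u + s) - 2 * ramp_cube u + ramp_cube (u - s) \<le> 3 / 2 * s\<^sup>2"
    unfolding X_def by auto
qed

locale shishkin_mesh =
  fixes m \<epsilon> :: real and n N :: nat
  assumes m: "0 < m" and \<epsilon>: "0 < \<epsilon>" "\<epsilon> < 1" and n: "0 < n" "N = 4 * n"
begin

definition l where "l = shishkin_lambda m \<epsilon> N"
definition \<Lambda> where "\<Lambda> = l / \<epsilon>"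
definition x where "x = mesh m \<epsilon> N"
definition h where "h = mesh_step x"

lemma N_bounds: "4 \<le> N" "0 < N" "0 < real N" "real N = 4 * real n" using n by auto

lemma ln_N: "1 \<le> ln (real N)" "ln (real N) \<le> real N"
proof -
  have "exp 1 \<le> real N" using exp_le N_bounds(1) by linarith
  then show "1 \<le> ln (real N)" using N_bounds by (subst ln_ge_iff) auto
  show "ln (real N) \<le> real N" using ln_le_minus_one[of "real N"] N_bounds by simp
qed

lemma l_bounds: "0 < l" "l \<le> 1/4" "l \<le> 2 * \<epsilon> * ln (real N) / sqrt m"
  "l < 1/4 \<Longrightarrow> l = 2 * \<epsilon> * ln (real N) / sqrt m"
proof -
  have "0 < 2 * \<epsilon> * ln (real N) / sqrt m"
    using ln_N(1) m \<epsilon> by (intro divide_pos_pos mult_pos_pos real_sqrt_gt_zero) linarith+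
  then show "0 < l" "l \<le> 1/4" "l \<le> 2 * \<epsilon> * ln (real N) / sqrt m"
    "l < 1/4 \<Longrightarrow> l = 2 * \<epsilon> * ln (real N) / sqrt m"
    unfolding l_def shishkin_lambda_def by linarith+
qed

lemma \<Lambda>_bounds: "0 < \<Lambda>" "\<Lambda> \<le> 2 * ln (real N) / sqrt m"
proof -
  show "0 < \<Lambda>" unfolding \<Lambda>_def using l_bounds \<epsilon> by simp
  have "l / \<epsilon> \<le> (2 * \<epsilon> * ln (real N) / sqrt m) / \<epsilon>" using l_bounds(3) \<epsilon> by (intro divide_right_mono) auto
  then show "\<Lambda> \<le> 2 * ln (real N) / sqrt m" unfolding \<Lambda>_def using \<epsilon> by simp
qed

text \<open>
  The steps inside the layers are at most a fixed multiple of \<open>\<epsilon>\<close>, since \<open>ln N \<le> N\<close>. This multiple is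
  the threshold between small and large steps below.
\<close>

lemma fine_step_le: "4 * l / N \<le> 8 / sqrt m * \<epsilon>"
proof -
  have "4 * l / N \<le> 4 * (2 * \<epsilon> * ln (real N) / sqrt m) / N"
    using l_bounds(3) N_bounds by (intro divide_right_mono mult_left_mono) auto
  also have "\<dots> = 8 / sqrt m * \<epsilon> * (ln (real N) / N)" by simp
  also have "\<dots> \<le> 8 / sqrt m * \<epsilon> * 1"
    using ln_N N_bounds m \<epsilon> by (intro mult_left_mono) (auto simp: divide_le_eq)
  finally show ?thesis by simp
qed

lemma x_reflect: "i \<le> N \<Longrightarrow> x (N - i) = 1 - x i"
proof -
  assume "i \<le> N"
  then have "real (N - i) / N = 1 - real i / N" using N_bounds by (simp add: of_nat_diff field_simps)
  then show ?thesis unfolding x_def mesh_def by (simp add: psi_reflect)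
qed

lemma h_reflect: "i < N \<Longrightarrow> h (N - Suc i) = h i"
  using x_reflect[of i] x_reflect[of "Suc i"] unfolding h_def mesh_step_def
  by (simp add: Suc_diff_Suc)

lemma x_left: "i \<le> 2 * n \<Longrightarrow> x i = 4 * l * (i / N) + 32 * (1 - 4 * l) * ramp_cube (real i / N - 1/4)"
proof -
  assume "i \<le> 2 * n"
  then have "real i \<le> 2 * real n" by linarith
  then have "real i / N \<le> 1 / 2" using N_bounds by (simp add: divide_le_eq)
  then show ?thesis unfolding x_def mesh_def psi_def l_def by (simp add: psi_left_ramp)
qed

lemma h_left:
  assumes "i < 2 * n"
  shows "h i = 4 * l / N + 32 * (1 - 4 * l) * (ramp_cube (real i / N - 1/4 + 1 / N) - ramp_cube (real i / N - 1/4))"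
proof -
  have "x (i + 1) = 4 * l * (real (i + 1) / N) + 32 * (1 - 4 * l) * ramp_cube (real (i + 1) / N - 1/4)"
    using x_left[of "i + 1"] assms by simp
  moreover have "real (i + 1) / N - 1/4 = real i / N - 1/4 + 1 / N" by (simp add: add_divide_distrib)
  moreover have "4 * l * (real (i + 1) / N) = 4 * l * (real i / N) + 4 * l / N"
    by (simp add: add_divide_distrib algebra_simps)
  ultimately have "x (i + 1) = 4 * l * (real i / N) + 4 * l / N
      + 32 * (1 - 4 * l) * ramp_cube (real i / N - 1/4 + 1 / N)" by (simp only:)
  moreover have "x i = 4 * l * (real i / N) + 32 * (1 - 4 * l) * ramp_cube (real i / N - 1/4)"
    using x_left[of i] assms by simp
  moreover have "(a + b + c * p) - (a + c * q) = b + c * (p - q)" for a b c p q :: real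
    by (simp add: algebra_simps)
  ultimately show ?thesis unfolding h_def mesh_step_def by (simp only:)
qed

lemma h_bounds: "i < N \<Longrightarrow> 0 < h i" "i < N \<Longrightarrow> h i \<le> 7 / N"
proof -
  have *: "0 < h i \<and> h i \<le> 7 / N" if "i < 2 * n" for i
  proof -
    define u where "u = real i / N - 1/4"
    have "real i + 1 \<le> 2 * real n" using that by linarith
    then have "u + 1 / N \<le> 1/4" using N_bounds unfolding u_def by (simp add: field_simps)
    then have "ramp_cube (u + 1 / N) - ramp_cube u \<le> 3/16 * (u + 1 / N - u)"
      by (intro ramp_cube_Lipschitz) auto
    then have r: "ramp_cube (u + 1 / N) - ramp_cube u \<le> 3/16 * (1 / N)" by simp
    have r0: "0 \<le> ramp_cube (u + 1 / N) - ramp_cube u" using ramp_cube_mono[of u "u + 1 / N"] by simp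
    have "0 < 4 * l / N" "4 * l / N \<le> 1 / N"
      using l_bounds(1) N_bounds(3) divide_right_mono[of "4 * l" 1 N] l_bounds(2) by simp_all
    moreover have "0 \<le> 32 * (1 - 4 * l) * (ramp_cube (u + 1 / N) - ramp_cube u)"
      using l_bounds r0 by (intro mult_nonneg_nonneg) auto
    moreover have "32 * (1 - 4 * l) * (ramp_cube (u + 1 / N) - ramp_cube u) \<le> 32 * 1 * (3/16 * (1 / N))"
      using l_bounds r r0 by (intro mult_mono) auto
    ultimately show ?thesis unfolding h_left[OF that] u_def[symmetric] by simp
  qed
  have "0 < h i \<and> h i \<le> 7 / N" if "i < N" for i
  proof (cases "i < 2 * n")
    case False
    then have "N - Suc i < 2 * n" using that n by linarith
    from *[OF this] show ?thesis using h_reflect[OF that] by simp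
  qed (rule *)
  then show "i < N \<Longrightarrow> 0 < h i" "i < N \<Longrightarrow> h i \<le> 7 / N" by auto
qed

text \<open>
  At the midpoint the two steps coincide by symmetry, although the second derivative of the mesh
  generating function jumps there.
\<close>

lemma h_second_difference:
  assumes "Suc i \<le> 2 * n"
  shows "h i \<le> h (Suc i)" "h (Suc i) - h i \<le> 48 / (real N)\<^sup>2"
proof -
  have "h i \<le> h (Suc i) \<and> h (Suc i) - h i \<le> 48 / (real N)\<^sup>2"
  proof (cases "Suc i = 2 * n")
    case True
    then have "N - Suc i = Suc i" using n by simp
    then have "h (Suc i) = h i" using h_reflect[of i] n True by simp
    then show ?thesis by simp
  next
    case False
    define s where "s = 1 / real N"
    define u where "u = real (Suc i) / N - 1/4"
    have s: "0 < s" "s \<le> 1" using N_bounds by (auto simp: s_def)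
    have ui: "real i / N - 1/4 = u - s" "real i / N - 1/4 + 1 / N = u" unfolding u_def s_def
      by (simp_all add: add_divide_distrib)
    have "real (Suc i) \<le> 2 * real n" using assms by linarith
    then have u: "u \<le> 1/4" unfolding u_def using N_bounds by (simp add: field_simps)
    have u': "u = (real (Suc i) - real n) * s" unfolding u_def s_def using N_bounds by (simp add: field_simps)
    have "u \<le> - s \<or> u = 0 \<or> s \<le> u"
    proof -
      consider "Suc i < n" | "Suc i = n" | "n < Suc i" by linarith
      then show ?thesis
      proof cases
        case 1
        then have "real (Suc i) - real n \<le> - 1" by linarith
        then have "(real (Suc i) - real n) * s \<le> - 1 * s" using s by (intro mult_right_mono) auto
        then show ?thesis unfolding u' by simp
      next
        case 2 then show ?thesis unfolding u' by simp
      next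
        case 3
        then have "1 \<le> real (Suc i) - real n" by linarith
        then have "1 * s \<le> (real (Suc i) - real n) * s" using s by (intro mult_right_mono) auto
        then show ?thesis unfolding u' by simp
      qed
    qed
    note r = ramp_cube_second_difference[OF less_imp_le[OF s(1)] u s(2) this]
    have "h i = 4 * l / N + 32 * (1 - 4 * l) * (ramp_cube u - ramp_cube (u - s))"
      using h_left[of i] assms unfolding ui(2) unfolding ui(1) by simp
    moreover have "h (Suc i) = 4 * l / N + 32 * (1 - 4 * l) * (ramp_cube (u + s) - ramp_cube u)"
      using h_left[of "Suc i"] assms False unfolding u_def s_def by simp
    ultimately have eq: "h (Suc i) - h i = 32 * (1 - 4 * l) * (ramp_cube (u + s) - 2 * ramp_cube u + ramp_cube (u - s))"
      by (simp add: algebra_simps)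
    have "0 \<le> h (Suc i) - h i" unfolding eq using r l_bounds by (intro mult_nonneg_nonneg) auto
    moreover have "h (Suc i) - h i \<le> 32 * 1 * (3 / 2 * s\<^sup>2)" unfolding eq using r l_bounds by (intro mult_mono) auto
    ultimately show ?thesis by (simp add: s_def power_divide)
  qed
  then show "h i \<le> h (Suc i)" "h (Suc i) - h i \<le> 48 / (real N)\<^sup>2" by auto
qed

lemma h_fine: "i < n \<Longrightarrow> h i = 4 * l / N"
proof -
  assume i: "i < n"
  then have "real i + 1 \<le> real n" by linarith
  then have "real i / N - 1/4 + 1 / N \<le> 0" "real i / N - 1/4 \<le> 0" using N_bounds by (auto simp: field_simps)
  then have "ramp_cube (real i / N - 1/4 + 1 / N) = 0" "ramp_cube (real i / N - 1/4) = 0"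
    by (simp_all add: ramp_cube_def max_def)
  then show ?thesis using h_left[of i] i by simp
qed

lemma h_uniform: "l = 1/4 \<Longrightarrow> i < N \<Longrightarrow> h i = 4 * l / N"
proof (cases "i < 2 * n")
  case False
  assume "l = 1/4" "i < N"
  then show ?thesis using h_reflect[of i] h_left[of "N - Suc i"] False n by simp
qed (simp add: h_left)

lemma x_sum: "i \<le> N \<Longrightarrow> x i = (\<Sum>j<i. h j)"
proof -
  have "x 0 = 0" using x_left[of 0] by (simp add: ramp_cube_def)
  then show ?thesis unfolding h_def mesh_step_def by (simp add: sum_lessThan_telescope)
qed

lemma x_mono: "i \<le> j \<Longrightarrow> j \<le> N \<Longrightarrow> x i \<le> x j"
proof (induction j rule: dec_induct)
  case (step j)
  then show ?case using h_bounds(1)[of j] unfolding h_def mesh_step_def by simp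
qed simp

lemma x_range: "i \<le> N \<Longrightarrow> 0 \<le> x i" "i \<le> N \<Longrightarrow> x i \<le> 1"
  using x_mono[of 0 i] x_mono[of i N] x_sum[of 0] x_reflect[of 0] by auto

lemma x_before_transition: "x (n - 1) = l - 4 * l / N"
proof -
  have "x (n - 1) = (\<Sum>j<n - 1. h j)" using n by (intro x_sum) linarith
  also have "\<dots> = (\<Sum>j<n - 1. 4 * l / N)" by (intro sum.cong refl h_fine) auto
  also have "\<dots> = (real n - 1) * (4 * l / N)" using n(1) by (simp add: of_nat_diff)
  finally have "x (n - 1) = (real n - 1) * (4 * l / N)" .
  then show ?thesis using N_bounds by (simp add: field_simps)
qed

lemma layer_back_step:
  assumes "0 \<le> s" "s \<le> 8 / sqrt m * \<epsilon>"
  shows "layer m \<epsilon> (y - s) \<le> exp 8 * layer m \<epsilon> y"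
proof -
  have "sqrt m * s / \<epsilon> \<le> 8" using assms m \<epsilon> by (simp add: field_simps)
  then have "layer m \<epsilon> (- s) \<le> exp 8" by (simp add: layer_def)
  then show ?thesis using layer_add[of m \<epsilon> y "- s"] by (simp add: mult.commute[of "exp 8"])
qed

text \<open>
  The choice of \<open>\<lambda>\<close> gives \<open>exp (- sqrt m \<lambda> / \<epsilon>) = 1 / N\<^sup>2\<close>. One step before the transition point is
  included because the residual at the transition point reaches back to it.
\<close>

lemma layer_coarse:
  assumes "n - 1 \<le> i" "i \<le> N" "l < 1/4"
  shows "layer m \<epsilon> (x i) \<le> exp 8 / (real N)\<^sup>2"
proof -
  have "layer m \<epsilon> l = exp (- (2 * ln (real N)))"
    unfolding layer_def l_bounds(4)[OF assms(3)] using m \<epsilon> by simp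
  also have "\<dots> = 1 / (real N)\<^sup>2"
    using N_bounds by (simp add: exp_minus exp_double inverse_eq_divide)
  finally have ll: "layer m \<epsilon> l = 1 / (real N)\<^sup>2" .
  have "layer m \<epsilon> (x i) \<le> layer m \<epsilon> (l - 4 * l / N)"
    using x_mono[OF assms(1,2)] m \<epsilon> unfolding x_before_transition by (intro layer_antimono) auto
  also have "\<dots> \<le> exp 8 * layer m \<epsilon> l"
    using fine_step_le l_bounds N_bounds by (intro layer_back_step) auto
  finally show ?thesis unfolding ll by simp
qed

end

text \<open>
  Three situations occur. On equal steps \<open>h = k = 4 \<lambda> / N\<close> the factor \<open>k\<^sup>2 / \<epsilon>\<^sup>2\<close> equals \<open>16 \<Lambda>\<^sup>2 / N\<^sup>2\<close>.
  On the graded part the layer functions are \<open>O(1 / N\<^sup>2)\<close>, and either the steps are at most \<open>K \<epsilon>\<close>, so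
  that the powers of \<open>k / \<epsilon>\<close> are bounded, or \<open>tanh (\<beta> k / 2)\<close> is bounded below and the coarse estimate
  applies. In the left half the steps increase, as both residual estimates require.
\<close>

lemma mesh_truncation_left:
  assumes C: "0 \<le> C" and m: "0 < m" and \<gamma>: "0 < \<gamma>"
  shows "\<exists>B\<ge>0. \<forall>\<epsilon> n N D j. shishkin_mesh m \<epsilon> n N \<longrightarrow> layer_bounded C m \<epsilon> D \<longrightarrow> Suc j \<le> 2 * n \<longrightarrow>
      \<bar>truncation (sqrt \<gamma> / \<epsilon>) (D 0) (D 2) (shishkin_mesh.x m \<epsilon> N (Suc j))
          (shishkin_mesh.h m \<epsilon> N j) (shishkin_mesh.h m \<epsilon> N (Suc j))\<bar>
        \<le> B * tanh (sqrt \<gamma> / \<epsilon> * shishkin_mesh.h m \<epsilon> N (Suc j) / 2)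
            * (1 + (shishkin_mesh.\<Lambda> m \<epsilon> N)\<^sup>2 * layers m \<epsilon> (shishkin_mesh.x m \<epsilon> N (Suc j))) / (real N)\<^sup>2"
proof -
  (* the ratio from fine_step_le, so that steps above it occur on the graded part only *)
  define K where "K = 8 / sqrt m"
  have K: "0 < K" unfolding K_def using m by simp
  obtain B1 where B1: "0 \<le> B1" "\<And>\<epsilon> D x h k E. 0 < \<epsilon> \<Longrightarrow> layer_bounded C m \<epsilon> D \<Longrightarrow> 0 < h \<Longrightarrow> h \<le> k \<Longrightarrow>
      0 \<le> x - h \<Longrightarrow> x + k \<le> 1 \<Longrightarrow> k \<le> K * \<epsilon> \<Longrightarrow>
      E = layer m \<epsilon> (x - h) + layer m \<epsilon> (1 - (x + k)) \<Longrightarrow>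
      \<bar>truncation (sqrt \<gamma> / \<epsilon>) (D 0) (D 2) x h k\<bar>
        \<le> B1 * tanh (sqrt \<gamma> / \<epsilon> * k / 2) * ((k - h) * (1 + E / \<epsilon>) + k\<^sup>2 * (1 + E / \<epsilon>\<^sup>2))"
    using truncation_small_steps[OF C m \<gamma> K] unfolding Let_def by blast
  obtain B2 where B2: "0 \<le> B2" "\<And>\<epsilon> D x h k E. 0 < \<epsilon> \<Longrightarrow> layer_bounded C m \<epsilon> D \<Longrightarrow> 0 < h \<Longrightarrow> h \<le> k \<Longrightarrow>
      0 \<le> x - h \<Longrightarrow> x + k \<le> 1 \<Longrightarrow> K * \<epsilon> \<le> k \<Longrightarrow>
      E = layer m \<epsilon> (x - h) + layer m \<epsilon> (1 - (x + k)) \<Longrightarrow>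
      \<bar>truncation (sqrt \<gamma> / \<epsilon>) (D 0) (D 2) x h k\<bar> \<le> B2 * ((k - h) + k\<^sup>2 + E)"
    using truncation_coarse[OF C m \<gamma> K] by blast
  define T where "T = tanh (sqrt \<gamma> * K / 2)"
  have T: "0 < T" unfolding T_def using \<gamma> K by simp
  (* 97 = 48 + 49, from k - h <= 48 / N^2 and k <= 7 / N; exp 8 is the growth of a layer
     function over one step of the fine mesh *)
  define A1 where "A1 = B1 * (97 + 16 * exp 8 + (K + K\<^sup>2) * (2 * exp 8))"
  define A2 where "A2 = B2 / T * (97 + 2 * exp 8)"
  define B where "B = A1 + A2"
  have A: "0 \<le> A1" "0 \<le> A2" unfolding A1_def A2_def using B1 B2 T K by auto
  have "\<bar>truncation (sqrt \<gamma> / \<epsilon>) (D 0) (D 2) (shishkin_mesh.x m \<epsilon> N (Suc j))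
          (shishkin_mesh.h m \<epsilon> N j) (shishkin_mesh.h m \<epsilon> N (Suc j))\<bar>
        \<le> B * tanh (sqrt \<gamma> / \<epsilon> * shishkin_mesh.h m \<epsilon> N (Suc j) / 2)
            * (1 + (shishkin_mesh.\<Lambda> m \<epsilon> N)\<^sup>2 * layers m \<epsilon> (shishkin_mesh.x m \<epsilon> N (Suc j))) / (real N)\<^sup>2"
    if mesh: "shishkin_mesh m \<epsilon> n N" and D: "layer_bounded C m \<epsilon> D" and j: "Suc j \<le> 2 * n" for \<epsilon> n N D j
  proof -
    interpret shishkin_mesh m \<epsilon> n N by (rule mesh)
    define h0 where "h0 = h j"
    define k0 where "k0 = h (Suc j)"
    define y where "y = x (Suc j)"
    have jN: "j < N" "Suc j < N" "Suc (Suc j) \<le> N" using j n by linarith+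
    have hk: "0 < h0" "h0 \<le> k0" "k0 \<le> 7 / N" "k0 - h0 \<le> 48 / (real N)\<^sup>2"
      unfolding h0_def k0_def using h_bounds[OF jN(1)] h_bounds[OF jN(2)] h_second_difference[OF j] by auto
    have y: "y - h0 = x j" "y + k0 = x (Suc (Suc j))"
      unfolding y_def h0_def k0_def h_def mesh_step_def by auto
    have yr: "0 \<le> y - h0" "y + k0 \<le> 1" unfolding y using x_range[of j] x_range[of "Suc (Suc j)"] jN by auto
    define E where "E = layer m \<epsilon> (y - h0) + layer m \<epsilon> (1 - (y + k0))"
    have E0: "0 \<le> E" unfolding E_def by (intro add_nonneg_nonneg less_imp_le layer_pos)
    define W where "W = 1 + \<Lambda>\<^sup>2 * layers m \<epsilon> y"
    have W: "1 \<le> W" unfolding W_def by simp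
    define t where "t = tanh (sqrt \<gamma> / \<epsilon> * k0 / 2)"
    have t: "0 < t" unfolding t_def using \<gamma> \<epsilon> hk by simp
    have coarse_E: "E \<le> 2 * exp 8 / (real N)\<^sup>2" if "n \<le> Suc j" "l < 1/4"
    proof -
      have "layer m \<epsilon> (x j) \<le> exp 8 / (real N)\<^sup>2" using that jN by (intro layer_coarse) auto
      moreover have "layer m \<epsilon> (x (N - Suc (Suc j))) \<le> exp 8 / (real N)\<^sup>2"
        using that jN j n by (intro layer_coarse) auto
      ultimately show ?thesis unfolding E_def y using x_reflect[OF jN(3)] by simp
    qed
    have k2: "k0\<^sup>2 \<le> 49 / (real N)\<^sup>2"
      using power_mono[OF hk(3), of 2] hk(1,2) by (simp add: power_divide)
    have "\<bar>truncation (sqrt \<gamma> / \<epsilon>) (D 0) (D 2) y h0 k0\<bar> \<le> B * t * W / (real N)\<^sup>2"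
    proof (cases "k0 \<le> K * \<epsilon>")
      case True
      define P where "P = (k0 - h0) * (1 + E / \<epsilon>) + k0\<^sup>2 * (1 + E / \<epsilon>\<^sup>2)"
      have "P \<le> (97 + 16 * exp 8 + (K + K\<^sup>2) * (2 * exp 8)) * (W / (real N)\<^sup>2)"
      proof (cases "Suc j < n \<or> l = 1/4")
        case fine: True
        then have hk': "h0 = 4 * l / N" "k0 = 4 * l / N" unfolding h0_def k0_def
          using h_fine[of j] h_fine[of "Suc j"] h_uniform[of j] h_uniform[of "Suc j"] jN by auto
        have "layer m \<epsilon> (y - h0) \<le> exp 8 * layer m \<epsilon> y"
          using hk(1) fine_step_le hk' by (intro layer_back_step) auto
        moreover have "layer m \<epsilon> (1 - y - k0) \<le> exp 8 * layer m \<epsilon> (1 - y)"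
          using hk(1,2) fine_step_le hk' by (intro layer_back_step) auto
        ultimately have E8: "E \<le> exp 8 * layers m \<epsilon> y" unfolding E_def layers_def by (simp add: algebra_simps)
        have "P = 16 * l\<^sup>2 / (real N)\<^sup>2 + 16 * \<Lambda>\<^sup>2 * E / (real N)\<^sup>2"
          unfolding P_def hk' \<Lambda>_def by (simp add: power_mult_distrib power_divide distrib_left add_divide_distrib mult_ac)
        also have "\<dots> \<le> 1 / (real N)\<^sup>2 + 16 * \<Lambda>\<^sup>2 * (exp 8 * layers m \<epsilon> y) / (real N)\<^sup>2"
        proof (intro add_mono divide_right_mono mult_left_mono E8)
          show "16 * l\<^sup>2 \<le> 1" using power_mono[of l "1/4" 2] l_bounds by (simp add: power_divide)
        qed auto
        also have "\<dots> = (1 + 16 * exp 8 * (\<Lambda>\<^sup>2 * layers m \<epsilon> y)) / (real N)\<^sup>2" by (simp add: add_divide_distrib)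
        also have "\<dots> \<le> ((97 + 16 * exp 8 + (K + K\<^sup>2) * (2 * exp 8)) * W) / (real N)\<^sup>2"
        proof (intro divide_right_mono)
          have p: "0 \<le> \<Lambda>\<^sup>2 * layers m \<epsilon> y" "0 \<le> (K + K\<^sup>2) * (2 * exp 8)" using K by auto
          have "1 + 16 * exp 8 * (\<Lambda>\<^sup>2 * layers m \<epsilon> y) \<le> (1 + 16 * exp 8) * W"
            unfolding W_def using p by (simp add: algebra_simps)
          also have "\<dots> \<le> (97 + 16 * exp 8 + (K + K\<^sup>2) * (2 * exp 8)) * W"
            using p W by (intro mult_right_mono) auto
          finally show "1 + 16 * exp 8 * (\<Lambda>\<^sup>2 * layers m \<epsilon> y) \<le> (97 + 16 * exp 8 + (K + K\<^sup>2) * (2 * exp 8)) * W" .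
        qed simp
        finally show ?thesis by simp
      next
        case False
        then have E2: "E \<le> 2 * exp 8 / (real N)\<^sup>2" using l_bounds(2) by (intro coarse_E) auto
          have "P = (k0 - h0) + k0\<^sup>2 + ((k0 - h0) / \<epsilon> + (k0 / \<epsilon>)\<^sup>2) * E"
            unfolding P_def by (simp add: algebra_simps power_divide)
          also have "\<dots> \<le> 48 / (real N)\<^sup>2 + 49 / (real N)\<^sup>2 + (K + K\<^sup>2) * (2 * exp 8 / (real N)\<^sup>2)"
          proof (intro add_mono mult_mono hk(4) k2 E2)
            have "k0 / \<epsilon> \<le> K" "0 \<le> k0 / \<epsilon>" using True \<epsilon> hk by (auto simp: divide_le_eq)
            then show "(k0 / \<epsilon>)\<^sup>2 \<le> K\<^sup>2" by (intro power_mono)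
            have "(k0 - h0) / \<epsilon> \<le> k0 / \<epsilon>" using hk \<epsilon> by (intro divide_right_mono) auto
            with \<open>k0 / \<epsilon> \<le> K\<close> show "(k0 - h0) / \<epsilon> \<le> K" by linarith
          qed (use K E0 hk in auto)
          also have "\<dots> = (97 + (K + K\<^sup>2) * (2 * exp 8)) * (1 / (real N)\<^sup>2)"
            by (simp add: distrib_right flip: add_divide_distrib)
          also have "\<dots> \<le> (97 + 16 * exp 8 + (K + K\<^sup>2) * (2 * exp 8)) * (W / (real N)\<^sup>2)"
            using W K by (intro mult_mono divide_right_mono) auto
          finally show ?thesis .
      qed
      then have "B1 * t * P \<le> B1 * t * ((97 + 16 * exp 8 + (K + K\<^sup>2) * (2 * exp 8)) * (W / (real N)\<^sup>2))"
        using B1(1) t by (intro mult_left_mono) auto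
      also have "\<dots> = A1 * t * W / (real N)\<^sup>2" unfolding A1_def by simp
      also have "\<dots> \<le> B * t * W / (real N)\<^sup>2"
        unfolding B_def using A t W by (intro divide_right_mono mult_right_mono) auto
      finally have "B1 * t * P \<le> B * t * W / (real N)\<^sup>2" .
      then show ?thesis
        using B1(2)[OF \<epsilon>(1) D hk(1,2) yr True E_def] unfolding P_def t_def by linarith
    next
      case False
      have "Suc j \<ge> n \<and> l < 1/4"
      proof (rule ccontr)
        assume *: "\<not> ?thesis"
        have "h (Suc j) = 4 * l / N"
          using * l_bounds(2) jN h_fine[of "Suc j"] h_uniform[of "Suc j"] by force
        then show False using False fine_step_le unfolding k0_def K_def by simp
      qed
      then have E2: "E \<le> 2 * exp 8 / (real N)\<^sup>2" using coarse_E by blast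
      have "T \<le> t"
        unfolding T_def t_def using False \<epsilon> \<gamma> by (simp add: le_divide_eq mult.assoc mult_left_mono)
      have "B2 * ((k0 - h0) + k0\<^sup>2 + E) \<le> B2 * (48 / (real N)\<^sup>2 + 49 / (real N)\<^sup>2 + 2 * exp 8 / (real N)\<^sup>2)"
        using hk(4) k2 E2 B2(1) by (intro mult_left_mono add_mono) auto
      also have "\<dots> = A2 * T / (real N)\<^sup>2" unfolding A2_def using T by (simp flip: add_divide_distrib)
      also have "\<dots> \<le> B * t * W / (real N)\<^sup>2"
      proof (intro divide_right_mono)
        have "A2 * T \<le> B * t" unfolding B_def using A T \<open>T \<le> t\<close> by (intro mult_mono) auto
        also have "\<dots> \<le> B * t * W" using W A t mult_left_mono[of 1 W "B * t"] by (simp add: B_def)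
        finally show "A2 * T \<le> B * t * W" .
      qed simp
      finally show ?thesis
        using B2(2)[OF \<epsilon>(1) D hk(1,2) yr _ E_def] False by linarith
    qed
    then show ?thesis unfolding y_def h0_def k0_def W_def t_def .
  qed
  moreover have "0 \<le> B" unfolding B_def using A by simp
  ultimately show ?thesis by blast
qed

text \<open>
  The right half follows by reflecting the function and the mesh at \<open>1/2\<close>.
\<close>

lemma mesh_truncation:
  assumes C: "0 \<le> C" and m: "0 < m" and \<gamma>: "0 < \<gamma>"
  shows "\<exists>B\<ge>0. \<forall>\<epsilon> n N D j. shishkin_mesh m \<epsilon> n N \<longrightarrow> layer_bounded C m \<epsilon> D \<longrightarrow> Suc j < N \<longrightarrow>
      (let x = mesh m \<epsilon> N; t = \<lambda>i. tanh (sqrt \<gamma> / \<epsilon> * mesh_step x i / 2) in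
       \<bar>truncation (sqrt \<gamma> / \<epsilon>) (D 0) (D 2) (x (Suc j)) (mesh_step x j) (mesh_step x (Suc j))\<bar>
        \<le> B * (t j + t (Suc j))
            * (1 + (shishkin_mesh.\<Lambda> m \<epsilon> N)\<^sup>2 * layers m \<epsilon> (x (Suc j))) / (real N)\<^sup>2)"
proof -
  obtain B where B: "0 \<le> B" "\<And>\<epsilon> n N D j. shishkin_mesh m \<epsilon> n N \<Longrightarrow> layer_bounded C m \<epsilon> D \<Longrightarrow> Suc j \<le> 2 * n \<Longrightarrow>
      \<bar>truncation (sqrt \<gamma> / \<epsilon>) (D 0) (D 2) (shishkin_mesh.x m \<epsilon> N (Suc j))
          (shishkin_mesh.h m \<epsilon> N j) (shishkin_mesh.h m \<epsilon> N (Suc j))\<bar>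
        \<le> B * tanh (sqrt \<gamma> / \<epsilon> * shishkin_mesh.h m \<epsilon> N (Suc j) / 2)
            * (1 + (shishkin_mesh.\<Lambda> m \<epsilon> N)\<^sup>2 * layers m \<epsilon> (shishkin_mesh.x m \<epsilon> N (Suc j))) / (real N)\<^sup>2"
    using mesh_truncation_left[OF C m \<gamma>] by blast
  have "\<bar>truncation (sqrt \<gamma> / \<epsilon>) (D 0) (D 2) (mesh m \<epsilon> N (Suc j)) (mesh_step (mesh m \<epsilon> N) j) (mesh_step (mesh m \<epsilon> N) (Suc j))\<bar>
        \<le> B * (tanh (sqrt \<gamma> / \<epsilon> * mesh_step (mesh m \<epsilon> N) j / 2) + tanh (sqrt \<gamma> / \<epsilon> * mesh_step (mesh m \<epsilon> N) (Suc j) / 2))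
            * (1 + (shishkin_mesh.\<Lambda> m \<epsilon> N)\<^sup>2 * layers m \<epsilon> (mesh m \<epsilon> N (Suc j))) / (real N)\<^sup>2"
    if mesh: "shishkin_mesh m \<epsilon> n N" and D: "layer_bounded C m \<epsilon> D" and j: "Suc j < N" for \<epsilon> n N D j
  proof -
    interpret shishkin_mesh m \<epsilon> n N by (rule mesh)
    define t where "t = (\<lambda>i. tanh (sqrt \<gamma> / \<epsilon> * h i / 2))"
    have t: "0 \<le> t j" "0 \<le> t (Suc j)" unfolding t_def using h_bounds(1)[of j] h_bounds(1)[of "Suc j"] j \<gamma> \<epsilon>
      by (simp_all add: less_imp_le)
    define W where "W = 1 + \<Lambda>\<^sup>2 * layers m \<epsilon> (x (Suc j))"
    have W: "0 \<le> W" unfolding W_def by simp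
    have "\<bar>truncation (sqrt \<gamma> / \<epsilon>) (D 0) (D 2) (x (Suc j)) (h j) (h (Suc j))\<bar> \<le> B * (t j + t (Suc j)) * W / (real N)\<^sup>2"
    proof (cases "Suc j \<le> 2 * n")
      case True
      have "B * t (Suc j) * W / (real N)\<^sup>2 \<le> B * (t j + t (Suc j)) * W / (real N)\<^sup>2"
        using B(1) t W by (intro divide_right_mono mult_right_mono mult_left_mono) auto
      then show ?thesis using B(2)[OF mesh D True] unfolding t_def W_def by linarith
    next
      case False
      define i where "i = N - Suc (Suc j)"
      have i: "Suc i \<le> 2 * n" "Suc i = N - Suc j" using False j n by (auto simp: i_def)
      have hi: "h (Suc i) = h j" "h i = h (Suc j)" "x (Suc i) = 1 - x (Suc j)"
        using h_reflect[of j] h_reflect[of "Suc j"] x_reflect[of "Suc j"] j unfolding i(2) by (auto simp: i_def)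
      define D' where "D' = (\<lambda>k s. (- 1) ^ k * D k (1 - s))"
      have "layer_bounded C m \<epsilon> D'" unfolding D'_def by (rule layer_bounded_reflect[OF D])
      from B(2)[OF mesh this i(1)]
      have "\<bar>truncation (sqrt \<gamma> / \<epsilon>) (D' 0) (D' 2) (1 - x (Suc j)) (h (Suc j)) (h j)\<bar> \<le> B * t j * W / (real N)\<^sup>2"
        unfolding hi t_def W_def layers_reflect .
      moreover have "D' 0 = (\<lambda>s. D 0 (1 - s))" "D' 2 = (\<lambda>s. D 2 (1 - s))" unfolding D'_def by auto
      moreover have "B * t j * W / (real N)\<^sup>2 \<le> B * (t j + t (Suc j)) * W / (real N)\<^sup>2"
        using B(1) t W by (intro divide_right_mono mult_right_mono mult_left_mono) auto
      ultimately show ?thesis by (simp add: truncation_reflect)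
    qed
    then show ?thesis unfolding t_def W_def x_def[symmetric] h_def[symmetric] .
  qed
  with B(1) show ?thesis unfolding Let_def by blast
qed

section \<open>Convergence\<close>

lemma coeff_d_eq: "0 < mesh_step x i \<Longrightarrow> 0 < \<gamma> \<Longrightarrow> 0 < \<epsilon> \<Longrightarrow> coeff_d \<gamma> \<epsilon> x i = tanh (sqrt \<gamma> / \<epsilon> * mesh_step x i / 2)"
  and coeff_a_eq: "0 < mesh_step x i \<Longrightarrow> 0 < \<gamma> \<Longrightarrow> 0 < \<epsilon> \<Longrightarrow> coeff_a \<gamma> \<epsilon> x i = 1 / tanh (sqrt \<gamma> / \<epsilon> * mesh_step x i / 2)"
proof -
  assume "0 < mesh_step x i" "0 < \<gamma>" "0 < \<epsilon>"
  define z where "z = sqrt \<gamma> / \<epsilon> * mesh_step x i / 2"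
  have z: "0 < z" "sqrt \<gamma> / \<epsilon> * mesh_step x i = 2 * z" unfolding z_def
    using \<open>0 < mesh_step x i\<close> \<open>0 < \<gamma>\<close> \<open>0 < \<epsilon>\<close> by auto
  have s: "0 < sinh z" "0 < cosh z" using z by auto
  have c1: "cosh (2 * z) - 1 = 2 * sinh z * sinh z" "cosh (2 * z) + 1 = 2 * cosh z * cosh z"
    unfolding cosh_double using cosh_square_eq[of z] by (auto simp: power2_eq_square)
  show "coeff_d \<gamma> \<epsilon> x i = tanh (sqrt \<gamma> / \<epsilon> * mesh_step x i / 2)"
    unfolding coeff_d_def Let_def z c1 sinh_double using s z by (simp add: tanh_def)
  show "coeff_a \<gamma> \<epsilon> x i = 1 / tanh (sqrt \<gamma> / \<epsilon> * mesh_step x i / 2)"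
    unfolding coeff_a_def Let_def z c1 sinh_double using s z by (simp add: tanh_def)
qed

lemma discrete_solution_fitted_op:
  assumes "discrete_solution f \<gamma> \<epsilon> N x u" "Suc j < N" "0 < \<gamma>" "0 < \<epsilon>"
    and h: "0 < mesh_step x j" "0 < mesh_step x (Suc j)"
  shows "fitted_op \<gamma> (\<lambda>i. tanh (sqrt \<gamma> / \<epsilon> * mesh_step x i / 2)) u (\<lambda>i. f (x i) (u i)) j = 0"
proof -
  define t where "t = (\<lambda>i. tanh (sqrt \<gamma> / \<epsilon> * mesh_step x i / 2))"
  have d: "coeff_d \<gamma> \<epsilon> x j = t j" "coeff_d \<gamma> \<epsilon> x (Suc j) = t (Suc j)"
    "coeff_a \<gamma> \<epsilon> x j = 1 / t j" "coeff_a \<gamma> \<epsilon> x (Suc j) = 1 / t (Suc j)"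
    unfolding t_def using assms by (simp_all only: coeff_d_eq coeff_a_eq)
  have t: "0 < t j" "0 < t (Suc j)" unfolding t_def using assms by auto
  have "discrete_T f \<gamma> \<epsilon> N x u (Suc j) = 0"
    using assms(1,2) unfolding discrete_solution_def by (metis less_imp_le)
  moreover have "discrete_T f \<gamma> \<epsilon> N x u (Suc j) = \<gamma> / (t j + t (Suc j)) *
      fitted_op \<gamma> t u (\<lambda>i. f (x i) (u i)) j"
    unfolding discrete_T_def Let_def fitted_op_def using assms(2)
    by (simp add: d diff_divide_distrib add_divide_distrib algebra_simps)
  ultimately show ?thesis using t \<open>0 < \<gamma>\<close> unfolding t_def[symmetric] by simp
qed

lemma truncation_eq_fitted_op:
  assumes "0 < \<gamma>" "0 < \<epsilon>"
    and "g (x j) = v j / \<epsilon>\<^sup>2" "g (x (Suc j)) = v (Suc j) / \<epsilon>\<^sup>2" "g (x (Suc (Suc j))) = v (Suc (Suc j)) / \<epsilon>\<^sup>2"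
  shows "truncation (sqrt \<gamma> / \<epsilon>) y g (x (Suc j)) (mesh_step x j) (mesh_step x (Suc j))
    = fitted_op \<gamma> (\<lambda>i. tanh (sqrt \<gamma> / \<epsilon> * mesh_step x i / 2)) (\<lambda>i. y (x i)) v j"
proof -
  have "x (Suc j) - mesh_step x j = x j" "x (Suc j) + mesh_step x (Suc j) = x (Suc (Suc j))"
    by (auto simp: mesh_step_def)
  moreover have "(sqrt \<gamma> / \<epsilon>)\<^sup>2 = \<gamma> / \<epsilon>\<^sup>2" using assms by (simp add: power_divide)
  moreover have "(a * (b / \<epsilon>\<^sup>2 + c / \<epsilon>\<^sup>2) + p * (c / \<epsilon>\<^sup>2 + d / \<epsilon>\<^sup>2)) / (\<gamma> / \<epsilon>\<^sup>2) = (a * (b + c) + p * (c + d)) / \<gamma>" for a b c d p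
    using assms(1,2) by (simp add: field_simps)
  ultimately show ?thesis unfolding truncation_def fitted_op_def using assms(3-5) by simp
qed

context monotone_C2_reaction
begin

lemma \<gamma>_pos: "0 < \<gamma>"
  using fy_bounds[of 0 0] m_pos by simp

text \<open>
  The barrier \<open>1 + \<Lambda>\<^sup>2 (\<phi>\<^sub>i + \<phi>\<^sub>N\<^sub>-\<^sub>i)\<close> matches the shape of the residual: applying the operator to it
  yields at most \<open>- (m / \<gamma>) (t\<^sub>i\<^sub>-\<^sub>1 + t\<^sub>i)\<close> times itself, and it dominates \<open>1 + \<Lambda>\<^sup>2 E x\<^sub>i\<close>.
\<close>

lemma discrete_error_bound:
  "\<exists>A\<ge>0. \<forall>\<epsilon> n N y u i. shishkin_mesh m \<epsilon> n N \<longrightarrow> bvp_solution \<epsilon> f y \<longrightarrow>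
     discrete_solution f \<gamma> \<epsilon> N (mesh m \<epsilon> N) u \<longrightarrow> i \<le> N \<longrightarrow>
     (let \<phi> = layer_barrier (sqrt (m / \<gamma>)) (\<lambda>i. tanh (sqrt \<gamma> / \<epsilon> * mesh_step (mesh m \<epsilon> N) i / 2)) in
      \<bar>y (mesh m \<epsilon> N i) - u i\<bar> \<le> A * (1 + (shishkin_mesh.\<Lambda> m \<epsilon> N)\<^sup>2 * (\<phi> i + \<phi> (N - i))) / (real N)\<^sup>2)"
proof -
  obtain C where C: "0 < C" "\<And>\<epsilon> y. 0 < \<epsilon> \<Longrightarrow> \<epsilon> < 1 \<Longrightarrow> bvp_solution \<epsilon> f y \<Longrightarrow>
     \<exists>D. D 0 = y \<and> (\<forall>x\<in>{0..1}. D 2 x = f x (y x) / \<epsilon>\<^sup>2) \<and> layer_bounded C m \<epsilon> D"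
    using solution_layer_bounded by blast
  obtain B where B: "0 \<le> B" "\<And>\<epsilon> n N D j. shishkin_mesh m \<epsilon> n N \<Longrightarrow> layer_bounded C m \<epsilon> D \<Longrightarrow> Suc j < N \<Longrightarrow>
      \<bar>truncation (sqrt \<gamma> / \<epsilon>) (D 0) (D 2) (mesh m \<epsilon> N (Suc j)) (mesh_step (mesh m \<epsilon> N) j) (mesh_step (mesh m \<epsilon> N) (Suc j))\<bar>
        \<le> B * (tanh (sqrt \<gamma> / \<epsilon> * mesh_step (mesh m \<epsilon> N) j / 2) + tanh (sqrt \<gamma> / \<epsilon> * mesh_step (mesh m \<epsilon> N) (Suc j) / 2))
            * (1 + (shishkin_mesh.\<Lambda> m \<epsilon> N)\<^sup>2 * layers m \<epsilon> (mesh m \<epsilon> N (Suc j))) / (real N)\<^sup>2"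
    using mesh_truncation[OF less_imp_le[OF C(1)] m_pos \<gamma>_pos] unfolding Let_def by blast
  define A where "A = B * \<gamma> / m"
  have A: "0 \<le> A" unfolding A_def using B(1) m_pos \<gamma>_pos by simp
  define \<kappa> where "\<kappa> = sqrt (m / \<gamma>)"
  have \<kappa>: "0 \<le> \<kappa>" "\<kappa>\<^sup>2 \<le> m / \<gamma>" unfolding \<kappa>_def using m_pos \<gamma>_pos by auto
  have "\<bar>y (mesh m \<epsilon> N i) - u i\<bar> \<le> A * (1 + (shishkin_mesh.\<Lambda> m \<epsilon> N)\<^sup>2 *
       (layer_barrier \<kappa> (\<lambda>i. tanh (sqrt \<gamma> / \<epsilon> * mesh_step (mesh m \<epsilon> N) i / 2)) i
        + layer_barrier \<kappa> (\<lambda>i. tanh (sqrt \<gamma> / \<epsilon> * mesh_step (mesh m \<epsilon> N) i / 2)) (N - i))) / (real N)\<^sup>2"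
    if mesh: "shishkin_mesh m \<epsilon> n N" and y: "bvp_solution \<epsilon> f y"
      and u: "discrete_solution f \<gamma> \<epsilon> N (mesh m \<epsilon> N) u" and i: "i \<le> N" for \<epsilon> n N y u i
  proof -
    interpret shishkin_mesh m \<epsilon> n N by (rule mesh)
    define t where "t = (\<lambda>i. tanh (sqrt \<gamma> / \<epsilon> * h i / 2))"
    define \<phi> where "\<phi> = layer_barrier \<kappa> t"
    have t: "0 < t i \<and> t i \<le> 1" if "i < N" for i
      unfolding t_def using h_bounds(1)[OF that] \<epsilon> \<gamma>_pos tanh_real_lt_1 by (auto intro: less_imp_le)
    have t_reflect: "t (N - Suc i) = t i" if "i < N" for i
      unfolding t_def using h_reflect[OF that] by simp
    obtain D where D: "D 0 = y" "\<And>x. x \<in> {0..1} \<Longrightarrow> D 2 x = f x (y x) / \<epsilon>\<^sup>2" "layer_bounded C m \<epsilon> D"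
      using C(2)[OF \<epsilon> y] by blast
    have xr: "x i \<in> {0..1}" if "i \<le> N" for i using x_range[OF that] by simp
    have "\<forall>i\<in>{..N}. \<exists>q. m \<le> q \<and> q \<le> \<gamma> \<and> f (x i) (y (x i)) - f (x i) (u i) = q * (y (x i) - u i)"
      using secant_bounds[OF xr] by simp
    then obtain q where q: "\<And>i. i \<le> N \<Longrightarrow>
        m \<le> q i \<and> q i \<le> \<gamma> \<and> f (x i) (y (x i)) - f (x i) (u i) = q i * (y (x i) - u i)"
      by (metis atMost_iff)
    define e where "e = (\<lambda>i. y (x i) - u i)"
    have \<phi>: "0 \<le> \<phi> i" if "i \<le> N" for i
      unfolding \<phi>_def using that t \<kappa>(1) by (intro less_imp_le[OF layer_barrier_bounds(1)]) (auto intro: less_imp_le)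
    have \<phi>_layer: "layer m \<epsilon> (x i) \<le> \<phi> i" if i: "i \<le> N" for i
    proof -
      have "\<kappa> * (\<Sum>j<i. t j) \<le> \<kappa> * (\<Sum>j<i. sqrt \<gamma> / \<epsilon> * h j / 2)"
      proof (intro mult_left_mono sum_mono \<kappa>(1))
        fix j assume "j \<in> {..<i}"
        then show "t j \<le> sqrt \<gamma> / \<epsilon> * h j / 2"
          unfolding t_def using i h_bounds(1)[of j] \<gamma>_pos \<epsilon> by (intro tanh_le_self) auto
      qed
      also have "\<dots> = (\<kappa> * sqrt \<gamma>) * x i / (2 * \<epsilon>)"
        using x_sum[OF i] by (simp add: sum_distrib_left sum_divide_distrib mult_ac)
      also have "\<kappa> * sqrt \<gamma> = sqrt m" unfolding \<kappa>_def using \<gamma>_pos by (simp add: real_sqrt_divide)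
      also have "sqrt m * x i / (2 * \<epsilon>) \<le> sqrt m * x i / \<epsilon>"
        using xr[OF i] m_pos \<epsilon> by (intro divide_left_mono) auto
      finally have "layer m \<epsilon> (x i) \<le> exp (- \<kappa> * (\<Sum>j<i. t j))" unfolding layer_def by simp
      also have "\<dots> \<le> \<phi> i" unfolding \<phi>_def
        using i t \<kappa>(1) by (intro exp_le_layer_barrier) (auto intro: less_imp_le)
      finally show ?thesis .
    qed
    define \<Phi> where "\<Phi> = (\<lambda>i. A / (real N)\<^sup>2 * (1 + \<Lambda>\<^sup>2 * (\<phi> i + \<phi> (N - i))))"
    have "\<bar>e i\<bar> \<le> \<Phi> i"
    proof (rule fitted_op_comparison[OF \<gamma>_pos m_pos, of N t q])
      show "0 < t i \<and> t i \<le> 1" if "i < N" for i using t[OF that] .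
      show "m \<le> q i \<and> q i \<le> \<gamma>" if "i \<le> N" for i using q[OF that] by simp
      have "u 0 = 0" "u N = 0" using u by (auto simp: discrete_solution_def discrete_T_def dest: spec[of _ 0] spec[of _ N])
      moreover have "x 0 = 0" "x N = 1" using x_sum[of 0] x_reflect[of 0] by auto
      ultimately show "e 0 = 0" "e N = 0" using y by (auto simp: e_def bvp_solution_def)
      show "0 \<le> \<Phi> i" if "i \<le> N" for i
        unfolding \<Phi>_def using A \<phi>[OF that] \<phi>[of "N - i"]
        by (intro mult_nonneg_nonneg divide_nonneg_nonneg add_nonneg_nonneg) auto
      show "i \<le> N" by fact
      fix j assume j: "Suc j < N"
      define T where "T = t j + t (Suc j)"
      have T: "0 < T" unfolding T_def using t[of j] t[of "Suc j"] j by auto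
      define P where "P = \<phi> (Suc j) + \<phi> (N - Suc j)"
      have "fitted_op \<gamma> t e (\<lambda>i. q i * e i) j
          = fitted_op \<gamma> t (\<lambda>i. y (x i) - u i) (\<lambda>i. f (x i) (y (x i)) - f (x i) (u i)) j"
        unfolding fitted_op_def e_def using q[of j] q[of "Suc j"] q[of "Suc (Suc j)"] j by simp
      also have "\<dots> = fitted_op \<gamma> t (\<lambda>i. y (x i)) (\<lambda>i. f (x i) (y (x i))) j"
        using discrete_solution_fitted_op[OF u j \<gamma>_pos \<epsilon>(1)] h_bounds(1)[of j] h_bounds(1)[of "Suc j"] j
        unfolding fitted_op_diff x_def[symmetric] h_def[symmetric] t_def[symmetric] by simp
      also have "\<dots> = truncation (sqrt \<gamma> / \<epsilon>) (D 0) (D 2) (x (Suc j)) (h j) (h (Suc j))"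
        unfolding h_def t_def D(1)
        by (rule truncation_eq_fitted_op[symmetric]) (use D(2) xr j \<gamma>_pos \<epsilon> in auto)
      finally have eq: "fitted_op \<gamma> t e (\<lambda>i. q i * e i) j
          = truncation (sqrt \<gamma> / \<epsilon>) (D 0) (D 2) (x (Suc j)) (h j) (h (Suc j))" .
      have "\<bar>fitted_op \<gamma> t e (\<lambda>i. q i * e i) j\<bar> \<le> B * T * (1 + \<Lambda>\<^sup>2 * layers m \<epsilon> (x (Suc j))) / (real N)\<^sup>2"
        using B(2)[OF mesh D(3) j] unfolding eq unfolding T_def t_def x_def[symmetric] h_def[symmetric] .
      also have "\<dots> \<le> B * T * (1 + \<Lambda>\<^sup>2 * P) / (real N)\<^sup>2"
      proof (intro divide_right_mono mult_left_mono add_left_mono)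
        have "layer m \<epsilon> (1 - x (Suc j)) \<le> \<phi> (N - Suc j)"
          using \<phi>_layer[of "N - Suc j"] x_reflect[of "Suc j"] j by simp
        then show "layers m \<epsilon> (x (Suc j)) \<le> P"
          unfolding layers_def P_def using \<phi>_layer[of "Suc j"] j by (intro add_mono) auto
      qed (use B(1) T in auto)
      finally have tr: "\<bar>fitted_op \<gamma> t e (\<lambda>i. q i * e i) j\<bar> \<le> B * T * (1 + \<Lambda>\<^sup>2 * P) / (real N)\<^sup>2" .
      have L1: "fitted_op \<gamma> t (\<lambda>i. 1) (\<lambda>i. m) j \<le> - (m / \<gamma>) * T"
      proof -
        have "fitted_op \<gamma> t (\<lambda>i. 1) (\<lambda>i. m) j = - (2 * (m / \<gamma> * T))"
          unfolding fitted_op_def T_def by (simp add: field_simps)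
        moreover have "0 \<le> m / \<gamma> * T" using m_pos \<gamma>_pos T by simp
        moreover have "- (2 * X) \<le> - X" if "0 \<le> X" for X :: real using that by simp
        ultimately show ?thesis unfolding mult_minus_left by metis
      qed
      have L2: "fitted_op \<gamma> t \<phi> (\<lambda>i. m * \<phi> i) j \<le> - (m / \<gamma>) * T * \<phi> (Suc j)"
        unfolding \<phi>_def T_def
        using t j m_pos \<gamma>_pos \<kappa> by (intro fitted_op_layer_barrier) auto
      have L3: "fitted_op \<gamma> t (\<lambda>i. \<phi> (N - i)) (\<lambda>i. m * \<phi> (N - i)) j \<le> - (m / \<gamma>) * T * \<phi> (N - Suc j)"
      proof -
        define k where "k = N - Suc (Suc j)"
        have k: "Suc k < N" "Suc k = N - Suc j" "t k = t (Suc j)" "t (Suc k) = t j"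
          using t_reflect[of j] t_reflect[of "Suc j"] j by (auto simp: k_def Suc_diff_Suc)
        have "fitted_op \<gamma> t (\<lambda>i. \<phi> (N - i)) (\<lambda>i. m * \<phi> (N - i)) j = fitted_op \<gamma> t \<phi> (\<lambda>i. m * \<phi> i) k"
          unfolding k_def using fitted_op_reverse[of j N t \<gamma> \<phi> "\<lambda>i. m * \<phi> i"] j t_reflect by simp
        also have "\<dots> \<le> - (m / \<gamma>) * (t k + t (Suc k)) * \<phi> (Suc k)"
          unfolding \<phi>_def using t k(1) m_pos \<gamma>_pos \<kappa> by (intro fitted_op_layer_barrier) auto
        finally show ?thesis unfolding k(3,4) unfolding k(2) T_def by (simp only: add.commute)
      qed
      have "fitted_op \<gamma> t \<Phi> (\<lambda>i. m * \<Phi> i) j = A / (real N)\<^sup>2 *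
          (fitted_op \<gamma> t (\<lambda>i. 1) (\<lambda>i. m) j + \<Lambda>\<^sup>2 *
            (fitted_op \<gamma> t \<phi> (\<lambda>i. m * \<phi> i) j + fitted_op \<gamma> t (\<lambda>i. \<phi> (N - i)) (\<lambda>i. m * \<phi> (N - i)) j))"
        unfolding \<Phi>_def fitted_op_add[symmetric] fitted_op_scale[symmetric]
        by (rule arg_cong2[where f = "\<lambda>a b. fitted_op \<gamma> t a b j"]) (auto simp: algebra_simps)
      also have "\<dots> \<le> A / (real N)\<^sup>2 * (- (m / \<gamma>) * T + \<Lambda>\<^sup>2 *
            (- (m / \<gamma>) * T * \<phi> (Suc j) + - (m / \<gamma>) * T * \<phi> (N - Suc j)))"
        using A L1 L2 L3 by (intro mult_left_mono add_mono) auto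
      also have "\<dots> = - (A * (m / \<gamma>) * T * (1 + \<Lambda>\<^sup>2 * P) / (real N)\<^sup>2)"
        unfolding P_def by (simp add: algebra_simps add_divide_distrib)
      also have "A * (m / \<gamma>) = B" unfolding A_def using m_pos \<gamma>_pos by simp
      finally show "\<bar>fitted_op \<gamma> t e (\<lambda>i. q i * e i) j\<bar> \<le> - fitted_op \<gamma> t \<Phi> (\<lambda>i. m * \<Phi> i) j"
        using tr by linarith
    qed
    then show ?thesis unfolding e_def \<Phi>_def \<phi>_def t_def x_def h_def by simp
  qed
  with A show ?thesis unfolding Let_def \<kappa>_def by blast
qed

lemma uniform_convergence:
  "\<exists>C>0. \<forall>(\<epsilon>::real) (N::nat) (y :: real \<Rightarrow> real) (ybar :: nat \<Rightarrow> real).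
           0 < \<epsilon> \<longrightarrow> \<epsilon> < 1 \<longrightarrow> N > 0 \<longrightarrow> 4 dvd N \<longrightarrow>
           bvp_solution \<epsilon> f y \<longrightarrow>
           discrete_solution f \<gamma> \<epsilon> N (mesh m \<epsilon> N) ybar \<longrightarrow>
           (\<forall>i\<le>N. \<bar>y (mesh m \<epsilon> N i) - ybar i\<bar> \<le>
              C * (if i \<in> {N div 4..3 * N div 4} then 1 / (real N)\<^sup>2
                   else (ln (real N))\<^sup>2 / (real N)\<^sup>2))"
proof -
  define \<kappa> where "\<kappa> = sqrt (m / \<gamma>)"
  have m\<gamma>: "m \<le> \<gamma>" using fy_bounds[of 0 0] by simp
  have \<kappa>: "0 < \<kappa>" "\<kappa> \<le> 1" "\<kappa>\<^sup>2 = m / \<gamma>" unfolding \<kappa>_def using m_pos \<gamma>_pos m\<gamma> by auto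
  obtain A where A: "0 \<le> A" "\<And>\<epsilon> n N y u i. shishkin_mesh m \<epsilon> n N \<Longrightarrow> bvp_solution \<epsilon> f y \<Longrightarrow>
     discrete_solution f \<gamma> \<epsilon> N (mesh m \<epsilon> N) u \<Longrightarrow> i \<le> N \<Longrightarrow>
      \<bar>y (mesh m \<epsilon> N i) - u i\<bar> \<le> A * (1 + (shishkin_mesh.\<Lambda> m \<epsilon> N)\<^sup>2 *
       (layer_barrier \<kappa> (\<lambda>i. tanh (sqrt \<gamma> / \<epsilon> * mesh_step (mesh m \<epsilon> N) i / 2)) i
        + layer_barrier \<kappa> (\<lambda>i. tanh (sqrt \<gamma> / \<epsilon> * mesh_step (mesh m \<epsilon> N) i / 2)) (N - i))) / (real N)\<^sup>2"
    using discrete_error_bound unfolding Let_def \<kappa>_def by blast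
  define Z where "Z = 4 * sqrt \<gamma> / sqrt m"
  define Q where "Q = 32 * (1 + Z)\<^sup>2 / m"
  have Q: "0 \<le> Q" unfolding Q_def using m_pos by simp
  define C where "C = A * (1 + 2 * Q) + A * (1 + 8 / m) + 1"
  have C: "A * (1 + 2 * Q) \<le> C" "A * (1 + 8 / m) \<le> C" "0 < C"
    unfolding C_def using A(1) Q m_pos by (auto intro: add_nonneg_pos)
  have "\<bar>y (mesh m \<epsilon> N i) - u i\<bar> \<le>
              C * (if i \<in> {N div 4..3 * N div 4} then 1 / (real N)\<^sup>2
                   else (ln (real N))\<^sup>2 / (real N)\<^sup>2)"
    if "0 < \<epsilon>" "\<epsilon> < 1" "N > 0" "4 dvd N" and y: "bvp_solution \<epsilon> f y"
      and u: "discrete_solution f \<gamma> \<epsilon> N (mesh m \<epsilon> N) u" and i: "i \<le> N" for \<epsilon> N y u i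
  proof -
    obtain n where n: "N = 4 * n" using \<open>4 dvd N\<close> by (rule dvdE)
    have "0 < n" using \<open>N > 0\<close> n by simp
    interpret shishkin_mesh m \<epsilon> n N by unfold_locales (use that n \<open>0 < n\<close> m_pos in auto)
    define t where "t = (\<lambda>i. tanh (sqrt \<gamma> / \<epsilon> * h i / 2))"
    define \<phi> where "\<phi> = layer_barrier \<kappa> t"
    have t: "0 \<le> t i" if "i < N" for i
      unfolding t_def using h_bounds(1)[OF that] \<epsilon> \<gamma>_pos by (auto intro: less_imp_le)
    have err: "\<bar>y (mesh m \<epsilon> N i) - u i\<bar> \<le> A * (1 + \<Lambda>\<^sup>2 * (\<phi> i + \<phi> (N - i))) / (real N)\<^sup>2"
      using A(2)[OF shishkin_mesh_axioms y u i] unfolding \<phi>_def t_def h_def x_def .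
    show ?thesis
    proof (cases "i \<in> {N div 4..3 * N div 4}")
      case True
      have i': "n \<le> i" "n \<le> N - i" "i \<le> N" using True n by auto
      define z where "z = sqrt \<gamma> / \<epsilon> * (4 * l / N) / 2"
      have nz: "real n * z = sqrt \<gamma> * \<Lambda> / 2"
        unfolding z_def \<Lambda>_def using N_bounds by (simp add: field_simps)
      have "z \<le> sqrt \<gamma> / \<epsilon> * (8 / sqrt m * \<epsilon>) / 2"
        unfolding z_def using fine_step_le \<gamma>_pos \<epsilon> by (intro divide_right_mono mult_left_mono) auto
      then have zZ: "z \<le> Z" unfolding Z_def using \<epsilon> by simp
      have z0: "0 < z" unfolding z_def using l_bounds \<gamma>_pos \<epsilon> N_bounds by simp
      have "\<phi> n * (real n * z)\<^sup>2 \<le> 8 * (1 + Z)\<^sup>2 / \<kappa>\<^sup>2"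
        unfolding \<phi>_def using h_fine by (intro layer_barrier_uniform_decay z0 zZ \<kappa>) (auto simp: t_def z_def)
      then have "\<phi> n * (\<gamma> * \<Lambda>\<^sup>2 / 4) \<le> 8 * (1 + Z)\<^sup>2 / (m / \<gamma>)"
        unfolding nz \<kappa>(3) using \<gamma>_pos by (simp add: power_mult_distrib power_divide)
      then have Qn: "\<Lambda>\<^sup>2 * \<phi> n \<le> Q" unfolding Q_def using \<gamma>_pos m_pos by (simp add: field_simps)
      have mono: "\<phi> k \<le> \<phi> n" if "n \<le> k" "k \<le> N" for k
        unfolding \<phi>_def using that t \<kappa>(1) by (intro layer_barrier_antimono) auto
      have "\<Lambda>\<^sup>2 * (\<phi> i + \<phi> (N - i)) \<le> \<Lambda>\<^sup>2 * (\<phi> n + \<phi> n)"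
        using mono i' by (intro mult_left_mono add_mono) auto
      also have "\<dots> \<le> 2 * Q" using Qn by (simp add: distrib_left)
      finally have "A * (1 + \<Lambda>\<^sup>2 * (\<phi> i + \<phi> (N - i))) \<le> A * (1 + 2 * Q)"
        using A(1) by (intro mult_left_mono) auto
      with C(1) have "A * (1 + \<Lambda>\<^sup>2 * (\<phi> i + \<phi> (N - i))) \<le> C" by linarith
      from divide_right_mono[OF this, of "(real N)\<^sup>2"] err True show ?thesis by simp
    next
      case False
      have "\<phi> k \<le> 1" if "k \<le> N" for k
        unfolding \<phi>_def using that t \<kappa>(1) by (intro layer_barrier_bounds) auto
      then have \<phi>: "\<phi> i \<le> 1" "\<phi> (N - i) \<le> 1" using i by auto
      have "\<Lambda>\<^sup>2 * (\<phi> i + \<phi> (N - i)) \<le> (2 * ln (real N) / sqrt m)\<^sup>2 * 2"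
        using \<Lambda>_bounds \<phi> by (intro order_trans[OF mult_left_mono mult_right_mono] power_mono) auto
      also have "\<dots> = 8 / m * (ln (real N))\<^sup>2" using m_pos by (simp add: power_divide power_mult_distrib)
      finally have "1 + \<Lambda>\<^sup>2 * (\<phi> i + \<phi> (N - i)) \<le> (1 + 8 / m) * (ln (real N))\<^sup>2"
        using power_mono[OF ln_N(1), of 2] by (simp add: distrib_right)
      then have "A * (1 + \<Lambda>\<^sup>2 * (\<phi> i + \<phi> (N - i))) \<le> A * ((1 + 8 / m) * (ln (real N))\<^sup>2)"
        using A(1) by (intro mult_left_mono) auto
      also have "\<dots> \<le> C * (ln (real N))\<^sup>2"
        using mult_right_mono[OF C(2), of "(ln (real N))\<^sup>2"] by (simp add: mult.assoc)
      finally have "A * (1 + \<Lambda>\<^sup>2 * (\<phi> i + \<phi> (N - i))) \<le> C * (ln (real N))\<^sup>2" .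
      from divide_right_mono[OF this, of "(real N)\<^sup>2"] err False show ?thesis by auto
    qed
  qed
  with C(3) show ?thesis by blast
qed

end

theorem theorem5p1:
  fixes f :: "real \<Rightarrow> real \<Rightarrow> real" and m \<gamma> :: real and k :: nat
  assumes "k \<ge> 2" and "Ck_strip k f"
    and "m > 0"
    and "\<And>x y. x \<in> {0..1} \<Longrightarrow> deriv (\<lambda>v. f x v) y \<ge> m"
    and "\<And>x y. x \<in> {0..1} \<Longrightarrow> \<gamma> \<ge> deriv (\<lambda>v. f x v) y"
  shows "\<exists>C>0. \<forall>(\<epsilon>::real) (N::nat) (y :: real \<Rightarrow> real) (ybar :: nat \<Rightarrow> real).
           0 < \<epsilon> \<longrightarrow> \<epsilon> < 1 \<longrightarrow> N > 0 \<longrightarrow> 4 dvd N \<longrightarrow>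
           bvp_solution \<epsilon> f y \<longrightarrow>
           discrete_solution f \<gamma> \<epsilon> N (mesh m \<epsilon> N) ybar \<longrightarrow>
           (\<forall>i\<le>N. \<bar>y (mesh m \<epsilon> N i) - ybar i\<bar> \<le>
              C * (if i \<in> {N div 4..3 * N div 4} then 1 / (real N)\<^sup>2
                   else (ln (real N))\<^sup>2 / (real N)\<^sup>2))"
proof -
  have "Ck_strip (Suc (Suc 0)) f"
    by (rule Ck_strip_mono[OF assms(2)]) (use assms(1) in simp)
  then obtain fx fy where f: "continuous_on ({0..1} \<times> UNIV) (\<lambda>(x, y). f x y)"
    "\<forall>x\<in>{0..1}. \<forall>y. ((\<lambda>s. f s y) has_real_derivative fx x y) (at x within {0..1}) \<and>
        ((\<lambda>v. f x v) has_real_derivative fy x y) (at y)"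
    "Ck_strip (Suc 0) fx" "Ck_strip (Suc 0) fy"
    unfolding Ck_strip.simps(2)[of "Suc 0" f] by blast
  obtain fxx fxy where fx: "continuous_on ({0..1} \<times> UNIV) (\<lambda>(x, y). fx x y)"
    "\<forall>x\<in>{0..1}. \<forall>y. ((\<lambda>s. fx s y) has_real_derivative fxx x y) (at x within {0..1}) \<and>
        ((\<lambda>v. fx x v) has_real_derivative fxy x y) (at y)"
    "Ck_strip 0 fxx" "Ck_strip 0 fxy"
    using f(3) unfolding Ck_strip.simps(2)[of 0 fx] by blast
  obtain fyx fyy where fy: "continuous_on ({0..1} \<times> UNIV) (\<lambda>(x, y). fy x y)"
    "\<forall>x\<in>{0..1}. \<forall>y. ((\<lambda>s. fy s y) has_real_derivative fyx x y) (at x within {0..1}) \<and>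
        ((\<lambda>v. fy x v) has_real_derivative fyy x y) (at y)"
    "Ck_strip 0 fyx" "Ck_strip 0 fyy"
    using f(4) unfolding Ck_strip.simps(2)[of 0 fy] by blast
  interpret monotone_C2_reaction f fx fy fxx fxy fyx fyy m \<gamma>
  proof
    show "continuous_on ({0..1} \<times> UNIV) (\<lambda>(x, y). g x y)" if "g \<in> {f, fx, fy, fxx, fxy, fyx, fyy}" for g
      using that f(1) fx(1,3,4) fy(1,3,4) by auto
    show "m \<le> fy x y \<and> fy x y \<le> \<gamma>" if "x \<in> {0..1}" for x y
    proof -
      have "deriv (\<lambda>v. f x v) y = fy x y" using f(2) that by (intro DERIV_imp_deriv) blast
      then show ?thesis using assms(4,5)[OF that, of y] by simp
    qed
  qed (use f(2) fx(2) fy(2) assms(3) in auto)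
  show ?thesis by (rule uniform_convergence)
qed

end
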